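(* For every integer $r\in\mathbb{N}$ and every real $\epsilon>0$ there is an algorithm (called FindITorBD) that takes as input a graph $G$ together with a partition $(V_1,\dots,V_m)$ of $V(G)$ such that $G$ is $r$-claw-free with respect to $(V_1,\dots,V_m)$, and outputs either: (1) an independent transversal of $G$ with respect to $(V_1,\dots,V_m)$; or (2) a set $\mathcal{B}\subseteq\{V_1,\dots,V_m\}$ of vertex classes and a set $D\subseteq V(G)$ such that $D$ dominates $G_{\mathcal{B}}$ in $G$ and $|D|<(2+\epsilon)(|\mathcal{B}|-1)$, and moreover $D\supseteq V(K)$ for some constellation $K$ for some set of classes $\mathcal{B}_0\supseteq\mathcal{B}$, with $|D\setminus V(K)|<\epsilon(|\mathcal{B}|-1)$. For fixed $r$ and $\epsilon$, the running time of the algorithm is polynomial in $|V(G)|$.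
   Context: Let $G$ be a graph with a partition $(V_1,\dots,V_m)$ of its vertex set into vertex classes. An independent transversal (IT) is an independent set $\{v_1,\dots,v_m\}$ of $G$ with $v_i\in V_i$ for each $i$. $G$ is $r$-claw-free with respect to $(V_1,\dots,V_m)$ if no vertex of $G$ has $r$ pairwise non-adjacent neighbours lying in $r$ distinct vertex classes. For $\mathcal{B}\subseteq\{V_1,\dots,V_m\}$, $G_{\mathcal{B}}$ denotes the graph obtained from the subgraph of $G$ induced by $\bigcup_{V_i\in\mathcal{B}}V_i$ by deleting all edges with both ends in the same class. A set $D\subseteq V(G)$ dominates a subgraph $W$ (in $G$) if every vertex $w\in V(W)$ has a neighbour $u\in D$, i.e. $uw\in E(G)$ (total domination). A constellation for a set $\mathcal{B}$ of vertex classes is an induced subgraph $K$ of $G_{\mathcal{B}}$ each of whose components is a star with at least two vertices, with a designated centre and a nonempty set of leaves distinct from the centre, such that the set of all leaves of $K$ forms an IT of some $|\mathcal{B}|-1$ of the vertex classes in $\mathcal{B}$ (i.e. it is independent and contains exactly one vertex from each of $|\mathcal{B}|-1$ distinct classes of $\mathcal{B}$). *)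

theory Defs
  imports
    "Graph_Theory.Digraph_Component"
    "HOL-Library.Disjoint_Sets"
    "HOL-Computational_Algebra.Polynomial"
begin

section \<open>Graphs with vertex classes\<close>

text \<open>
  A finite simple graph is a \<open>pair_graph\<close>: a finite vertex set together with a finite, symmetric
  and irreflexive set of ordered pairs. An edge \<open>uv\<close> is thus the pair of arcs \<open>(u, v)\<close>, \<open>(v, u)\<close>.
\<close>

text \<open>The classes are listed as \<open>V\<^sub>1, \<dots>, V\<^sub>m\<close>; \<open>partition_on\<close> makes them nonempty and disjoint.\<close>

definition vertex_partition :: "'a pair_pre_digraph \<Rightarrow> 'a set list \<Rightarrow> bool" where
  "vertex_partition G Vs \<longleftrightarrow> distinct Vs \<and> partition_on (pverts G) (set Vs)"

definition independent_set :: "'a pair_pre_digraph \<Rightarrow> 'a set \<Rightarrow> bool" where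
  "independent_set G S \<longleftrightarrow> S \<subseteq> pverts G \<and> (\<forall>u\<in>S. \<forall>v\<in>S. (u, v) \<notin> parcs G)"

definition independent_transversal ::
    "'a pair_pre_digraph \<Rightarrow> 'a set set \<Rightarrow> 'a set \<Rightarrow> bool" where
  "independent_transversal G \<C> T \<longleftrightarrow>
     independent_set G T \<and> (\<exists>v. (\<forall>X\<in>\<C>. v X \<in> X) \<and> T = v ` \<C>)"

definition claw_free_wrt :: "nat \<Rightarrow> 'a pair_pre_digraph \<Rightarrow> 'a set set \<Rightarrow> bool" where
  "claw_free_wrt r G \<C> \<longleftrightarrow>
     \<not> (\<exists>v\<in>pverts G. \<exists>S. finite S \<and> card S = r \<and> (\<forall>u\<in>S. (v, u) \<in> parcs G) \<and>
          independent_set G S \<and> (\<forall>X\<in>\<C>. \<forall>u\<in>S \<inter> X. \<forall>w\<in>S \<inter> X. u = w))"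

definition class_graph :: "'a pair_pre_digraph \<Rightarrow> 'a set set \<Rightarrow> 'a pair_pre_digraph" where
  "class_graph G \<B> =
     \<lparr> pverts = \<Union>\<B>,
       parcs = {(u, v) \<in> parcs G. u \<in> \<Union>\<B> \<and> v \<in> \<Union>\<B> \<and> \<not> (\<exists>X\<in>\<B>. u \<in> X \<and> v \<in> X)} \<rparr>"

text \<open>Total domination: a vertex of \<open>W\<close> lying in \<open>D\<close> needs a neighbour in \<open>D\<close> as well.\<close>

definition totally_dominates :: "'a pair_pre_digraph \<Rightarrow> 'a set \<Rightarrow> 'a pair_pre_digraph \<Rightarrow> bool" where
  "totally_dominates G D W \<longleftrightarrow> (\<forall>w\<in>pverts W. \<exists>u\<in>D. (u, w) \<in> parcs G)"

definition star_with_centre :: "('a, 'a \<times> 'a) pre_digraph \<Rightarrow> 'a \<Rightarrow> bool" where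
  "star_with_centre C c \<longleftrightarrow>
     c \<in> verts C \<and> verts C - {c} \<noteq> {} \<and>
     arcs C = {c} \<times> (verts C - {c}) \<union> (verts C - {c}) \<times> {c}"

text \<open>
  For a symmetric digraph the strongly connected components \<open>sccs\<close> are the connected components.
  The function \<open>centre\<close> designates the centre of each component; this is a genuine choice when a
  component is a single edge.
\<close>

definition constellation ::
    "'a pair_pre_digraph \<Rightarrow> 'a set set \<Rightarrow> 'a pair_pre_digraph \<Rightarrow> bool" where
  "constellation G \<B> K \<longleftrightarrow>
     induced_subgraph (with_proj K) (with_proj (class_graph G \<B>)) \<and>
     (\<exists>centre.
        (\<forall>C\<in>pre_digraph.sccs (with_proj K). star_with_centre C (centre C)) \<and>
        (\<exists>\<C>\<subseteq>\<B>. card \<C> + 1 = card \<B> \<and>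
           independent_transversal G \<C>
             (\<Union>C\<in>pre_digraph.sccs (with_proj K). verts C - {centre C})))"


section \<open>Algorithms and their running time\<close>

text \<open>
  The model of computation is a first-order, call-by-value functional language over binary trees
  (pure first-order Lisp with a single atom). A program is a finite list of function bodies that
  may call each other recursively by their position in the list; function \<open>0\<close> is the main
  function. Variables are de Bruijn indices into the environment of parameters and local bindings.

  Every evaluated subexpression costs one unit. A program has a fixed finite text, the only test
  is whether a tree is a leaf, and trees can be represented by pointers into a shared heap, so that
  each unit of cost is a bounded number of pointer operations. Up to a polynomial, the cost is
  therefore the running time on a Turing machine.
\<close>

datatype data = Leaf | Branch data data

datatype expr =
    Var nat
  | MkLeaf
  | MkBranch expr expr
  | Left expr
  | Right expr
  | IfBranch expr expr expr
  | LetIn expr expr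
  | Call nat "expr list"

type_synonym program = "expr list"

fun left :: "data \<Rightarrow> data" where
  "left Leaf = Leaf"
| "left (Branch a b) = a"

fun right :: "data \<Rightarrow> data" where
  "right Leaf = Leaf"
| "right (Branch a b) = b"

text \<open>\<open>eval P env e x t\<close>: in environment \<open>env\<close>, expression \<open>e\<close> evaluates to \<open>x\<close> at cost \<open>t\<close>.\<close>

inductive eval :: "program \<Rightarrow> data list \<Rightarrow> expr \<Rightarrow> data \<Rightarrow> nat \<Rightarrow> bool"
  and evals :: "program \<Rightarrow> data list \<Rightarrow> expr list \<Rightarrow> data list \<Rightarrow> nat \<Rightarrow> bool"
  for P :: program where
  eval_Var: "i < length env \<Longrightarrow> eval P env (Var i) (env ! i) 1"
| eval_MkLeaf: "eval P env MkLeaf Leaf 1"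
| eval_MkBranch: "eval P env a x s \<Longrightarrow> eval P env b y t \<Longrightarrow>
    eval P env (MkBranch a b) (Branch x y) (s + t + 1)"
| eval_Left: "eval P env a x t \<Longrightarrow> eval P env (Left a) (left x) (t + 1)"
| eval_Right: "eval P env a x t \<Longrightarrow> eval P env (Right a) (right x) (t + 1)"
| eval_If_Branch: "eval P env c x s \<Longrightarrow> x \<noteq> Leaf \<Longrightarrow> eval P env a y t \<Longrightarrow>
    eval P env (IfBranch c a b) y (s + t + 1)"
| eval_If_Leaf: "eval P env c x s \<Longrightarrow> x = Leaf \<Longrightarrow> eval P env b y t \<Longrightarrow>
    eval P env (IfBranch c a b) y (s + t + 1)"
| eval_Let: "eval P env a x s \<Longrightarrow> eval P (x # env) b y t \<Longrightarrow>
    eval P env (LetIn a b) y (s + t + 1)"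
| eval_Call: "evals P env as xs s \<Longrightarrow> f < length P \<Longrightarrow> eval P xs (P ! f) y t \<Longrightarrow>
    eval P env (Call f as) y (s + t + 1)"
| evals_Nil: "evals P env [] [] 0"
| evals_Cons: "eval P env a x s \<Longrightarrow> evals P env as xs t \<Longrightarrow>
    evals P env (a # as) (x # xs) (s + t)"

text \<open>Result and cost are determined by the program and the input.\<close>

lemma eval_deterministic:
  "eval P env e x t \<Longrightarrow> eval P env e x' t' \<Longrightarrow> x = x' \<and> t = t'"
  "evals P env as xs s \<Longrightarrow> evals P env as xs' s' \<Longrightarrow> xs = xs' \<and> s = s'"
proof (induction arbitrary: x' t' and xs' s' rule: eval_evals.inducts)
  case (eval_Var i env)
  then show ?case by (auto elim: eval.cases)
next
  case (eval_MkLeaf env)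
  then show ?case by (auto elim: eval.cases)
next
  case (eval_MkBranch env a x s b y t)
  from eval_MkBranch.prems show ?case
    by (cases rule: eval.cases) (use eval_MkBranch.IH in \<open>blast+\<close>)
next
  case (eval_Left env a x t)
  from eval_Left.prems show ?case
    by (cases rule: eval.cases) (use eval_Left.IH in \<open>blast+\<close>)
next
  case (eval_Right env a x t)
  from eval_Right.prems show ?case
    by (cases rule: eval.cases) (use eval_Right.IH in \<open>blast+\<close>)
next
  case (eval_If_Branch env c x s a y t b)
  from eval_If_Branch.prems show ?case
    by (cases rule: eval.cases) (use eval_If_Branch.IH eval_If_Branch.hyps in \<open>blast+\<close>)
next
  case (eval_If_Leaf env c x s b y t a)
  from eval_If_Leaf.prems show ?case
    by (cases rule: eval.cases) (use eval_If_Leaf.IH eval_If_Leaf.hyps in \<open>blast+\<close>)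
next
  case (eval_Let env a x s b y t)
  from eval_Let.prems show ?case
    by (cases rule: eval.cases) (use eval_Let.IH in \<open>blast+\<close>)
next
  case (eval_Call env as xs s f y t)
  from eval_Call.prems show ?case
    by (cases rule: eval.cases) (use eval_Call.IH in \<open>blast+\<close>)
next
  case (evals_Nil env)
  then show ?case by (auto elim: evals.cases)
next
  case (evals_Cons env a x s as xs t)
  from evals_Cons.prems show ?case
    by (cases rule: evals.cases) (use evals_Cons.IH in \<open>blast+\<close>)
qed

definition runs :: "program \<Rightarrow> data \<Rightarrow> data \<Rightarrow> nat \<Rightarrow> bool" where
  "runs P x y t \<longleftrightarrow> P \<noteq> [] \<and> eval P [x] (P ! 0) y t"


section \<open>Encoding of inputs and outputs\<close>

fun enc_list :: "data list \<Rightarrow> data" where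
  "enc_list [] = Leaf"
| "enc_list (x # xs) = Branch x (enc_list xs)"

text \<open>Numbers are written in unary; all encoded numbers are below the number of vertices.\<close>

definition enc_nat :: "nat \<Rightarrow> data" where
  "enc_nat n = enc_list (replicate n Leaf)"

definition enc_bool :: "bool \<Rightarrow> data" where
  "enc_bool b = (if b then Branch Leaf Leaf else Leaf)"

definition enc_nats :: "nat list \<Rightarrow> data" where
  "enc_nats ns = enc_list (map enc_nat ns)"

text \<open>
  A graph on the vertices \<open>0, \<dots>, n - 1\<close> is given by its adjacency matrix, and the partition by the
  list of its classes, each being the increasing list of its elements.
\<close>

definition enc_input :: "nat pair_pre_digraph \<Rightarrow> nat set list \<Rightarrow> data" where
  "enc_input G Vs =
     (let n = card (pverts G) in
      Branch
        (enc_list (map (\<lambda>u. enc_list (map (\<lambda>v. enc_bool ((u, v) \<in> parcs G)) [0..<n])) [0..<n]))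
        (enc_list (map (\<lambda>X. enc_nats (sorted_list_of_set X)) Vs)))"

text \<open>
  The first component of an output says which of the two outcomes is returned. A set of vertices
  is output as a list of its elements, a set of classes as a list of (0-based) class indices.
\<close>

definition enc_IT :: "nat list \<Rightarrow> data" where
  "enc_IT vs = Branch (enc_bool False) (enc_nats vs)"

definition enc_BD :: "nat list \<Rightarrow> nat list \<Rightarrow> data" where
  "enc_BD is ds = Branch (enc_bool True) (Branch (enc_nats is) (enc_nats ds))"

end

theory Submission
  imports Defs
begin

text \<open>
  Let \<open>M\<close> be a partial independent transversal and \<open>a\<close> a vertex of a class that \<open>M\<close> misses. Layers of
  centres are grown from the class of \<open>a\<close>: a new layer takes at most one vertex from each class reached
  so far (the class of \<open>a\<close> and the classes of the leaves, i.e. the \<open>M\<close>-neighbours of earlier centres),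
  each of them adjacent to no earlier centre or leaf. If a new layer is short compared with the number
  \<open>t\<close> of leaves, the reached classes that contribute nothing to it are dominated by all centres and
  leaves, and the stars of the old layers form the constellation. Otherwise the layer is kept.

  A centre without \<open>M\<close>-neighbours can replace the vertex of \<open>M\<close> in its class. Such swaps are delayed
  until the top layer contains at least \<open>t / k\<^sup>2\<close> of these centres; then either one of them lies in the
  class of \<open>a\<close> and enlarges \<open>M\<close>, or by averaging some lower layer loses a \<open>1 / k\<^sup>2\<close> fraction of its
  leaves at once, and everything above it is discarded. Claw-freeness bounds the leaves of a fresh
  layer by a multiple of \<open>t\<close>, so a layer is hit only boundedly often, and the number of leaves grows
  geometrically with the number of layers, so there are \<open>O(log n)\<close> layers. Reading the remaining hits
  of the layers as the digits of a number in a fixed base gives a decreasing potential that is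
  polynomially bounded. Finally \<open>k\<close> is chosen with \<open>\<epsilon> (k - 2) > r + 4\<close>.
\<close>

section \<open>The algorithm on lists of vertices\<close>

text \<open>Call a centre without \<open>M\<close>-neighbours idle. If idle centres were swapped as
  soon as they appear, a hit might remove a single leaf; digits up to n in logarithmically many
  positions bound the number of rounds only superpolynomially. If every hit removes a fixed fraction
  of the leaves, the base of the digits depends on \<open>r\<close> and \<open>k\<close> alone.

  The price is that idle centres stay in the layers. The threshold \<open>t / k\<^sup>2\<close>
  keeps them harmless: a layer \<open>N\<close> is kept only if \<open>t \<le> k * length N\<close>,
  so in a stuck layer at most a fraction \<open>1 / k\<close> of the centres is idle, and the others
  own disjoint nonempty sets of leaves. Hence the leaves still grow geometrically, and idle centres
  form only a small part of the dominating set.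

  A batch does not spoil the layers that it keeps. The vertices entering \<open>M\<close> are
  centres of the top layer, so they are adjacent to no lower centre and become leaves of none; the
  vertices leaving \<open>M\<close> are leaves of the layer that is hit, so the layers below it lose
  nothing. Leaves are recomputed from \<open>M\<close>, and the state consists of \<open>M\<close>
  and the lists of centres only.\<close>

definition related :: "('a \<Rightarrow> 'b \<Rightarrow> bool) \<Rightarrow> 'b list \<Rightarrow> 'a list \<Rightarrow> 'a list" where
  "related R xs ys = filter (\<lambda>y. \<exists>x\<in>set xs. R y x) ys"

definition unrelated :: "('a \<Rightarrow> 'b \<Rightarrow> bool) \<Rightarrow> 'b list \<Rightarrow> 'a list \<Rightarrow> 'a list" where
  "unrelated R xs ys = filter (\<lambda>y. \<not> (\<exists>x\<in>set xs. R y x)) ys"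

lemma set_related: "set (related R xs ys) = {y \<in> set ys. \<exists>x\<in>set xs. R y x}"
  by (auto simp: related_def)

lemma set_unrelated: "set (unrelated R xs ys) = {y \<in> set ys. \<forall>x\<in>set xs. \<not> R y x}"
  by (auto simp: unrelated_def)

lemma set_related_subset: "set (related R xs ys) \<subseteq> set ys"
  by (auto simp: related_def)

lemma distinct_related: "distinct ys \<Longrightarrow> distinct (related R xs ys)"
  by (simp add: related_def)

lemma distinct_unrelated: "distinct ys \<Longrightarrow> distinct (unrelated R xs ys)"
  by (simp add: unrelated_def)

lemma length_related_unrelated:
  "length (related R xs ys) + length (unrelated R xs ys) = length ys"
  unfolding related_def unrelated_def by (rule sum_length_filter_compl)

lemma length_related_le: "length (related R xs ys) \<le> length ys"
  by (simp add: related_def)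

lemma length_unrelated_le: "length (unrelated R xs ys) \<le> length ys"
  by (simp add: unrelated_def)

lemma related_append: "related R xs (ys @ zs) = related R xs ys @ related R xs zs"
  by (simp add: related_def)

lemma unrelated_append: "unrelated R xs (ys @ zs) = unrelated R xs ys @ unrelated R xs zs"
  by (simp add: unrelated_def)

text \<open>The default 0 matches \<open>left Leaf = Leaf\<close>: taking \<open>Left\<close> of an
  encoded list gives the encoded head even for the empty list.\<close>

definition head :: "nat list \<Rightarrow> nat" where
  "head xs = (case xs of [] \<Rightarrow> 0 | x # _ \<Rightarrow> x)"

lemma head_eq_hd: "xs \<noteq> [] \<Longrightarrow> head xs = hd xs"
  by (cases xs) (auto simp: head_def)

lemma head_Cons [simp]: "head (x # xs) = x" by (simp add: head_def)

datatype outcome =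
    IT "nat list"
  | BD "nat list" "nat list"
  | Continue "nat list" "nat list list"

locale partitioned_graph =
  fixes G :: "nat pair_pre_digraph" and Vs :: "nat set list" and r k :: nat
  assumes graph: "pair_graph G"
    and verts: "pverts G = {..<card (pverts G)}"
    and part: "vertex_partition G Vs"
    and claw_free: "claw_free_wrt r G (set Vs)"
    and k_ge: "k \<ge> 3"
begin

definition E :: "nat \<Rightarrow> nat \<Rightarrow> bool" where "E u v \<longleftrightarrow> (u, v) \<in> parcs G"

definition cs :: "nat list list" where "cs = map sorted_list_of_set Vs"

text \<open>Phrased over the lists \<open>cs\<close> because this is the test that the program
  performs; \<open>S_iff\<close> is the version over the classes themselves.\<close>

definition S :: "nat \<Rightarrow> nat \<Rightarrow> bool" where
  "S u v \<longleftrightarrow> (\<exists>c\<in>set cs. u \<in> set c \<and> v \<in> set c)"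

text \<open>
  \<open>M\<close> is the partial transversal, \<open>X\<close> the list of all centres, \<open>T\<close> contains one vertex of each class
  reached so far, and \<open>N\<close> is the new layer. Lists of layers have the newest layer first.
\<close>

fun build :: "nat list \<Rightarrow> nat list \<Rightarrow> nat list \<Rightarrow> nat list \<Rightarrow> nat list list \<Rightarrow> nat list" where
  "build M X T N [] = N"
| "build M X T N (c # ds) = build M X T
     (if \<exists>z\<in>set T. S (hd c) z
      then (case unrelated E (N @ X @ related E (N @ X) M) c of [] \<Rightarrow> N | v # _ \<Rightarrow> v # N)
      else N) ds"

fun class_indices :: "nat list \<Rightarrow> nat list \<Rightarrow> nat \<Rightarrow> nat list list \<Rightarrow> nat list" where
  "class_indices T N i [] = []"
| "class_indices T N i (c # ds) =
     (if (\<exists>z\<in>set T. S (hd c) z) \<and> \<not> (\<exists>z\<in>set N. S (hd c) z)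
      then i # class_indices T N (Suc i) ds else class_indices T N (Suc i) ds)"

text \<open>The scan runs downwards from the layer below the top, and a hit drops everything above
  the layer that is hit. When it reaches the empty list, some centre of \<open>imm\<close> lies in
  the class of \<open>a\<close>; this is proved in \<open>hit_correct\<close>.\<close>

fun hit :: "nat \<Rightarrow> nat list \<Rightarrow> nat list \<Rightarrow> nat list list \<Rightarrow> outcome" where
  "hit a M imm [] = Continue (head (related S [a] imm) # M) []"
| "hit a M imm (N # Ls) =
     (let y = related E N M; q = related S y imm in
      if q \<noteq> [] \<and> length y \<le> k * (k * length q)
      then Continue (q @ unrelated S q M) (N # Ls) else hit a M imm Ls)"

definition grow :: "nat \<Rightarrow> nat list \<Rightarrow> nat list list \<Rightarrow> outcome" where
  "grow a M Ls =
     (let X = concat Ls; y = related E X M; N = build M X (a # y) [] cs in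
      if k * length N < length y
      then BD (class_indices (a # y) N 0 cs) (N @ X @ related E (N @ X) M)
      else Continue M (N # Ls))"

definition tick :: "nat list \<Rightarrow> nat list list \<Rightarrow> outcome" where
  "tick M Ls = (case unrelated S M (map hd cs) of [] \<Rightarrow> IT M
     | a # _ \<Rightarrow> (case Ls of [] \<Rightarrow> grow a M Ls
        | N # R \<Rightarrow> let imm = unrelated E M N in
            if imm \<noteq> [] \<and> length (related E (concat R) M) \<le> k * (k * length imm)
            then hit a M imm R else grow a M Ls))"

abbreviation "V \<equiv> pverts G"
abbreviation "n \<equiv> card (pverts G)"

section \<open>Adjacency and classes\<close>

lemma E_sym: "E u v \<Longrightarrow> E v u"
proof -
  interpret pair_graph G by (rule graph)
  show "E u v \<Longrightarrow> E v u" unfolding E_def by (rule arcs_symmetric)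
qed

lemma E_irrefl: "\<not> E u u"
proof -
  interpret pair_graph G by (rule graph)
  show ?thesis unfolding E_def using no_loops by fastforce
qed

lemma finite_V: "finite V" using verts by (metis finite_lessThan)

lemma partition: "distinct Vs" "\<Union>(set Vs) = V" "\<And>X Y. X \<in> set Vs \<Longrightarrow> Y \<in> set Vs \<Longrightarrow> X \<noteq> Y \<Longrightarrow> X \<inter> Y = {}"
  "{} \<notin> set Vs"
  using part by (auto simp: vertex_partition_def partition_on_def disjoint_def)

lemma finite_class: "X \<in> set Vs \<Longrightarrow> finite X"
  using partition(2) finite_V by (metis Union_upper finite_subset)

lemma set_cs: "set ` set cs = set Vs"
  unfolding cs_def using finite_class by (auto simp: image_image)

lemma S_iff: "S u v \<longleftrightarrow> (\<exists>X\<in>set Vs. u \<in> X \<and> v \<in> X)"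
  unfolding S_def set_cs[symmetric] by auto

lemma S_sym: "S u v \<Longrightarrow> S v u" unfolding S_def by auto

lemma S_trans: "S u v \<Longrightarrow> S v w \<Longrightarrow> S u w"
  unfolding S_iff using partition(3) by blast

lemma S_refl: "v \<in> V \<Longrightarrow> S v v" unfolding S_iff using partition(2) by blast

lemma cs_nonempty: "c \<in> set cs \<Longrightarrow> c \<noteq> []"
  using partition(4) finite_class unfolding cs_def by auto

lemma cs_subset: "c \<in> set cs \<Longrightarrow> set c \<subseteq> V"
  using partition(2) set_cs by blast

lemma hd_cs: "c \<in> set cs \<Longrightarrow> hd c \<in> set c" using cs_nonempty by simp

lemma S_class: "c \<in> set cs \<Longrightarrow> v \<in> set c \<Longrightarrow> S v w \<longleftrightarrow> w \<in> set c"
proof -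
  assume c: "c \<in> set cs" "v \<in> set c"
  then have X: "set c \<in> set Vs" using set_cs by (metis imageI)
  show "S v w \<longleftrightarrow> w \<in> set c"
    unfolding S_iff using partition(3)[OF X] X c(2) by (metis disjoint_iff)
qed

lemma length_cs: "length cs \<le> n"
proof -
  have ne: "\<exists>v. v \<in> X" if "X \<in> set Vs" for X using that partition(4) by (metis equals0I)
  have some: "(SOME v. v \<in> X) \<in> X" if "X \<in> set Vs" for X using someI_ex[OF ne[OF that]] .
  have "inj_on (\<lambda>X. SOME v. v \<in> X) (set Vs)"
    by (rule inj_onI) (metis partition(3) some disjoint_iff)
  moreover have "(\<lambda>X. SOME v. v \<in> X) ` set Vs \<subseteq> V" using some partition(2) by blast
  ultimately have "card (set Vs) \<le> card V" using finite_V by (rule card_inj_on_le)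
  then show ?thesis unfolding cs_def using partition(1) by (simp add: distinct_card)
qed

end

section \<open>Layers and stars\<close>

lemma length_filter_disj:
  "\<forall>y\<in>set ys. \<not> (P y \<and> Q y) \<Longrightarrow>
   length (filter (\<lambda>y. P y \<or> Q y) ys) = length (filter P ys) + length (filter Q ys)"
  by (induction ys) auto

text \<open>The growth factor of the number of leaves: by \<open>stuck_layer\<close>, a stuck layer
  over \<open>t\<close> leaves adds at least \<open>t * (k - 1) / k\<^sup>2\<close> leaves of its
  own.\<close>

definition rate :: "nat \<Rightarrow> real" where
  "rate k = 1 + (real k - 1) / (real k)\<^sup>2"

context partitioned_graph begin

definition partial :: "nat list \<Rightarrow> bool" where
  "partial M \<longleftrightarrow> set M \<subseteq> V \<and> distinct M \<and> (\<forall>x\<in>set M. \<forall>y\<in>set M. \<not> E x y) \<and>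
     (\<forall>x\<in>set M. \<forall>y\<in>set M. S x y \<longrightarrow> x = y)"

abbreviation leaves :: "nat list \<Rightarrow> nat list \<Rightarrow> nat list" where
  "leaves M X \<equiv> related E X M"

text \<open>The top layer has too few centres without \<open>M\<close>-neighbours for a batch of swaps.\<close>

definition stuck :: "nat list \<Rightarrow> nat list list \<Rightarrow> bool" where
  "stuck M Ls \<longleftrightarrow> (case Ls of [] \<Rightarrow> True
     | N # R \<Rightarrow> unrelated E M N = [] \<or>
         k * (k * length (unrelated E M N)) < length (leaves M (concat R)))"

text \<open>No lower bound on the leaves of \<open>N\<close> itself is imposed, so the condition
  survives a loss of leaves of \<open>N\<close> (\<open>layer_ok_mono\<close>). The length condition
  compares \<open>N\<close> with the leaves below it, and a hit on \<open>N\<close> leaves these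
  alone.\<close>

definition layer_ok :: "nat \<Rightarrow> nat list \<Rightarrow> nat list \<Rightarrow> nat list \<Rightarrow> bool" where
  "layer_ok a M N X \<longleftrightarrow> N \<noteq> [] \<and> set N \<subseteq> V \<and> distinct N \<and>
     length (leaves M X) \<le> k * length N \<and>
     (\<forall>x\<in>set N. \<forall>x'\<in>set N \<union> set X. \<not> E x x') \<and>
     (\<forall>y\<in>set (leaves M N). y \<notin> set (leaves M X)) \<and>
     (\<forall>x\<in>set N. \<forall>x'\<in>set N. \<forall>y\<in>set M. E y x \<longrightarrow> E y x' \<longrightarrow> x = x') \<and>
     (\<forall>x\<in>set N. \<exists>z\<in>set (a # leaves M X). S x z) \<and>
     (\<forall>x\<in>set N. \<forall>x'\<in>set N. S x x' \<longrightarrow> x = x')"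

text \<open>A new layer is started only over a stuck one. Thus every layer except the newest is
  stuck, which is what the growth estimate needs.\<close>

fun layered :: "nat \<Rightarrow> nat list \<Rightarrow> nat list list \<Rightarrow> bool" where
  "layered a M [] = True"
| "layered a M (N # Ls) \<longleftrightarrow> layered a M Ls \<and> stuck M Ls \<and> layer_ok a M N (concat Ls)"

definition uncovered :: "nat list \<Rightarrow> nat \<Rightarrow> bool" where
  "uncovered M a \<longleftrightarrow> a \<in> V \<and> (\<forall>y\<in>set M. \<not> S a y)"

lemma partialD:
  assumes "partial M"
  shows "set M \<subseteq> V" "distinct M" "\<And>x y. x \<in> set M \<Longrightarrow> y \<in> set M \<Longrightarrow> \<not> E x y"
    "\<And>x y. x \<in> set M \<Longrightarrow> y \<in> set M \<Longrightarrow> S x y \<Longrightarrow> x = y"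
  using assms by (auto simp: partial_def)

lemma layer_okD:
  assumes "layer_ok a M N X"
  shows "N \<noteq> []" "set N \<subseteq> V" "distinct N" "length (leaves M X) \<le> k * length N"
    "\<And>x x'. x \<in> set N \<Longrightarrow> x' \<in> set N \<union> set X \<Longrightarrow> \<not> E x x'"
    "\<And>y. y \<in> set (leaves M N) \<Longrightarrow> y \<notin> set (leaves M X)"
    "\<And>x x' y. x \<in> set N \<Longrightarrow> x' \<in> set N \<Longrightarrow> y \<in> set M \<Longrightarrow> E y x \<Longrightarrow> E y x' \<Longrightarrow> x = x'"
    "\<And>x. x \<in> set N \<Longrightarrow> \<exists>z\<in>set (a # leaves M X). S x z"
    "\<And>x x'. x \<in> set N \<Longrightarrow> x' \<in> set N \<Longrightarrow> S x x' \<Longrightarrow> x = x'"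
  using assms unfolding layer_ok_def by (blast, blast, blast, blast, blast, blast, blast, blast, blast)

section \<open>Counting centres and leaves\<close>

lemma length_leaves_append:
  assumes "\<And>y. y \<in> set (leaves M N) \<Longrightarrow> y \<notin> set (leaves M X)"
  shows "length (leaves M (N @ X)) = length (leaves M N) + length (leaves M X)"
proof -
  let ?P = "\<lambda>y. \<exists>x\<in>set N. E y x" and ?Q = "\<lambda>y. \<exists>x\<in>set X. E y x"
  have "\<forall>y\<in>set M. \<not> (?P y \<and> ?Q y)" using assms unfolding set_related by blast
  then have "length (filter (\<lambda>y. ?P y \<or> ?Q y) M) = length (filter ?P M) + length (filter ?Q M)"
    by (rule length_filter_disj)
  moreover have "leaves M (N @ X) = filter (\<lambda>y. ?P y \<or> ?Q y) M"
    unfolding related_def by (rule filter_cong) auto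
  ultimately show ?thesis by (simp add: related_def)
qed

lemma length_le_by_relation:
  assumes "distinct xs" "\<And>x. x \<in> set xs \<Longrightarrow> \<exists>y\<in>set ys. R x y"
    and "\<And>x x' y. x \<in> set xs \<Longrightarrow> x' \<in> set xs \<Longrightarrow> y \<in> set ys \<Longrightarrow> R x y \<Longrightarrow> R x' y \<Longrightarrow> x = x'"
  shows "length xs \<le> length ys"
proof -
  obtain f where f: "\<And>x. x \<in> set xs \<Longrightarrow> f x \<in> set ys \<and> R x (f x)"
    using assms(2) by metis
  have "inj_on f (set xs)" by (rule inj_onI) (metis assms(3) f)
  moreover have "f ` set xs \<subseteq> set ys" using f by blast
  ultimately have "card (set xs) \<le> card (set ys)" by (intro card_inj_on_le) auto
  then show ?thesis using assms(1) card_length[of ys] by (simp add: distinct_card)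
qed

text \<open>Two centres of one layer share no leaf, so each centre that is not idle owns a
  leaf.\<close>

lemma nonfree_le_leaves:
  assumes "layer_ok a M N X"
  shows "length (related E M N) \<le> length (leaves M N)"
proof (rule length_le_by_relation[where R = E])
  show "distinct (related E M N)" using layer_okD(3)[OF assms] by (rule distinct_related)
  show "\<exists>y\<in>set (leaves M N). E x y" if "x \<in> set (related E M N)" for x
    using that E_sym by (auto simp: set_related)
  show "x = x'" if "x \<in> set (related E M N)" "x' \<in> set (related E M N)" "y \<in> set (leaves M N)"
    "E x y" "E x' y" for x x' y
    using that layer_okD(7)[OF assms, of x x' y] E_sym by (auto simp: set_related)
qed

text \<open>The \<open>M\<close>-neighbours of a vertex are independent and lie in distinct classes,
  so \<open>r\<close> of them would form a forbidden claw.\<close>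

lemma leaves_single_le:
  assumes M: "partial M" and x: "x \<in> V"
  shows "length (leaves M [x]) \<le> r"
proof (rule ccontr)
  assume "\<not> ?thesis"
  then have "r \<le> card (set (leaves M [x]))"
    using partialD(2)[OF M] by (simp add: distinct_card distinct_related)
  then obtain U where U: "U \<subseteq> set (leaves M [x])" "card U = r" "finite U"
    using obtain_subset_with_card_n by metis
  have UM: "U \<subseteq> set M" and Ux: "\<And>u. u \<in> U \<Longrightarrow> E x u"
    using U(1) E_sym by (auto simp: set_related)
  have "independent_set G U"
    unfolding independent_set_def E_def[symmetric] using UM partialD(1,3)[OF M] by blast
  moreover have "\<forall>X\<in>set Vs. \<forall>u\<in>U \<inter> X. \<forall>w\<in>U \<inter> X. u = w"
    using UM partialD(4)[OF M] unfolding S_iff by blast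
  ultimately show False
    using claw_free x U(2,3) Ux unfolding claw_free_wrt_def E_def by blast
qed

lemma leaves_le:
  assumes M: "partial M" and N: "set N \<subseteq> V"
  shows "length (leaves M N) \<le> r * length N"
  using N
proof (induction N)
  case Nil
  then show ?case by (simp add: related_def)
next
  case (Cons x N)
  have "length (leaves M (x # N)) \<le> length (leaves M [x]) + length (leaves M N)"
    by (induction M) (auto simp: related_def)
  then show ?case using Cons leaves_single_le[OF M, of x] by simp
qed

text \<open>With \<open>f\<close> idle centres, either \<open>f = 0\<close> or
  \<open>k * (k * f) < t \<le> k * length N\<close>, so \<open>k * f \<le> length N\<close>. The
  remaining \<open>length N - f\<close> centres own leaves, hence
  \<open>length N \<le> y + f\<close>. Multiplying this by \<open>k * k\<close> and using
  \<open>k * (k * f) \<le> t\<close> turns \<open>k * t \<le> k * (k * length N)\<close> into the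
  second bound.\<close>

lemma stuck_layer:
  assumes lay: "layer_ok a M N (concat R)" and st: "stuck M (N # R)"
  defines "t \<equiv> length (leaves M (concat R))"
  defines "y \<equiv> length (leaves M N)"
  defines "f \<equiv> length (unrelated E M N)"
  shows "1 \<le> y" "(k - 1) * t \<le> k * (k * y)" "(k - 1) * f \<le> y"
proof -
  have len: "length N \<le> y + f"
    using nonfree_le_leaves[OF lay] length_related_unrelated[of E M N] by (simp add: y_def f_def)
  have N0: "length N > 0" using layer_okD(1)[OF lay] by simp
  have tN: "t \<le> k * length N" using layer_okD(4)[OF lay] by (simp add: t_def)
  have f: "f = 0 \<or> k * (k * f) < t" using st by (auto simp: stuck_def f_def t_def)
  have k: "k \<ge> 3" by (rule k_ge)
  have kf: "k * f \<le> length N" and fl: "f < length N"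
  proof -
    have "f = 0 \<or> k * (k * f) < k * length N" using f tN by linarith
    then show a: "k * f \<le> length N" by auto
    have "f + f \<le> k * f" using mult_le_mono1[OF k, of f] by linarith
    then show "f < length N" using N0 a by linarith
  qed
  then show "1 \<le> y" using len by linarith
  have kk: "(k - 1) * f + f = k * f" using k by (cases k) auto
  show "(k - 1) * f \<le> y" using kf kk len by linarith
  have "k * (k * length N) \<le> k * (k * y) + k * (k * f)"
    using mult_le_mono2[OF mult_le_mono2[OF len, of k], of k] by (simp add: algebra_simps)
  moreover have "k * t \<le> k * (k * length N)" using tN by simp
  moreover have "(k - 1) * t + t = k * t" using k by (cases k) auto
  moreover have "k * (k * f) \<le> t" using f by auto
  ultimately show "(k - 1) * t \<le> k * (k * y)" by linarith
qed

text \<open>The leaf sets of different layers are disjoint, so the bounds for single layers add up.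
  The two parts limit the idle centres, which fall outside the constellation, and the centres inside
  it.\<close>

lemma free_total:
  assumes "layered a M Ls" "stuck M Ls"
  shows "(k - 1) * length (unrelated E M (concat Ls)) \<le> length (leaves M (concat Ls)) \<and>
    length (related E M (concat Ls)) \<le> length (leaves M (concat Ls))"
  using assms
proof (induction Ls)
  case Nil
  then show ?case by (simp add: unrelated_def related_def)
next
  case (Cons N R)
  then have lay: "layer_ok a M N (concat R)" and IH: "(k - 1) * length (unrelated E M (concat R)) \<le> length (leaves M (concat R))"
    "length (related E M (concat R)) \<le> length (leaves M (concat R))" by auto
  have "length (leaves M (N @ concat R)) = length (leaves M N) + length (leaves M (concat R))"
    using layer_okD(6)[OF lay] by (rule length_leaves_append)
  with stuck_layer[OF lay Cons.prems(2)] IH nonfree_le_leaves[OF lay]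
  show ?case by (simp add: related_append unrelated_append algebra_simps)
qed

text \<open>The bottom layer has at least one leaf, whence the exponent
  \<open>length Ls - 1\<close>; each further stuck layer multiplies the number of leaves by at least
  \<open>rate k\<close>.\<close>

lemma growth:
  assumes "layered a M Ls" "stuck M Ls" "Ls \<noteq> []"
  shows "rate k ^ (length Ls - 1) \<le> real (length (leaves M (concat Ls)))"
  using assms
proof (induction Ls)
  case Nil
  then show ?case by simp
next
  case (Cons N R)
  then have lay: "layer_ok a M N (concat R)" by simp
  note st = stuck_layer[OF lay Cons.prems(2)]
  have len: "length (leaves M (N @ concat R)) = length (leaves M N) + length (leaves M (concat R))"
    using layer_okD(6)[OF lay] by (rule length_leaves_append)
  show ?case
  proof (cases "R = []")
    case True
    then show ?thesis using st(1) by simp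
  next
    case False
    let ?t = "real (length (leaves M (concat R)))" and ?y = "real (length (leaves M N))"
    have IH: "rate k ^ (length R - 1) \<le> ?t" using Cons False by auto
    have "real ((k - 1) * length (leaves M (concat R))) \<le> real (k * (k * length (leaves M N)))"
      using st(2) of_nat_le_iff by blast
    then have "(real k - 1) * ?t \<le> (real k)\<^sup>2 * ?y"
      using k_ge by (simp add: power2_eq_square of_nat_diff)
    then have y: "(real k - 1) / (real k)\<^sup>2 * ?t \<le> ?y"
      using k_ge by (simp add: field_simps)
    have "rate k \<ge> 0" using k_ge by (simp add: rate_def)
    then have "rate k * rate k ^ (length R - 1) \<le> rate k * ?t" using IH by (rule mult_left_mono[rotated])
    also have "\<dots> \<le> ?y + ?t" using y by (simp add: rate_def algebra_simps)
    finally show ?thesis using False len by (cases R) auto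
  qed
qed

text \<open>The class of \<open>x\<close> contains \<open>a\<close> or an older leaf
  \<open>z\<close>. Since \<open>a\<close> is uncovered, a vertex of \<open>M\<close> in this class
  can only be \<open>z\<close>, which is not a leaf of the new layer. Without this, an edge of a
  star could be among those deleted in \<open>class_graph\<close>.\<close>

lemma own_class:
  assumes M: "partial M" and a: "uncovered M a" and lay: "layer_ok a M N X"
    and x: "x \<in> set N" "y \<in> set M" "S x y"
  shows "\<not> E x y"
proof
  assume Exy: "E x y"
  obtain z where z: "z \<in> set (a # leaves M X)" "S x z" using layer_okD(8)[OF lay x(1)] by blast
  have "S z y" using z(2) x(3) S_sym S_trans by blast
  then have "z \<noteq> a" using a x(2) by (auto simp: uncovered_def)
  then have "z \<in> set (leaves M X)" using z by auto
  then have "y \<in> set (leaves M X)" using \<open>S z y\<close> partialD(4)[OF M, of z y] x(2) by (auto simp: set_related)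
  moreover have "y \<in> set (leaves M N)" using x Exy E_sym by (auto simp: set_related)
  ultimately show False using layer_okD(6)[OF lay] by blast
qed

lemma layered_centres:
  assumes M: "partial M" and a: "uncovered M a" and lay: "layered a M Ls"
  shows "(\<forall>x\<in>set (concat Ls). x \<in> V \<and> (\<forall>y\<in>set M. S x y \<longrightarrow> \<not> E x y) \<and>
      (\<exists>z\<in>set (a # leaves M (concat Ls)). S x z) \<and>
      (\<forall>x'\<in>set (concat Ls). \<not> E x x' \<and> (\<forall>y\<in>set M. E y x \<longrightarrow> E y x' \<longrightarrow> x = x')))"
  using lay
proof (induction Ls)
  case Nil
  then show ?case by simp
next
  case (Cons N R)
  then have lay: "layer_ok a M N (concat R)" by simp
  have IH: "\<forall>x\<in>set (concat R). x \<in> V \<and> (\<forall>y\<in>set M. S x y \<longrightarrow> \<not> E x y) \<and>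
      (\<exists>z\<in>set (a # leaves M (concat R)). S x z) \<and>
      (\<forall>x'\<in>set (concat R). \<not> E x x' \<and> (\<forall>y\<in>set M. E y x \<longrightarrow> E y x' \<longrightarrow> x = x'))"
    using Cons by simp
  note L = layer_okD[OF lay]
  have sub: "set (leaves M (concat R)) \<subseteq> set (leaves M (concat (N # R)))"
    by (auto simp: set_related)
  have cross: False if "x \<in> set N" "x' \<in> set (concat R)" "y \<in> set M" "E y x" "E y x'" for x x' y
    using L(6)[of y] that by (auto simp: set_related)
  show ?case
  proof (intro ballI conjI)
    fix x assume x: "x \<in> set (concat (N # R))"
    show "x \<in> V" using x L(2) IH by auto
    show "\<exists>z\<in>set (a # leaves M (concat (N # R))). S x z"
    proof (cases "x \<in> set N")
      case True
      then show ?thesis using L(8)[of x] sub by auto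
    next
      case False
      then show ?thesis using IH x sub by fastforce
    qed
    show "S x y \<longrightarrow> \<not> E x y" if "y \<in> set M" for y
      using x own_class[OF M a lay] IH that by auto
    fix x' assume x': "x' \<in> set (concat (N # R))"
    show "\<not> E x x'" using x x' L(5)[of x x'] L(5)[of x' x] IH E_sym[of x x'] by auto
    fix y assume y: "y \<in> set M"
    show "E y x \<longrightarrow> E y x' \<longrightarrow> x = x'"
      using x x' y cross[of x x' y] cross[of x' x y] L(7)[of x x' y] IH by auto
  qed
qed

section \<open>The greedy construction of a layer\<close>

lemma cs_eqI: "c \<in> set cs \<Longrightarrow> c' \<in> set cs \<Longrightarrow> x \<in> set c \<Longrightarrow> x \<in> set c' \<Longrightarrow> c = c'"
proof -
  assume c: "c \<in> set cs" "c' \<in> set cs" "x \<in> set c" "x \<in> set c'"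
  then obtain X Y where X: "X \<in> set Vs" "c = sorted_list_of_set X" "Y \<in> set Vs" "c' = sorted_list_of_set Y"
    by (auto simp: cs_def)
  then have "x \<in> X" "x \<in> Y" using c finite_class by auto
  then show ?thesis using X partition(3)[of X Y] by blast
qed

lemma distinct_cs: "distinct cs"
proof -
  have "inj_on sorted_list_of_set (set Vs)"
    by (rule inj_onI) (metis finite_class sorted_list_of_set.set_sorted_key_list_of_set)
  then show ?thesis unfolding cs_def using partition(1) by (simp add: distinct_map)
qed

text \<open>Here \<open>ds\<close> lists the classes scanned so far. The last clause persists during
  the scan because the set of centres and leaves only grows: a reached class that had no free vertex
  when it was scanned stays dominated.\<close>

definition build_inv :: "nat list \<Rightarrow> nat list \<Rightarrow> nat list \<Rightarrow> nat list \<Rightarrow> nat list list \<Rightarrow> bool" where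
  "build_inv M X T N ds \<longleftrightarrow> set N \<subseteq> V \<and> distinct N \<and>
     (\<forall>x\<in>set N. \<forall>x'\<in>set N \<union> set X. \<not> E x x') \<and>
     (\<forall>y\<in>set (leaves M N). y \<notin> set (leaves M X)) \<and>
     (\<forall>x\<in>set N. \<forall>x'\<in>set N. \<forall>y\<in>set M. E y x \<longrightarrow> E y x' \<longrightarrow> x = x') \<and>
     (\<forall>x\<in>set N. (\<exists>z\<in>set T. S x z) \<and> (\<exists>c\<in>set ds. x \<in> set c)) \<and>
     (\<forall>x\<in>set N. \<forall>x'\<in>set N. S x x' \<longrightarrow> x = x') \<and>
     (\<forall>c\<in>set ds. (\<exists>z\<in>set T. S (hd c) z) \<longrightarrow> (\<exists>x\<in>set N. x \<in> set c) \<or>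
        (\<forall>v\<in>set c. \<exists>u\<in>set (N @ X @ leaves M (N @ X)). E v u))"

lemma build_invD:
  assumes "build_inv M X T N ds"
  shows "set N \<subseteq> V" "distinct N"
    "\<And>x x'. x \<in> set N \<Longrightarrow> x' \<in> set N \<union> set X \<Longrightarrow> \<not> E x x'"
    "\<And>y. y \<in> set (leaves M N) \<Longrightarrow> y \<notin> set (leaves M X)"
    "\<And>x x' y. x \<in> set N \<Longrightarrow> x' \<in> set N \<Longrightarrow> y \<in> set M \<Longrightarrow> E y x \<Longrightarrow> E y x' \<Longrightarrow> x = x'"
    "\<And>x. x \<in> set N \<Longrightarrow> \<exists>z\<in>set T. S x z"
    "\<And>x. x \<in> set N \<Longrightarrow> \<exists>c\<in>set ds. x \<in> set c"
    "\<And>x x'. x \<in> set N \<Longrightarrow> x' \<in> set N \<Longrightarrow> S x x' \<Longrightarrow> x = x'"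
    "\<And>c. c \<in> set ds \<Longrightarrow> \<exists>z\<in>set T. S (hd c) z \<Longrightarrow> (\<exists>x\<in>set N. x \<in> set c) \<or>
        (\<forall>v\<in>set c. \<exists>u\<in>set (N @ X @ leaves M (N @ X)). E v u)"
  using assms unfolding build_inv_def
  by (blast, blast, blast, blast, blast, blast, blast, blast, blast)

lemma build_inv_extend:
  assumes inv: "build_inv M X T N ds" and c: "c \<in> set cs" "c \<notin> set ds" "set ds \<subseteq> set cs"
    and z: "z \<in> set T" "S (hd c) z" and v: "v \<in> set c"
    and free: "\<And>u. u \<in> set (N @ X @ leaves M (N @ X)) \<Longrightarrow> \<not> E v u"
  shows "build_inv M X T (v # N) (ds @ [c])"
proof -
  note I = build_invD[OF inv]
  have Nc: "x \<notin> set c" if "x \<in> set N" for x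
  proof
    assume "x \<in> set c"
    moreover obtain c' where "c' \<in> set ds" "x \<in> set c'" using I(7)[OF \<open>x \<in> set N\<close>] by blast
    ultimately show False using cs_eqI[of c c' x] c by auto
  qed
  have vV: "v \<in> V" using cs_subset c v by blast
  have fN: "\<not> E v u" if "u \<in> set N \<union> set X" for u using free that by auto
  \<comment> \<open>A common \<open>M\<close>-neighbour of \<open>v\<close> and an older centre
    would be a leaf of \<open>N @ X\<close>, and \<open>v\<close> has no neighbour among these
    leaves.\<close>
  have fl: "\<not> (E y v \<and> E y x)" if "x \<in> set N \<union> set X" "y \<in> set M" for x y
    using free[of y] that E_sym by (auto simp: set_related)
  have 1: "set (v # N) \<subseteq> V \<and> distinct (v # N)" using I(1,2) vV Nc v by auto
  have 2: "\<forall>x\<in>set (v # N). \<forall>x'\<in>set (v # N) \<union> set X. \<not> E x x'"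
    
  proof (intro ballI)
    fix x x' assume "x \<in> set (v # N)" "x' \<in> set (v # N) \<union> set X"
    then show "\<not> E x x'" using I(3)[of x x'] fN[of x'] fN[of x] E_irrefl[of v] E_sym[of x x'] by auto
  qed
  have 3: "\<forall>y\<in>set (leaves M (v # N)). y \<notin> set (leaves M X)"
  proof
    fix y assume y: "y \<in> set (leaves M (v # N))"
    show "y \<notin> set (leaves M X)"
    proof (cases "E y v")
      case True
      then show ?thesis using fl y by (auto simp: set_related)
    next
      case False
      then have "y \<in> set (leaves M N)" using y by (auto simp: set_related)
      then show ?thesis using I(4) by blast
    qed
  qed
  have 4: "\<forall>x\<in>set (v # N). \<forall>x'\<in>set (v # N). \<forall>y\<in>set M. E y x \<longrightarrow> E y x' \<longrightarrow> x = x'"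
  proof (intro ballI impI)
    fix x x' y assume x: "x \<in> set (v # N)" "x' \<in> set (v # N)" and y: "y \<in> set M" "E y x" "E y x'"
    show "x = x'"
    proof (cases "x = v \<or> x' = v")
      case True
      then show ?thesis using fl[of x y] fl[of x' y] x y by auto
    next
      case False
      then show ?thesis using I(5)[of x x' y] x y by auto
    qed
  qed
  have Svz: "S v z" using S_class[OF c(1)] v z hd_cs[OF c(1)] by blast
  have 5: "\<forall>x\<in>set (v # N). (\<exists>z\<in>set T. S x z) \<and> (\<exists>c'\<in>set (ds @ [c]). x \<in> set c')"
    using I(6,7) Svz z v by fastforce
  have 6: "\<forall>x\<in>set (v # N). \<forall>x'\<in>set (v # N). S x x' \<longrightarrow> x = x'"
  proof (intro ballI impI)
    fix x x' assume x: "x \<in> set (v # N)" "x' \<in> set (v # N)" "S x x'"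
    show "x = x'"
    proof (cases "x = v \<or> x' = v")
      case True
      then have "x \<in> set c \<and> x' \<in> set c" using S_class[OF c(1) v] x(3) S_sym v by blast
      then show ?thesis using Nc x by auto
    next
      case False
      then show ?thesis using I(8)[of x x'] x by auto
    qed
  qed
  have mono: "set (N @ X @ leaves M (N @ X)) \<subseteq> set ((v # N) @ X @ leaves M ((v # N) @ X))"
    by (auto simp: set_related)
  have 7: "\<forall>c'\<in>set (ds @ [c]). (\<exists>z\<in>set T. S (hd c') z) \<longrightarrow> (\<exists>x\<in>set (v # N). x \<in> set c') \<or>
        (\<forall>w\<in>set c'. \<exists>u\<in>set ((v # N) @ X @ leaves M ((v # N) @ X)). E w u)"
  proof (intro ballI impI)
    fix c' assume c': "c' \<in> set (ds @ [c])" "\<exists>z\<in>set T. S (hd c') z"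
    show "(\<exists>x\<in>set (v # N). x \<in> set c') \<or>
        (\<forall>w\<in>set c'. \<exists>u\<in>set ((v # N) @ X @ leaves M ((v # N) @ X)). E w u)"
    proof (cases "c' = c")
      case True
      then show ?thesis using v by auto
    next
      case False
      then have "c' \<in> set ds" using c' by auto
      then have "(\<exists>x\<in>set N. x \<in> set c') \<or>
        (\<forall>v\<in>set c'. \<exists>u\<in>set (N @ X @ leaves M (N @ X)). E v u)"
        using I(9) c'(2) by blast
      then show ?thesis using mono by (meson list.set_intros(2) subsetD)
    qed
  qed
  show ?thesis unfolding build_inv_def using 1 2 3 4 5 6 7 by (intro conjI) (blast | assumption)+
qed

lemma build_inv_skip:
  assumes inv: "build_inv M X T N ds"
    and c: "(\<exists>z\<in>set T. S (hd c) z) \<Longrightarrow> (\<forall>v\<in>set c. \<exists>u\<in>set (N @ X @ leaves M (N @ X)). E v u)"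
  shows "build_inv M X T N (ds @ [c])"
proof -
  note I = build_invD[OF inv]
  have 5: "\<forall>x\<in>set N. (\<exists>z\<in>set T. S x z) \<and> (\<exists>c'\<in>set (ds @ [c]). x \<in> set c')"
    using I(6,7) by fastforce
  have 7: "\<forall>c'\<in>set (ds @ [c]). (\<exists>z\<in>set T. S (hd c') z) \<longrightarrow> (\<exists>x\<in>set N. x \<in> set c') \<or>
        (\<forall>w\<in>set c'. \<exists>u\<in>set (N @ X @ leaves M (N @ X)). E w u)"
  proof (intro ballI impI)
    fix c' assume "c' \<in> set (ds @ [c])" "\<exists>z\<in>set T. S (hd c') z"
    then show "(\<exists>x\<in>set N. x \<in> set c') \<or>
        (\<forall>w\<in>set c'. \<exists>u\<in>set (N @ X @ leaves M (N @ X)). E w u)"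
      using I(9)[of c'] c by (cases "c' = c") auto
  qed
  have 3: "\<forall>x\<in>set N. \<forall>x'\<in>set N \<union> set X. \<not> E x x'" using I(3) by blast
  have 4: "\<forall>x\<in>set N. \<forall>x'\<in>set N. \<forall>y\<in>set M. E y x \<longrightarrow> E y x' \<longrightarrow> x = x'" using I(5) by blast
  have 6: "\<forall>x\<in>set N. \<forall>x'\<in>set N. S x x' \<longrightarrow> x = x'" using I(8) by blast
  show ?thesis unfolding build_inv_def using I(1,2,4) 3 4 5 6 7 by (intro conjI) (blast | assumption)+
qed

lemma build_inv_build:
  assumes "build_inv M X T N ds" "distinct (ds @ es)" "set (ds @ es) \<subseteq> set cs"
  shows "build_inv M X T (build M X T N es) (ds @ es)"
  using assms
proof (induction es arbitrary: N ds)
  case Nil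
  then show ?case by simp
next
  case (Cons c es)
  let ?u = "unrelated E (N @ X @ related E (N @ X) M) c"
  let ?N = "if \<exists>z\<in>set T. S (hd c) z then (case ?u of [] \<Rightarrow> N | v # _ \<Rightarrow> v # N) else N"
  have "build_inv M X T ?N (ds @ [c])"
  proof (cases "\<exists>z\<in>set T. S (hd c) z")
    case False
    have "build_inv M X T N (ds @ [c])"
      by (rule build_inv_skip[OF Cons.prems(1)]) (use False in blast)
    then show ?thesis using False by simp
  next
    case True
    then obtain z where z: "z \<in> set T" "S (hd c) z" by blast
    show ?thesis
    proof (cases ?u)
      case Nil
      then have "set ?u = {}" by simp
      then have "\<forall>v\<in>set c. \<exists>u\<in>set (N @ X @ leaves M (N @ X)). E v u"
        unfolding set_unrelated by blast
      then have "build_inv M X T N (ds @ [c])" by (rule build_inv_skip[OF Cons.prems(1)])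
      then show ?thesis using Nil True by simp
    next
      case (Cons v vs)
      then have "v \<in> set ?u" by simp
      then have v: "v \<in> set c" "\<And>u. u \<in> set (N @ X @ leaves M (N @ X)) \<Longrightarrow> \<not> E v u"
        unfolding set_unrelated by blast+
      have "build_inv M X T (v # N) (ds @ [c])"
        by (rule build_inv_extend[OF \<open>build_inv M X T N ds\<close> _ _ _ z v])
          (use \<open>distinct (ds @ c # es)\<close> \<open>set (ds @ c # es) \<subseteq> set cs\<close> in auto)
      then show ?thesis using True Cons by simp
    qed
  qed
  from Cons.IH[OF this] Cons.prems show ?case by simp
qed

lemma build_correct:
  "build_inv M X T (build M X T [] cs) cs"
  using build_inv_build[of M X T "[]" "[]" cs] distinct_cs by (simp add: build_inv_def related_def)

end

section \<open>The dominating set\<close>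

text \<open>The retraction \<open>g\<close> onto the centres is constant along arcs, and every
  vertex is joined to its centre in both directions. So mutual reachability amounts to equal values
  of \<open>g\<close>, and the components are the fibres of \<open>g\<close>.\<close>

lemma star_forest_sccs:
  fixes K :: "'a pair_pre_digraph"
  assumes verts: "pverts K = P \<union> Y" and disj: "P \<inter> Y = {}"
    and f: "\<And>y. y \<in> Y \<Longrightarrow> f y \<in> P"
    and arcs: "parcs K = (\<Union>y\<in>Y. {(f y, y), (y, f y)})"
  shows "pre_digraph.sccs (with_proj K) = (\<lambda>p. with_proj K \<restriction> insert p {y \<in> Y. f y = p}) ` P"
proof -
  have wf: "pair_wf_digraph K"
    by unfold_locales (use arcs verts f in auto)
  interpret wf_digraph "with_proj K" using wf by (simp add: wf_digraph_wp_iff)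
  define g where "g u = (if u \<in> P then u else f u)" for u
  have gP: "g u \<in> P" if "u \<in> P \<union> Y" for u using that f by (auto simp: g_def)
  have reach: "u \<rightarrow>\<^sup>*\<^bsub>with_proj K\<^esub> v \<longleftrightarrow> u \<in> P \<union> Y \<and> v \<in> P \<union> Y \<and> g u = g v" for u v
  proof
    assume r: "u \<rightarrow>\<^sup>*\<^bsub>with_proj K\<^esub> v"
    then have "g u = g v"
    proof (induction rule: reachable_induct)
      case (step x y)
      then have "(x, y) \<in> parcs K" by simp
      then have "g x = g y" using arcs f disj by (auto simp: g_def)
      then show ?case using step by simp
    qed simp
    then show "u \<in> P \<union> Y \<and> v \<in> P \<union> Y \<and> g u = g v"
      using reachable_in_verts[OF r] verts by simp
  next
    assume uv: "u \<in> P \<union> Y \<and> v \<in> P \<union> Y \<and> g u = g v"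
    have 1: "w \<rightarrow>\<^sup>*\<^bsub>with_proj K\<^esub> g w" "g w \<rightarrow>\<^sup>*\<^bsub>with_proj K\<^esub> w" if w: "w \<in> P \<union> Y" for w
    proof -
      have "w \<rightarrow>\<^sup>*\<^bsub>with_proj K\<^esub> g w \<and> g w \<rightarrow>\<^sup>*\<^bsub>with_proj K\<^esub> w"
      proof (cases "w \<in> P")
        case True
        then show ?thesis using verts by (simp add: g_def reachable_refl)
      next
        case False
        then have "(w, g w) \<in> parcs K" "(g w, w) \<in> parcs K" using w arcs by (auto simp: g_def)
        then show ?thesis by (auto intro!: reachable_adjI)
      qed
      then show "w \<rightarrow>\<^sup>*\<^bsub>with_proj K\<^esub> g w" "g w \<rightarrow>\<^sup>*\<^bsub>with_proj K\<^esub> w" by auto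
    qed
    show "u \<rightarrow>\<^sup>*\<^bsub>with_proj K\<^esub> v" using 1(1)[of u] 1(2)[of v] uv reachable_trans by metis
  qed
  have star: "{v \<in> P \<union> Y. g v = p} = insert p {y \<in> Y. f y = p}" if "p \<in> P" for p
    using that disj by (auto simp: g_def)
  have "sccs_verts = (\<lambda>p. insert p {y \<in> Y. f y = p}) ` P"
  proof (intro set_eqI iffI)
    fix A assume "A \<in> sccs_verts"
    then have A: "A \<noteq> {}" "\<And>u v. u \<in> A \<Longrightarrow> v \<in> A \<Longrightarrow> u \<rightarrow>\<^sup>*\<^bsub>with_proj K\<^esub> v"
      "\<And>u v. u \<in> A \<Longrightarrow> v \<notin> A \<Longrightarrow> \<not> u \<rightarrow>\<^sup>*\<^bsub>with_proj K\<^esub> v \<or> \<not> v \<rightarrow>\<^sup>*\<^bsub>with_proj K\<^esub> u"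
      by (auto simp: sccs_verts_def)
    then obtain u where u: "u \<in> A" by blast
    have uV: "u \<in> P \<union> Y" using A(2)[OF u u] reach by blast
    have "A = {v \<in> P \<union> Y. g v = g u}"
      using A(2)[OF u] A(3)[OF u] unfolding reach using uV by (auto; metis)
    then show "A \<in> (\<lambda>p. insert p {y \<in> Y. f y = p}) ` P"
      using star[OF gP[OF uV]] gP[OF uV] by blast
  next
    fix A assume "A \<in> (\<lambda>p. insert p {y \<in> Y. f y = p}) ` P"
    then obtain p where p: "p \<in> P" "A = {v \<in> P \<union> Y. g v = p}" using star by blast
    moreover have "p \<in> A" using p by (simp add: g_def)
    ultimately show "A \<in> sccs_verts" unfolding sccs_verts_def reach by auto
  qed
  then show ?thesis by (simp add: sccs_conv_sccs_verts image_image)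
qed

context partitioned_graph begin

section \<open>The constellation formed by the stars\<close>

definition cls :: "nat \<Rightarrow> nat set" where "cls v = {w. S v w}"

lemma cls_eq: "X \<in> set Vs \<Longrightarrow> v \<in> X \<Longrightarrow> cls v = X"
  unfolding cls_def S_iff using partition(3) by blast

lemma cls_in: "v \<in> V \<Longrightarrow> cls v \<in> set Vs"
  using cls_eq S_refl[of v] unfolding S_iff by blast

lemma self_in_cls: "v \<in> V \<Longrightarrow> v \<in> cls v"
  using S_refl by (simp add: cls_def)

lemma cls_eq_iff: "u \<in> V \<Longrightarrow> v \<in> V \<Longrightarrow> cls u = cls v \<longleftrightarrow> S u v"
  using cls_def S_refl S_trans S_sym by blast

text \<open>Idle centres are omitted, because a star needs a leaf. The leaves represent all classes
  of the family except that of \<open>a\<close>, which is the one class that a constellation may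
  miss.\<close>

lemma constellation_exists:
  assumes M: "partial M" and a: "uncovered M a" and lay: "layered a M Ls"
  defines "Y \<equiv> set (leaves M (concat Ls))"
  defines "P \<equiv> set (related E M (concat Ls))"
  shows "\<exists>K. constellation G (cls ` insert a Y) K \<and> pverts K = P \<union> Y"
proof -
  note C = layered_centres[OF M a lay]
  let ?B = "cls ` insert a Y"
  define W where "W = P \<union> Y"
  have YM: "Y \<subseteq> set M" and Yx: "\<And>y. y \<in> Y \<Longrightarrow> \<exists>x\<in>P. E x y"
    using E_sym by (auto simp: Y_def P_def set_related)
  have PX: "P \<subseteq> set (concat Ls)" by (auto simp: P_def set_related)
  have Py: "\<exists>y\<in>Y. E x y" if "x \<in> P" for x
    using that E_sym unfolding Y_def P_def set_related by blast
  have YV: "Y \<subseteq> V" using YM partialD(1)[OF M] by blast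
  have aV: "a \<in> V" and aY: "\<And>y. y \<in> Y \<Longrightarrow> \<not> S a y" using a YM by (auto simp: uncovered_def)
  have PP: "\<not> E x x'" if "x \<in> P" "x' \<in> P" for x x' using C that PX by blast
  have YY: "\<not> E y y'" if "y \<in> Y" "y' \<in> Y" for y y' using partialD(3)[OF M] that YM by blast
  have uniq: "x = x'" if "x \<in> P" "x' \<in> P" "y \<in> Y" "E x y" "E x' y" for x x' y
    using C that PX YM E_sym by blast
  have own: "\<not> S x y" if "x \<in> P" "y \<in> Y" "E x y" for x y
    using C that PX YM by blast
  have disj: "P \<inter> Y = {}" using Yx PP by blast
  have WB: "W \<subseteq> \<Union>?B"
  proof
    fix w assume "w \<in> W"
    then consider "w \<in> P" | "w \<in> Y" by (auto simp: W_def)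
    then show "w \<in> \<Union>?B"
    proof cases
      case 1
      then obtain z where "z \<in> insert a Y" "S w z" using C PX unfolding Y_def by fastforce
      then show ?thesis using S_sym by (auto simp: cls_def)
    next
      case 2
      then show ?thesis using self_in_cls YV by auto
    qed
  qed
  have BVs: "?B \<subseteq> set Vs" using cls_in aV YV by auto
  define f where "f y = (SOME x. x \<in> P \<and> E x y)" for y
  have f: "f y \<in> P" "E (f y) y" if "y \<in> Y" for y
    using someI_ex[of "\<lambda>x. x \<in> P \<and> E x y"] Yx that unfolding f_def by blast+
  have f_eq: "f y = x" if "y \<in> Y" "x \<in> P" "E x y" for x y using f uniq that by blast
  define A where "A = {(u, v) \<in> parcs (class_graph G ?B). u \<in> W \<and> v \<in> W}"
  define K where "K = \<lparr>pverts = W, parcs = A\<rparr>"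
  have A: "A = (\<Union>y\<in>Y. {(f y, y), (y, f y)})"
  proof (intro equalityI subsetI)
    fix e assume "e \<in> A"
    then obtain u v where e: "e = (u, v)" "E u v" "u \<in> W" "v \<in> W"
      by (auto simp: A_def class_graph_def E_def)
    then consider "u \<in> P" "v \<in> Y" | "u \<in> Y" "v \<in> P" using PP YY by (auto simp: W_def)
    then show "e \<in> (\<Union>y\<in>Y. {(f y, y), (y, f y)})"
    proof cases
      case 1
      then have "f v = u" using f_eq e by blast
      then show ?thesis using e 1 by blast
    next
      case 2
      then have "f u = v" using f_eq e E_sym by blast
      then show ?thesis using e 2 by blast
    qed
  next
    fix e assume "e \<in> (\<Union>y\<in>Y. {(f y, y), (y, f y)})"
    then obtain y where y: "y \<in> Y" "e = (f y, y) \<or> e = (y, f y)" by blast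
    \<comment> \<open>The edges of the stars survive in \<open>class_graph\<close>, since a centre
      never shares a class with its leaf.\<close>
    have "\<not> (\<exists>X\<in>?B. f y \<in> X \<and> y \<in> X)"
      using own[OF f(1)[OF y(1)] y(1) f(2)[OF y(1)]] BVs S_iff by blast
    moreover have "f y \<in> W" "y \<in> W" using f y by (auto simp: W_def)
    moreover have "(f y, y) \<in> parcs G" "(y, f y) \<in> parcs G" using f(2)[OF y(1)] E_sym by (auto simp: E_def)
    ultimately show "e \<in> A" using y(2) WB by (auto simp: A_def class_graph_def)
  qed
  have sccs: "pre_digraph.sccs (with_proj K) = (\<lambda>p. with_proj K \<restriction> insert p {y \<in> Y. f y = p}) ` P"
    by (rule star_forest_sccs) (use disj f A in \<open>auto simp: K_def W_def\<close>)
  \<comment> \<open>Every component meets \<open>P\<close> in exactly one vertex, so membership in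
    \<open>P\<close> singles out the centre even in a star with one leaf.\<close>
  define centre where "centre C = (SOME p. p \<in> verts C \<inter> P)" for C :: "(nat, nat \<times> nat) pre_digraph"
  have centre: "centre (with_proj K \<restriction> insert p {y \<in> Y. f y = p}) = p" if "p \<in> P" for p
  proof -
    have "verts (with_proj K \<restriction> insert p {y \<in> Y. f y = p}) \<inter> P = {p}" using that disj by auto
    then show ?thesis unfolding centre_def by simp
  qed
  have star: "star_with_centre C (centre C)" if "C \<in> pre_digraph.sccs (with_proj K)" for C
  proof -
    obtain p where p: "p \<in> P" and C: "C = with_proj K \<restriction> insert p {y \<in> Y. f y = p}"
      using \<open>C \<in> _\<close> sccs by auto
    obtain y where y: "y \<in> Y" "E p y" using Py p by blast
    then have "f y = p" using f_eq p by blast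
    moreover have "p \<notin> Y" using p disj by blast
    moreover have "arcs C = {p} \<times> {y \<in> Y. f y = p} \<union> {y \<in> Y. f y = p} \<times> {p}"
      using p disj f(1) unfolding C by (auto simp: K_def A)
    ultimately show ?thesis
      unfolding star_with_centre_def using centre[OF p] y C by auto
  qed
  have "(\<Union>C\<in>pre_digraph.sccs (with_proj K). verts C - {centre C}) =
      (\<Union>p\<in>P. insert p {y \<in> Y. f y = p} - {p})"
    unfolding sccs using centre by auto
  also have "\<dots> = Y"
  proof (intro equalityI subsetI)
    fix y assume "y \<in> Y"
    moreover have "f y \<noteq> y" using f(1)[OF \<open>y \<in> Y\<close>] disj \<open>y \<in> Y\<close> by (metis disjoint_iff)
    ultimately show "y \<in> (\<Union>p\<in>P. insert p {y \<in> Y. f y = p} - {p})" using f(1) by auto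
  qed auto
  finally have leafset: "(\<Union>C\<in>pre_digraph.sccs (with_proj K). verts C - {centre C}) = Y" .
  have fin: "finite Y" by (simp add: Y_def)
  have "cls a \<notin> cls ` Y" using aY aV YV cls_eq_iff by blast
  then have card: "card (cls ` Y) + 1 = card ?B" using fin by simp
  have "independent_transversal G (cls ` Y) Y"
  proof -
    define v where "v X = (SOME y. y \<in> Y \<and> y \<in> X)" for X
    have v: "v (cls y) = y" if y: "y \<in> Y" for y
      unfolding v_def
    proof (rule some_equality)
      show "y \<in> Y \<and> y \<in> cls y" using y YV self_in_cls by blast
      show "y' = y" if "y' \<in> Y \<and> y' \<in> cls y" for y'
        using that y partialD(4)[OF M, of y y'] YM by (auto simp: cls_def)
    qed
    have "independent_set G Y"
      unfolding independent_set_def using YV YY by (auto simp: E_def)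
    moreover have "\<forall>X\<in>cls ` Y. v X \<in> X" using v YV self_in_cls by auto
    moreover have "Y = v ` cls ` Y" using v by (force simp: image_image)
    ultimately show ?thesis unfolding independent_transversal_def by blast
  qed
  moreover have "induced_subgraph (with_proj K) (with_proj (class_graph G ?B))"
  proof -
    have "pair_wf_digraph K" by unfold_locales (auto simp: K_def A_def)
    moreover have "pair_wf_digraph (class_graph G ?B)"
      by unfold_locales (auto simp: class_graph_def)
    moreover have "W \<subseteq> pverts (class_graph G ?B)" using WB by (simp add: class_graph_def)
    moreover have "parcs K \<subseteq> parcs (class_graph G ?B)" by (auto simp: K_def A_def)
    ultimately show ?thesis
      unfolding induced_subgraph_def subgraph_def compatible_def
      by (auto simp: wf_digraph_wp_iff K_def A_def)
  qed
  ultimately have "constellation G ?B K"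
    unfolding constellation_def using star leafset card
    by (intro conjI exI[of _ centre] exI[of _ "cls ` Y"]) auto
  moreover have "pverts K = P \<union> Y" by (simp add: K_def W_def)
  ultimately show ?thesis by blast
qed

section \<open>The dominated classes and the size of the dominating set\<close>

lemma set_class_indices:
  "set (class_indices T N i ds) = {i + j | j. j < length ds \<and>
     (\<exists>z\<in>set T. S (hd (ds ! j)) z) \<and> \<not> (\<exists>z\<in>set N. S (hd (ds ! j)) z)}"
proof (induction ds arbitrary: i)
  case Nil
  then show ?case by simp
next
  case (Cons c ds)
  let ?Q = "\<lambda>c. (\<exists>z\<in>set T. S (hd c) z) \<and> \<not> (\<exists>z\<in>set N. S (hd c) z)"
  have "{i + j | j. j < length (c # ds) \<and> ?Q ((c # ds) ! j)} =
      (if ?Q c then {i} else {}) \<union> {Suc i + j | j. j < length ds \<and> ?Q (ds ! j)}" (is "?A = ?B")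
  proof (intro equalityI subsetI)
    fix x assume "x \<in> ?A"
    then obtain j where j: "x = i + j" "j < length (c # ds)" "?Q ((c # ds) ! j)" by blast
    then show "x \<in> ?B" by (cases j) auto
  next
    fix x assume "x \<in> ?B"
    then consider "?Q c" "x = i" | j where "x = Suc i + j" "j < length ds" "?Q (ds ! j)"
      by (auto split: if_splits)
    then show "x \<in> ?A"
    proof cases
      case 1
      then show ?thesis by (intro CollectI exI[of _ 0]) auto
    next
      case 2
      then show ?thesis by (intro CollectI exI[of _ "Suc j"]) auto
    qed
  qed
  then show ?case using Cons[of "Suc i"] by simp
qed

lemma class_indices_classes:
  assumes "set T \<subseteq> V" "set N \<subseteq> V"
  shows "(\<lambda>i. Vs ! i) ` set (class_indices T N 0 cs) = cls ` set T - cls ` set N"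
    and "i \<in> set (class_indices T N 0 cs) \<Longrightarrow> i < length Vs"
proof -
  have len: "length cs = length Vs" by (simp add: cs_def)
  have nth: "S (hd (cs ! j)) z \<longleftrightarrow> Vs ! j = cls z" if "j < length Vs" "z \<in> V" for j z
  proof -
    have X: "Vs ! j \<in> set Vs" using that by simp
    have c: "cs ! j \<in> set cs" "set (cs ! j) = Vs ! j" using that finite_class[OF X] len by (auto simp: cs_def)
    have "S (hd (cs ! j)) z \<longleftrightarrow> z \<in> Vs ! j" using S_class[OF c(1) hd_cs[OF c(1)]] c(2) by simp
    also have "\<dots> \<longleftrightarrow> Vs ! j = cls z" using cls_eq[OF X, of z] self_in_cls[OF that(2)] by auto
    finally show ?thesis .
  qed
  have ex: "(\<exists>z\<in>set U. S (hd (cs ! j)) z) \<longleftrightarrow> Vs ! j \<in> cls ` set U" if "j < length Vs" "set U \<subseteq> V" for j U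
    using nth[OF that(1)] that(2) by blast
  have mem: "j \<in> set (class_indices T N 0 cs) \<longleftrightarrow>
    j < length Vs \<and> Vs ! j \<in> cls ` set T - cls ` set N" for j
  proof (cases "j < length Vs")
    case True
    show ?thesis
      unfolding set_class_indices len Diff_iff ex[OF True assms(1), symmetric]
        ex[OF True assms(2), symmetric] using True by simp
  next
    case False
    then show ?thesis unfolding set_class_indices len by simp
  qed
  show "(\<lambda>i. Vs ! i) ` set (class_indices T N 0 cs) = cls ` set T - cls ` set N"
  proof (intro equalityI subsetI)
    fix X assume "X \<in> (\<lambda>i. Vs ! i) ` set (class_indices T N 0 cs)"
    then obtain j where "X = Vs ! j" "j \<in> set (class_indices T N 0 cs)" by (rule imageE)
    then show "X \<in> cls ` set T - cls ` set N" unfolding mem by simp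
  next
    fix X assume X: "X \<in> cls ` set T - cls ` set N"
    moreover have "cls ` set T \<subseteq> set Vs" using cls_in assms by blast
    ultimately have "X \<in> set Vs" by blast
    then obtain j where j: "j < length Vs" "X = Vs ! j" by (metis in_set_conv_nth)
    then have "j \<in> set (class_indices T N 0 cs)" unfolding mem using X by simp
    then show "X \<in> (\<lambda>i. Vs ! i) ` set (class_indices T N 0 cs)" using j(2) by (rule rev_image_eqI)
  qed
  show "i \<in> set (class_indices T N 0 cs) \<Longrightarrow> i < length Vs" unfolding mem by blast
qed

text \<open>
  Here \<open>t\<close> is the number of leaves, \<open>l\<close> the length of the last, short layer, and \<open>e\<close> counts the
  vertices outside the constellation: centres without leaves, the last layer and its \<open>M\<close>-neighbours.
\<close>

definition small_dominator :: "nat list \<Rightarrow> nat list \<Rightarrow> bool" where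
  "small_dominator js ds \<longleftrightarrow> (\<exists>t e l. 0 < t \<and> k * l < t \<and> (k - 1) * e \<le> (r + 2) * t \<and>
        (\<forall>i\<in>set js. i < length Vs) \<and> set ds \<subseteq> V \<and>
        totally_dominates G (set ds) (class_graph G ((\<lambda>i. Vs ! i) ` set js)) \<and>
        t + 1 \<le> card ((\<lambda>i. Vs ! i) ` set js) + l \<and> card (set ds) \<le> 2 * t + e \<and>
        (\<exists>\<B>\<^sub>0 K. (\<lambda>i. Vs ! i) ` set js \<subseteq> \<B>\<^sub>0 \<and> \<B>\<^sub>0 \<subseteq> set Vs \<and> constellation G \<B>\<^sub>0 K \<and>
           pverts K \<subseteq> set ds \<and> card (set ds - pverts K) \<le> e))"

text \<open>There are \<open>t + 1\<close> reached classes, and at most \<open>length N\<close> of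
  them receive a vertex of the short layer. All others had no free vertex when they were scanned, so
  by the last clause of \<open>build_inv\<close> they are dominated.\<close>

lemma grow_BD:
  assumes M: "partial M" and a: "uncovered M a" and lay: "layered a M Ls" and st: "stuck M Ls"
    and grow: "grow a M Ls = BD is ds"
  shows "small_dominator is ds"
proof -
  define X where "X = concat Ls"
  define y where "y = leaves M X"
  define N where "N = build M X (a # y) [] cs"
  have BD: "k * length N < length y" "is = class_indices (a # y) N 0 cs"
    "ds = N @ X @ leaves M (N @ X)"
    using grow unfolding grow_def Let_def X_def[symmetric] y_def[symmetric] N_def[symmetric]
    by (auto split: if_splits)
  note inv = build_invD[OF build_correct[of M X "a # y", folded N_def]]
  have yM: "set y \<subseteq> set M" by (auto simp: y_def set_related)
  have yV: "set y \<subseteq> V" using yM partialD(1)[OF M] by blast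
  have aV: "a \<in> V" and anoty: "\<And>z. z \<in> set y \<Longrightarrow> \<not> S a z" using a yM by (auto simp: uncovered_def)
  have TV: "set (a # y) \<subseteq> V" using yV aV by simp
  have XV: "set X \<subseteq> V" using layered_centres[OF M a lay] unfolding X_def by blast
  have lV: "set (leaves M Z) \<subseteq> V" for Z using partialD(1)[OF M] by (auto simp: set_related)
  define \<B> where "\<B> = cls ` set (a # y) - cls ` set N"
  have B: "(\<lambda>i. Vs ! i) ` set is = \<B>" and idx: "\<forall>i\<in>set is. i < length Vs"
    using class_indices_classes[OF TV inv(1)] unfolding BD(2) \<B>_def by auto
  have fr: "(k - 1) * length (unrelated E M X) \<le> length y" "length (related E M X) \<le> length y"
    using free_total[OF lay st] unfolding X_def y_def by auto
  \<comment> \<open>Each vertex of \<open>N\<close> is counted with its at most \<open>r\<close>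
    leaves. Both the number of idle centres and \<open>length N\<close> are at most
    \<open>t / (k - 1)\<close>, which yields the factor \<open>1 + (r + 1) = r + 2\<close>.\<close>
  define e where "e = length (unrelated E M X) + (r + 1) * length N"
  have "(k - 1) * length N \<le> length y"
    using BD(1) mult_le_mono1[of "k - 1" k "length N"] by linarith
  then have "(r + 1) * ((k - 1) * length N) \<le> (r + 1) * length y" by (rule mult_le_mono2)
  then have e: "(k - 1) * e \<le> (r + 2) * length y"
  proof -
    assume "(r + 1) * ((k - 1) * length N) \<le> (r + 1) * length y"
    moreover have "(k - 1) * e = (k - 1) * length (unrelated E M X) + (r + 1) * ((k - 1) * length N)"
      by (simp only: e_def distrib_left mult.left_commute)
    moreover have "(r + 2) * length y = (r + 1) * length y + length y" by simp
    ultimately show ?thesis using fr(1) by linarith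
  qed
  have "distinct y" unfolding y_def using partialD(2)[OF M] by (rule distinct_related)
  have inj: "inj_on cls (set (a # y))"
  proof (rule inj_onI)
    fix u v assume uv: "u \<in> set (a # y)" "v \<in> set (a # y)" "cls u = cls v"
    then have "S u v" using TV cls_eq_iff by blast
    show "u = v"
    proof (cases "u = a \<or> v = a")
      case True
      then show ?thesis using uv anoty S_sym \<open>S u v\<close> by auto
    next
      case False
      then have "u \<in> set M" "v \<in> set M" using uv yM by auto
      then show ?thesis using \<open>S u v\<close> partialD(4)[OF M] by blast
    qed
  qed
  have "a \<notin> set y" using anoty S_refl aV by blast
  then have cardT: "card (cls ` set (a # y)) = length y + 1"
    using card_image[OF inj] \<open>distinct y\<close> by (simp add: distinct_card)
  have "card (cls ` set (a # y)) - card (cls ` set N) \<le> card \<B>"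
    unfolding \<B>_def by (rule diff_card_le_card_Diff) simp
  moreover have "card (cls ` set N) \<le> length N"
    using card_image_le[of "set N" cls] card_length[of N] by simp
  ultimately have cardB: "length y + 1 \<le> card \<B> + length N" using cardT by linarith
  have dom: "totally_dominates G (set ds) (class_graph G \<B>)"
    unfolding totally_dominates_def
  proof
    fix w assume "w \<in> pverts (class_graph G \<B>)"
    then obtain X' where X': "X' \<in> \<B>" "w \<in> X'" by (auto simp: class_graph_def)
    then obtain z where z: "z \<in> set (a # y)" "X' = cls z" by (auto simp: \<B>_def)
    have "X' \<in> set Vs" using z TV cls_in by blast
    then obtain c where c: "c \<in> set cs" "set c = X'" using set_cs by (metis imageE)
    have zc: "z \<in> set c" using c z TV self_in_cls by blast
    then have "\<exists>z\<in>set (a # y). S (hd c) z" using S_class[OF c(1) hd_cs[OF c(1)]] z(1) by blast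
    moreover have "\<not> (\<exists>x\<in>set N. x \<in> set c)"
    proof
      assume "\<exists>x\<in>set N. x \<in> set c"
      then obtain x where "x \<in> set N" "x \<in> X'" using c by blast
      then have "X' = cls x" using cls_eq \<open>X' \<in> set Vs\<close> by blast
      then show False using X' \<open>x \<in> set N\<close> by (auto simp: \<B>_def)
    qed
    ultimately have "\<forall>v\<in>set c. \<exists>u\<in>set (N @ X @ leaves M (N @ X)). E v u"
      using inv(9)[OF c(1)] by blast
    then obtain u where "u \<in> set ds" "E w u" unfolding BD(3) using X'(2) c(2) by blast
    then show "\<exists>u\<in>set ds. (u, w) \<in> parcs G" using E_sym unfolding E_def by blast
  qed
  obtain K where K: "constellation G (cls ` insert a (set y)) K"
    "pverts K = set (related E M X) \<union> set y"
    using constellation_exists[OF M a lay] unfolding X_def y_def by blast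
  have dsV: "set ds \<subseteq> V" unfolding BD(3) using inv(1) XV lV by simp
  have sub: "pverts K \<subseteq> set ds"
    unfolding K(2) BD(3) by (auto simp: set_related y_def)
  have "set ds - pverts K \<subseteq> set (unrelated E M X @ N @ leaves M N)"
    unfolding K(2) BD(3) y_def by (auto simp: set_related set_unrelated)
  then have "card (set ds - pverts K) \<le> card (set (unrelated E M X @ N @ leaves M N))"
    by (intro card_mono) auto
  also have "\<dots> \<le> length (unrelated E M X @ N @ leaves M N)" by (rule card_length)
  also have "\<dots> \<le> e" using leaves_le[OF M inv(1)] by (simp add: e_def)
  finally have cK: "card (set ds - pverts K) \<le> e" .
  have "card (pverts K) \<le> length (related E M X @ y)"
    unfolding K(2) set_append[symmetric] by (rule card_length)
  then have "card (pverts K) \<le> 2 * length y" using fr(2) by simp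
  moreover have "card (set ds) = card (set ds - pverts K) + card (pverts K)"
    using card_Diff_subset[OF finite_subset[OF sub]] sub card_mono[OF _ sub] by simp
  ultimately have cD: "card (set ds) \<le> 2 * length y + e" using cK by linarith
  have "\<B> \<subseteq> cls ` insert a (set y)" by (auto simp: \<B>_def)
  moreover have "cls ` insert a (set y) \<subseteq> set Vs" using TV cls_in by auto
  ultimately have "\<exists>\<B>\<^sub>0 K. \<B> \<subseteq> \<B>\<^sub>0 \<and> \<B>\<^sub>0 \<subseteq> set Vs \<and> constellation G \<B>\<^sub>0 K \<and>
       pverts K \<subseteq> set ds \<and> card (set ds - pverts K) \<le> e"
    using K(1) sub cK by blast
  moreover have "0 < length y" using BD(1) by linarith
  ultimately show ?thesis
    unfolding small_dominator_def B using BD(1) e idx dsV dom cardB cD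
    by (intro exI[of _ "length y"] exI[of _ e] exI[of _ "length N"] conjI) assumption+
qed

end

section \<open>The potential\<close>

definition shrink :: "nat \<Rightarrow> real" where
  "shrink k = 1 - 1 / (real k)\<^sup>2"

text \<open>A fresh layer over \<open>t \<ge> 1\<close> leaves has at most
  \<open>t + 1 \<le> 2 * t\<close> centres, hence at most \<open>2 * r * t\<close> leaves. After
  this many hits it would have fewer leaves than a stuck layer must have by
  \<open>stuck_layer\<close>.\<close>

definition hit_bound :: "nat \<Rightarrow> nat \<Rightarrow> nat" where
  "hit_bound r k = (LEAST c. 2 * real r * shrink k ^ c < (real k - 1) / (real k)\<^sup>2)"

text \<open>By \<open>growth\<close>, a stuck stack of \<open>j \<ge> 1\<close> layers satisfies
  \<open>rate k ^ (j - 1) \<le> n\<close>, so \<open>j\<close> is at most the least exponent in the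
  definition. The successor leaves room for the newest layer, which need not be stuck.\<close>

definition depth :: "nat \<Rightarrow> nat \<Rightarrow> nat" where
  "depth k n = Suc (LEAST l. real n < rate k ^ l)"

lemma shrink_bounds: "k \<ge> 3 \<Longrightarrow> 0 < shrink k" "k \<ge> 3 \<Longrightarrow> shrink k < 1"
  unfolding shrink_def by (simp_all add: power_gt1)

lemma ex_power_shrink_less:
  assumes "k \<ge> 3" "0 < b"
  shows "\<exists>c. a * shrink k ^ c < b"
proof -
  obtain c where c: "shrink k ^ c < b / (\<bar>a\<bar> + 1)"
    using real_arch_pow_inv[of "b / (\<bar>a\<bar> + 1)" "shrink k"] shrink_bounds assms by auto
  have "a * shrink k ^ c \<le> (\<bar>a\<bar> + 1) * shrink k ^ c"
    using shrink_bounds(1)[OF assms(1)] by (intro mult_right_mono) auto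
  also have "\<dots> < b" using c by (simp add: field_simps)
  finally show ?thesis by blast
qed

lemma hit_bound: "k \<ge> 3 \<Longrightarrow> 2 * real r * shrink k ^ hit_bound r k < (real k - 1) / (real k)\<^sup>2"
  unfolding hit_bound_def by (rule LeastI_ex) (rule ex_power_shrink_less, auto)

lemma rate_gt_1: "k \<ge> 3 \<Longrightarrow> rate k > 1"
  by (simp add: rate_def)

lemma less_depth:
  assumes "k \<ge> 3" "rate k ^ i \<le> real n"
  shows "Suc i < depth k n"
proof -
  have "\<exists>l. real n < rate k ^ l" using real_arch_pow rate_gt_1[OF assms(1)] by blast
  then have "real n < rate k ^ (LEAST l. real n < rate k ^ l)" by (rule LeastI_ex)
  then have "rate k ^ i < rate k ^ (LEAST l. real n < rate k ^ l)" using assms(2) by linarith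
  then have "i < (LEAST l. real n < rate k ^ l)"
    using rate_gt_1[OF assms(1)] power_strict_increasing_iff by blast
  then show ?thesis by (simp add: depth_def)
qed

context partitioned_graph begin

text \<open>
  As long as a layer is stuck, its number of leaves is at least the maximum below, and every hit
  multiplies this number by at most \<open>shrink k\<close>.
\<close>

definition hits_left :: "nat list \<Rightarrow> nat list \<Rightarrow> nat list \<Rightarrow> nat" where
  "hits_left M N X = (LEAST w. real (length (leaves M N)) * shrink k ^ w
     < max 1 (real (length (leaves M X)) * ((real k - 1) / (real k)\<^sup>2)))"

abbreviation "L \<equiv> depth k n"
abbreviation "base \<equiv> hit_bound r k + 2"

text \<open>The bottom layer carries the most significant digit, so that a hit on a layer may
  discard the digits of all layers above it.\<close>

fun layer_potential :: "nat list \<Rightarrow> nat list list \<Rightarrow> nat" where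
  "layer_potential M [] = 0"
| "layer_potential M (N # Ls) =
     hits_left M N (concat Ls) * base ^ (L - Suc (length Ls)) + layer_potential M Ls"

text \<open>The last summand stands for the layers not yet built. A new layer replaces it by
  \<open>base\<close> times a smaller power \<open>p\<close>: at most \<open>hit_bound r k\<close>
  copies of \<open>p\<close> pay for its digit, one copy is the new last summand, and one copy is
  the strict decrease. Hence the 2 in \<open>base\<close>.\<close>

definition potential :: "nat list \<Rightarrow> nat list list \<Rightarrow> nat" where
  "potential M Ls = (length cs - length M) * base ^ L + layer_potential M Ls + base ^ (L - length Ls)"

text \<open>The root \<open>a\<close> is not stored: it is the head of the first class that
  \<open>M\<close> misses. Swaps exchange vertices within their classes, so the missed classes, and
  with them the root of the layers, stay the same.\<close>

definition state_ok :: "nat list \<Rightarrow> nat list list \<Rightarrow> bool" where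
  "state_ok M Ls \<longleftrightarrow> partial M \<and>
     (case unrelated S M (map hd cs) of [] \<Rightarrow> True | a # _ \<Rightarrow> layered a M Ls)"

lemma state_ok_Nil: "partial M \<Longrightarrow> state_ok M []"
  by (auto simp: state_ok_def split: list.split)

lemma root_uncovered:
  assumes "unrelated S M (map hd cs) = a # as"
  shows "uncovered M a"
proof -
  have "a \<in> set (unrelated S M (map hd cs))" using assms by simp
  then have "a \<in> hd ` set cs" "\<forall>y\<in>set M. \<not> S a y" by (auto simp: set_unrelated)
  moreover then have "a \<in> V" using hd_cs cs_subset by blast
  ultimately show ?thesis by (simp add: uncovered_def)
qed

lemma covered_transversal:
  assumes M: "partial M" and cov: "unrelated S M (map hd cs) = []"
  shows "independent_transversal G (set Vs) (set M)"
proof -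
  have ex: "\<exists>y\<in>set M. y \<in> X" if X: "X \<in> set Vs" for X
  proof -
    obtain c where c: "c \<in> set cs" "set c = X" using X set_cs by (metis imageE)
    have "set (unrelated S M (map hd cs)) = {}" using cov by simp
    then obtain y where "y \<in> set M" "S (hd c) y" using c unfolding set_unrelated by fastforce
    then show ?thesis using S_class[OF c(1) hd_cs[OF c(1)]] c(2) by blast
  qed
  define v where "v X = (SOME y. y \<in> set M \<and> y \<in> X)" for X
  have v: "v X \<in> set M" "v X \<in> X" if "X \<in> set Vs" for X
    using someI_ex[of "\<lambda>y. y \<in> set M \<and> y \<in> X"] ex[OF that] unfolding v_def by blast+
  have "set M \<subseteq> v ` set Vs"
  proof
    fix y assume y: "y \<in> set M"
    then obtain X where X: "X \<in> set Vs" "y \<in> X" using partialD(1)[OF M] partition(2) by blast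
    have "v X = y" using partialD(4)[OF M v(1)[OF X(1)] y] v(2)[OF X(1)] X unfolding S_iff by blast
    then show "y \<in> v ` set Vs" using X(1) by blast
  qed
  then have "set M = v ` set Vs" using v(1) by blast
  moreover have "independent_set G (set M)"
    unfolding independent_set_def using partialD(1,3)[OF M] by (auto simp: E_def)
  ultimately show ?thesis unfolding independent_transversal_def using v(2) by blast
qed

lemma partial_length: "partial M \<Longrightarrow> length M \<le> length cs"
proof (rule length_le_by_relation[where R = "\<lambda>x c. x \<in> set c"])
  assume M: "partial M"
  show "distinct M" by (rule partialD(2)[OF M])
  show "\<exists>c\<in>set cs. x \<in> set c" if "x \<in> set M" for x
    using that partialD(1)[OF M] S_refl[of x] unfolding S_def by blast
  show "x = x'" if "x \<in> set M" "x' \<in> set M" "c \<in> set cs" "x \<in> set c" "x' \<in> set c" for x x' c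
    using that partialD(4)[OF M] unfolding S_def by blast
qed

lemma hits_left_spec:
  "real (length (leaves M N)) * shrink k ^ hits_left M N X
     < max 1 (real (length (leaves M X)) * ((real k - 1) / (real k)\<^sup>2))"
  unfolding hits_left_def
  by (rule LeastI_ex) (rule ex_power_shrink_less[OF k_ge], simp)

lemma hits_left_le:
  assumes "real (length (leaves M N)) * shrink k ^ w
     < max 1 (real (length (leaves M X)) * ((real k - 1) / (real k)\<^sup>2))"
  shows "hits_left M N X \<le> w"
  unfolding hits_left_def using assms by (rule Least_le)

lemma grow_Continue:
  assumes M: "partial M" and a: "uncovered M a" and lay: "layered a M Ls" and st: "stuck M Ls"
    and grow: "grow a M Ls = Continue M' Ls'"
  shows "M' = M \<and> layered a M Ls' \<and> potential M Ls' < potential M Ls"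
proof -
  define X where "X = concat Ls"
  define y where "y = leaves M X"
  define N where "N = build M X (a # y) [] cs"
  have C: "length y \<le> k * length N" "M' = M" "Ls' = N # Ls"
    using grow unfolding grow_def Let_def X_def[symmetric] y_def[symmetric] N_def[symmetric]
    by (auto split: if_splits)
  note inv = build_invD[OF build_correct[of M X "a # y", folded N_def]]
  have Ls_pos: "1 \<le> length y" if "Ls \<noteq> []"
  proof -
    have "0 < rate k ^ (length Ls - 1)" using rate_gt_1[OF k_ge] by simp
    then show ?thesis using growth[OF lay st that] unfolding y_def X_def by linarith
  qed
  \<comment> \<open>An empty layer passes the length test only if there are no leaves, hence no
    layers. Then nothing dominates \<open>a\<close>, while the class of \<open>a\<close> counts as
    reached, so the scan would have selected a vertex from it.\<close>
  have "N \<noteq> []"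
  proof
    assume N: "N = []"
    then have Ls: "Ls = []" using C(1) Ls_pos by auto
    have aV: "a \<in> V" using a by (simp add: uncovered_def)
    obtain c where c: "c \<in> set cs" "a \<in> set c" using S_refl[OF aV] unfolding S_def by blast
    have "\<exists>z\<in>set (a # y). S (hd c) z" using S_class[OF c(1) hd_cs[OF c(1)]] c(2) by auto
    from inv(9)[OF c(1) this] have "\<exists>u\<in>set (N @ X @ leaves M (N @ X)). E a u"
      using N c(2) by auto
    then show False using N Ls by (simp add: X_def related_def)
  qed
  then have ok: "layer_ok a M N X"
    unfolding layer_ok_def using C(1) inv unfolding y_def
    by (intro conjI ballI impI) (assumption | blast)+
  then have lay': "layered a M Ls'" using lay st by (simp add: C(3) X_def)
  have NT: "length N \<le> length (a # y)"
  proof (rule length_le_by_relation[where R = S])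
    show "distinct N" by (rule inv(2))
    show "\<exists>z\<in>set (a # y). S x z" if "x \<in> set N" for x using inv(6)[OF that] .
    show "x = x'" if "x \<in> set N" "x' \<in> set N" "z \<in> set (a # y)" "S x z" "S x' z" for x x' z
      using inv(8)[OF that(1,2)] that(4,5) S_sym S_trans by blast
  qed
  have len: "Suc (length Ls) \<le> L"
  proof (cases "Ls = []")
    case True
    then show ?thesis by (simp add: depth_def)
  next
    case False
    have "length y \<le> n" using length_related_le[of E X M] partial_length[OF M] length_cs
      unfolding y_def by linarith
    then have "rate k ^ (length Ls - 1) \<le> real n"
      using growth[OF lay st False] unfolding y_def X_def by linarith
    from less_depth[OF k_ge this] False show ?thesis by (cases Ls) auto
  qed
  have hl: "hits_left M N X \<le> hit_bound r k"
  proof (rule hits_left_le)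
    let ?s = "shrink k ^ hit_bound r k" and ?t = "real (length y)" and ?d = "(real k - 1) / (real k)\<^sup>2"
    have s0: "0 \<le> ?s" using shrink_bounds(1)[OF k_ge] by simp
    have kk: "real k * 1 \<le> real k * real k" using k_ge by (intro mult_left_mono) auto
    have d1: "?d \<le> 1"
      unfolding power2_eq_square using k_ge by (subst divide_le_eq_1_pos) (simp, use kk in linarith)
    have d0: "0 \<le> ?d" using k_ge by simp
    have "length (leaves M N) \<le> r * length N" by (rule leaves_le[OF M inv(1)])
    also have "\<dots> \<le> r * (length y + 1)" using NT by (intro mult_le_mono2) simp
    finally have "real (length (leaves M N)) \<le> real (r * (length y + 1))" by (rule of_nat_mono)
    then have le: "real (length (leaves M N)) * ?s \<le> real r * (?t + 1) * ?s"
      using s0 by (intro mult_right_mono) (auto simp: algebra_simps)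
    have b: "2 * real r * ?s < ?d" by (rule hit_bound[OF k_ge])
    show "real (length (leaves M N)) * ?s < max 1 (real (length (leaves M X)) * ?d)"
    proof (cases "length y = 0")
      \<comment> \<open>The case of a bottom layer: the threshold is the 1 in the maximum, and
        \<open>length N \<le> 1\<close> leaves at most \<open>r\<close> leaves.\<close>
      case True
      have "0 \<le> real r * ?s" using s0 by simp
      moreover have "real (length (leaves M N)) * ?s \<le> real r * ?s" using le True by simp
      ultimately have "real (length (leaves M N)) * ?s < 1" using b d1 d0 by linarith
      then show ?thesis by simp
    next
      case False
      then have t: "1 \<le> ?t" by (cases "length y") auto
      have "real r * (?t + 1) * ?s \<le> real r * (2 * ?t) * ?s"
        using t s0 by (intro mult_right_mono mult_left_mono) auto
      also have "\<dots> = ?t * (2 * real r * ?s)" by simp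
      also have "\<dots> < ?t * ?d" using b t by (intro mult_strict_left_mono) auto
      finally show ?thesis using le unfolding y_def by linarith
    qed
  qed
  have "potential M Ls' < potential M Ls"
  proof -
    have split: "L - length Ls = Suc (L - Suc (length Ls))" using len by simp
    let ?p = "base ^ (L - Suc (length Ls))"
    have "hits_left M N X * ?p \<le> hit_bound r k * ?p" using hl by (rule mult_le_mono1)
    moreover have "base ^ (L - length Ls) = hit_bound r k * ?p + ?p + ?p"
      unfolding split by (simp add: algebra_simps)
    moreover have "0 < ?p" by simp
    ultimately show ?thesis
      unfolding potential_def C(3) layer_potential.simps X_def[symmetric] length_Cons by linarith
  qed
  then show ?thesis using C(2) lay' by blast
qed

section \<open>Stability of the layers when the partial transversal changes\<close>

lemma layer_ok_mono:
  assumes ok: "layer_ok a M N X" and X: "leaves M' X = leaves M X"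
    and N: "set (leaves M' N) \<subseteq> set (leaves M N)"
  shows "layer_ok a M' N X"
proof -
  note I = layer_okD[OF ok]
  have "x = x'" if "x \<in> set N" "x' \<in> set N" "y \<in> set M'" "E y x" "E y x'" for x x' y
  proof -
    have "y \<in> set (leaves M' N)" using that by (auto simp: set_related)
    then have "y \<in> set M" using N by (auto simp: set_related)
    then show ?thesis using I(7) that by blast
  qed
  then show ?thesis
    unfolding layer_ok_def X using I N by (intro conjI ballI impI) (assumption | blast)+
qed

lemma unrelated_cong_leaves:
  assumes "\<And>x. x \<in> set N \<Longrightarrow> set (leaves M' [x]) = set (leaves M [x])"
  shows "unrelated E M' N = unrelated E M N"
  unfolding unrelated_def
proof (rule filter_cong)
  fix x assume "x \<in> set N"
  from assms[OF this] have "\<And>y. y \<in> set M' \<and> E y x \<longleftrightarrow> y \<in> set M \<and> E y x"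
    by (auto simp: set_related)
  then show "(\<not> (\<exists>y\<in>set M'. E x y)) = (\<not> (\<exists>y\<in>set M. E x y))" using E_sym by blast
qed simp

lemma stuck_cong:
  assumes st: "stuck M Ls" and eq: "\<And>Z. set Z \<subseteq> set (concat Ls) \<Longrightarrow> leaves M' Z = leaves M Z"
  shows "stuck M' Ls"
proof (cases Ls)
  case Nil
  then show ?thesis by (simp add: stuck_def)
next
  case (Cons N R)
  have "unrelated E M' N = unrelated E M N"
    by (rule unrelated_cong_leaves) (use eq Cons in auto)
  moreover have "leaves M' (concat R) = leaves M (concat R)" using eq Cons by simp
  ultimately show ?thesis using st Cons by (simp add: stuck_def)
qed

lemma layered_cong:
  assumes "layered a M Ls" and "\<And>Z. set Z \<subseteq> set (concat Ls) \<Longrightarrow> leaves M' Z = leaves M Z"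
  shows "layered a M' Ls"
  using assms
proof (induction Ls)
  case Nil
  then show ?case by simp
next
  case (Cons N R)
  have eq: "leaves M' Z = leaves M Z" if "set Z \<subseteq> set (concat R)" for Z
    using that Cons.prems(2)[of Z] by auto
  have "layered a M' R" using Cons eq by simp
  moreover have "stuck M' R" by (rule stuck_cong[of M]) (use Cons.prems(1) eq in auto)
  moreover have "layer_ok a M' N (concat R)"
    by (rule layer_ok_mono[of a M]) (use Cons.prems eq[of "concat R"] in auto)
  ultimately show ?case by simp
qed

lemma layer_potential_cong:
  assumes "\<And>Z. set Z \<subseteq> set (concat Ls) \<Longrightarrow> leaves M' Z = leaves M Z"
  shows "layer_potential M' Ls = layer_potential M Ls"
  using assms
proof (induction Ls)
  case Nil
  then show ?case by simp
next
  case (Cons N R)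
  have "hits_left M' N (concat R) = hits_left M N (concat R)"
    unfolding hits_left_def using Cons.prems[of N] Cons.prems[of "concat R"] by simp
  moreover have "layer_potential M' R = layer_potential M R"
    by (rule Cons.IH) (use Cons.prems in auto)
  ultimately show ?case by simp
qed

lemma layered_suffix:
  assumes "layered a M (A @ B)" "A \<noteq> []"
  shows "layered a M B \<and> stuck M B"
  using assms
proof (induction A)
  case (Cons N A)
  then show ?case by (cases "A = []") auto
qed simp

lemma layer_potential_suffix: "layer_potential M B \<le> layer_potential M (A @ B)"
  by (induction A) auto

section \<open>Batches of swaps and augmentation\<close>

lemma hit_cases:
  obtains (swap) A N B q where "R = A @ N # B" "q = related S (leaves M N) imm" "q \<noteq> []"
      "length (leaves M N) \<le> k * (k * length q)"
      "hit a M imm R = Continue (q @ unrelated S q M) (N # B)"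
  | (augment) "\<And>N. N \<in> set R \<Longrightarrow> related S (leaves M N) imm = [] \<or>
        k * (k * length (related S (leaves M N) imm)) < length (leaves M N)"
      "hit a M imm R = Continue (head (related S [a] imm) # M) []"
proof -
  have "(\<exists>A N B q. R = A @ N # B \<and> q = related S (leaves M N) imm \<and> q \<noteq> [] \<and>
      length (leaves M N) \<le> k * (k * length q) \<and>
      hit a M imm R = Continue (q @ unrelated S q M) (N # B)) \<or>
    ((\<forall>N\<in>set R. related S (leaves M N) imm = [] \<or>
        k * (k * length (related S (leaves M N) imm)) < length (leaves M N)) \<and>
      hit a M imm R = Continue (head (related S [a] imm) # M) [])"
  proof (induction R)
    case Nil
    then show ?case by simp
  next
    case (Cons N R)
    let ?q = "related S (leaves M N) imm"
    show ?case
    proof (cases "?q \<noteq> [] \<and> length (leaves M N) \<le> k * (k * length ?q)")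
      case True
      then show ?thesis
        by (intro disjI1 exI[of _ "[]"] exI[of _ N] exI[of _ R] exI[of _ ?q]) (simp add: Let_def)
    next
      case False
      then have eq: "hit a M imm (N # R) = hit a M imm R"
        unfolding hit.simps Let_def by (rule if_not_P)
      from Cons show ?thesis
      proof (elim disjE exE conjE)
        fix A N' B q
        assume "R = A @ N' # B" "q = related S (leaves M N') imm" "q \<noteq> []"
          "length (leaves M N') \<le> k * (k * length q)"
          "hit a M imm R = Continue (q @ unrelated S q M) (N' # B)"
        then show ?thesis unfolding eq
          by (intro disjI1 exI[of _ "N # A"] exI[of _ N'] exI[of _ B] exI[of _ q]) simp
      next
        assume "\<forall>N\<in>set R. related S (leaves M N) imm = [] \<or>
          k * (k * length (related S (leaves M N) imm)) < length (leaves M N)"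
          "hit a M imm R = Continue (head (related S [a] imm) # M) []"
        then show ?thesis unfolding eq using False by auto
      qed
    qed
  qed
  then show ?thesis using that by blast
qed

text \<open>The averaging argument, read contrapositively: if no layer is hit hard enough, the
  strict inequalities of the single layers add up over the disjoint leaf sets. The alternative
  \<open>[]\<close> covers layers without any candidate, where strictness could fail.\<close>

lemma no_swap_count:
  assumes "layered a M R" and "\<And>N. N \<in> set R \<Longrightarrow> related S (leaves M N) imm = [] \<or>
        k * (k * length (related S (leaves M N) imm)) < length (leaves M N)"
  shows "related S (leaves M (concat R)) imm = [] \<or>
    k * (k * length (related S (leaves M (concat R)) imm)) < length (leaves M (concat R))"
  using assms
proof (induction R)
  case Nil
  then show ?case by (simp add: related_def)
next
  case (Cons N R)
  let ?q = "related S (leaves M N) imm" and ?Q = "related S (leaves M (concat R)) imm"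
  let ?P = "related S (leaves M (N @ concat R)) imm"
  have ok: "layer_ok a M N (concat R)" using Cons.prems(1) by simp
  have IH: "?Q = [] \<or> k * (k * length ?Q) < length (leaves M (concat R))"
    using Cons by simp
  have q: "?q = [] \<or> k * (k * length ?q) < length (leaves M N)" using Cons.prems(2) by simp
  have len: "length (leaves M (N @ concat R)) = length (leaves M N) + length (leaves M (concat R))"
    using layer_okD(6)[OF ok] by (rule length_leaves_append)
  have "?P = filter (\<lambda>x. (\<exists>z\<in>set (leaves M N). S x z) \<or> (\<exists>z\<in>set (leaves M (concat R)). S x z)) imm"
  proof -
    have set_eq: "set (leaves M (N @ concat R)) = set (leaves M N) \<union> set (leaves M (concat R))"
      unfolding set_related by auto
    show ?thesis unfolding related_def[of S] set_eq by (rule filter_cong) auto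
  qed
  also have "length \<dots> \<le> length ?q + length ?Q"
    unfolding related_def[of S] by (induction imm) auto
  finally have P: "length ?P \<le> length ?q + length ?Q" .
  then have "k * (k * length ?P) \<le> k * (k * length ?q) + k * (k * length ?Q)"
    using mult_le_mono2[OF mult_le_mono2[OF P, of k], of k] by (simp add: algebra_simps)
  moreover have "k * (k * length ?q) + k * (k * length ?Q) < length (leaves M N) + length (leaves M (concat R))"
    if "\<not> (?q = [] \<and> ?Q = [])"
    using q IH that by (cases "?q = []"; cases "?Q = []") auto
  moreover have "?P = []" if "?q = [] \<and> ?Q = []" using P that by simp
  ultimately have "?P = [] \<or> k * (k * length ?P) < length (leaves M (N @ concat R))"
    unfolding len by linarith
  then show ?case by simp
qed


text \<open>One more covered class releases \<open>base ^ L\<close>, exactly the last summand of the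
  potential of an empty stack. The decrease is strict because the last summand of the old potential
  was positive.\<close>

lemma augment_step:
  assumes M: "partial M" and a: "uncovered M a" and x: "x \<in> V" "S x a"
    and free: "\<And>y. y \<in> set M \<Longrightarrow> \<not> E x y"
  shows "partial (x # M) \<and> potential (x # M) [] < potential M Ls"
proof -
  note P = partialD[OF M]
  have xS: "\<not> S x y" "\<not> S y x" if "y \<in> set M" for y
    using a that x(2) S_sym S_trans unfolding uncovered_def by blast+
  have xE: "\<not> E x y" "\<not> E y x" if "y \<in> set M" for y using free that E_sym by blast+
  have "partial (x # M)"
    unfolding partial_def
  proof (intro conjI ballI impI)
    show "set (x # M) \<subseteq> V" using P(1) x(1) by simp
    show "distinct (x # M)" using P(2) xS S_refl x(1) by auto
    fix u v assume uv: "u \<in> set (x # M)" "v \<in> set (x # M)"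
    show "\<not> E u v" using uv xE P(3) E_irrefl by auto
    show "u = v" if "S u v" using uv xS P(4) that by auto
  qed
  moreover have "potential (x # M) [] < potential M Ls"
  proof -
    have "length (x # M) \<le> length cs" using \<open>partial (x # M)\<close> by (rule partial_length)
    then have "length cs - length M = Suc (length cs - length (x # M))" by simp
    then show ?thesis unfolding potential_def by simp
  qed
  ultimately show ?thesis by blast
qed

lemma filter_commute: "filter P (filter Q xs) = filter Q (filter P xs)"
  by (simp add: conj_commute)

text \<open>The vertices of \<open>q\<close> belong to one layer, so they are pairwise non-adjacent
  and in distinct classes; being idle, they are also non-adjacent to \<open>M\<close>. They can
  therefore all replace the vertices of \<open>M\<close> in their classes simultaneously.\<close>

lemma swap_step:
  assumes M: "partial M" and a: "uncovered M a" and lay: "layered a M (N0 # A @ N # B)"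
    and imm: "set imm \<subseteq> set N0" "distinct imm" "\<And>x y. x \<in> set imm \<Longrightarrow> y \<in> set M \<Longrightarrow> \<not> E x y"
    and q: "q = related S (leaves M N) imm" "q \<noteq> []" "length (leaves M N) \<le> k * (k * length q)"
  defines "M' \<equiv> q @ unrelated S q M"
  shows "partial M' \<and> layered a M' (N # B) \<and> unrelated S M' (map hd cs) = unrelated S M (map hd cs) \<and>
    potential M' (N # B) < potential M (N0 # A @ N # B)"
proof -
  note P = partialD[OF M]
  have suff: "layered a M (N # B)" "stuck M (N # B)"
    using layered_suffix[of a M "N0 # A" "N # B"] lay by auto
  have ok0: "layer_ok a M N0 (concat (A @ N # B))" using lay by simp
  have ok: "layer_ok a M N (concat B)" using suff by simp
  note I = layer_okD[OF ok]
  have qi: "set q \<subseteq> set imm" and qS: "\<And>x. x \<in> set q \<Longrightarrow> \<exists>z\<in>set (leaves M N). S x z"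
    unfolding q(1) by (auto simp: set_related)
  have dq: "distinct q" unfolding q(1) using imm(2) by (rule distinct_related)
  have qV: "set q \<subseteq> V" using qi imm(1) layer_okD(2)[OF ok0] by blast
  have qE: "\<not> E x z" if "x \<in> set q" "z \<in> set q \<union> set M \<union> set (concat (N # B))" for x z
    using layer_okD(5)[OF ok0, of x z] imm(3)[of x z] qi imm(1) that by auto
  have q_inj: "x = x'" if "x \<in> set q" "x' \<in> set q" "S x x'" for x x'
    using layer_okD(9)[OF ok0] qi imm(1) that by blast
  have M': "set M' \<subseteq> set q \<union> set M" by (auto simp: M'_def set_unrelated)
  have rest: "\<not> S y x" if "y \<in> set M'" "y \<notin> set q" "x \<in> set q" for x y
    using that by (auto simp: M'_def set_unrelated)
  have pM': "partial M'"
    unfolding partial_def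
  proof (intro conjI ballI impI)
    show "set M' \<subseteq> V" using M' qV P(1) by blast
    have "set q \<inter> set (unrelated S q M) = {}"
      using S_refl qV by (auto simp: set_unrelated)
    then show "distinct M'" using dq P(2) by (simp add: M'_def distinct_unrelated)
    fix u v assume uv: "u \<in> set M'" "v \<in> set M'"
    have uv': "u \<in> set q \<union> set M" "v \<in> set q \<union> set M" using uv M' by blast+
    show "\<not> E u v"
    proof (cases "u \<in> set q \<or> v \<in> set q")
      case True
      then show ?thesis using qE uv' E_sym by blast
    next
      case False
      then show ?thesis using P(3) uv' by blast
    qed
    show "u = v" if uvS: "S u v"
    proof -
      consider "u \<in> set q" "v \<in> set q" | "u \<in> set q" "v \<notin> set q" | "u \<notin> set q" "v \<in> set q"
        | "u \<notin> set q" "v \<notin> set q" by blast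
      then show ?thesis
      proof cases
        case 1 then show ?thesis using q_inj uvS by blast
      next
        case 2 then show ?thesis using rest[OF uv(2)] uvS S_sym by blast
      next
        case 3 then show ?thesis using rest[OF uv(1)] uvS by blast
      next
        case 4 then show ?thesis using P(4) uv' uvS by blast
      qed
    qed
  qed
  have leaves_M': "leaves M' Z = unrelated S q (leaves M Z)" if Z: "set Z \<subseteq> set (concat (N # B))" for Z
  proof -
    have "\<forall>x\<in>set q. \<not> (\<exists>z\<in>set Z. E x z)" using qE Z by blast
    then have "related E Z q = []" by (simp add: related_def filter_empty_conv)
    then show ?thesis
      unfolding M'_def related_append unfolding related_def unrelated_def
      by (simp add: filter_commute conj_commute)
  qed
  \<comment> \<open>A vertex removed from \<open>M\<close> shares its class with a leaf of
    \<open>N\<close> and hence equals it; leaves of \<open>N\<close> are not leaves of lower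
    layers.\<close>
  have same: "leaves M' Z = leaves M Z" if Z: "set Z \<subseteq> set (concat B)" for Z
  proof -
    have "\<not> S y x" if y: "y \<in> set (leaves M Z)" and x: "x \<in> set q" for x y
    proof
      assume "S y x"
      obtain z where z: "z \<in> set (leaves M N)" "S x z" using qS[OF x] by blast
      have "S y z" using \<open>S y x\<close> z(2) S_trans by blast
      then have "y = z" using P(4) y z(1) by (auto simp: set_related)
      then have "y \<notin> set (leaves M (concat B))" using I(6) z(1) by blast
      then show False using y Z by (auto simp: set_related)
    qed
    then have "unrelated S q (leaves M Z) = leaves M Z"
      unfolding unrelated_def filter_id_conv by blast
    moreover have "set Z \<subseteq> set (concat (N # B))" using Z by auto
    ultimately show ?thesis using leaves_M' by metis
  qed
  have N_sub: "leaves M' N = unrelated S q (leaves M N)" by (rule leaves_M') simp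
  have "layered a M' B" by (rule layered_cong[of a M]) (use suff same in auto)
  moreover have "stuck M' B" by (rule stuck_cong[of M]) (use suff same in auto)
  moreover have "layer_ok a M' N (concat B)"
    by (rule layer_ok_mono[OF ok]) (use same N_sub in \<open>auto simp: set_unrelated\<close>)
  ultimately have lay': "layered a M' (N # B)" by simp
  have heads: "unrelated S M' (map hd cs) = unrelated S M (map hd cs)"
  proof -
    have "(\<exists>y\<in>set M'. S h y) \<longleftrightarrow> (\<exists>y\<in>set M. S h y)" for h
    proof
      assume "\<exists>y\<in>set M'. S h y"
      then obtain y where y: "y \<in> set M'" "S h y" by blast
      show "\<exists>y\<in>set M. S h y"
      proof (cases "y \<in> set q")
        case True
        then obtain z where "z \<in> set M" "S y z" using qS by (auto simp: set_related)
        then show ?thesis using y(2) S_trans by blast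
      next
        case False
        then show ?thesis using y M' by blast
      qed
    next
      assume "\<exists>y\<in>set M. S h y"
      then obtain y where y: "y \<in> set M" "S h y" by blast
      show "\<exists>y\<in>set M'. S h y"
      proof (cases "\<exists>x\<in>set q. S y x")
        case True
        then obtain x where "x \<in> set q" "S y x" by blast
        then have "x \<in> set M'" "S h x" using y(2) S_trans by (auto simp: M'_def)
        then show ?thesis by blast
      next
        case False
        then have "y \<in> set M'" using y by (auto simp: M'_def set_unrelated)
        then show ?thesis using y by blast
      qed
    qed
    then show ?thesis unfolding unrelated_def by (intro filter_cong) auto
  qed
  \<comment> \<open>Each vertex of \<open>q\<close> expels a leaf of \<open>N\<close>, and different
    vertices of \<open>q\<close> expel different leaves because they lie in different
    classes.\<close>
  have removed: "length q \<le> length (related S q (leaves M N))"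
  proof (rule length_le_by_relation[where R = S])
    show "distinct q" by (rule dq)
    show "\<exists>z\<in>set (related S q (leaves M N)). S x z" if "x \<in> set q" for x
      using qS[OF that] that S_sym by (auto simp: set_related)
    show "x = x'" if "x \<in> set q" "x' \<in> set q" "z \<in> set (related S q (leaves M N))" "S x z" "S x' z" for x x' z
      using q_inj that S_sym S_trans by blast
  qed
  have "length (related S q M) \<le> length q"
  proof (rule length_le_by_relation[where R = S])
    show "distinct (related S q M)" using P(2) by (rule distinct_related)
    show "\<exists>z\<in>set q. S x z" if "x \<in> set (related S q M)" for x
      using that by (auto simp: set_related)
    show "x = x'" if "x \<in> set (related S q M)" "x' \<in> set (related S q M)" "z \<in> set q" "S x z" "S x' z" for x x' z
    proof -
      have "S x x'" using that(4,5) S_sym S_trans by blast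
      moreover have "x \<in> set M" "x' \<in> set M" using that(1,2) by (simp_all add: set_related)
      ultimately show ?thesis using P(4) by blast
    qed
  qed
  then have lenM: "length M \<le> length M'"
    using length_related_unrelated[of S q M] by (simp add: M'_def)
  let ?h = "hits_left M N (concat B)"
  let ?thr = "max 1 (real (length (leaves M (concat B))) * ((real k - 1) / (real k)\<^sup>2))"
  let ?y = "real (length (leaves M N))"
  have thr: "?thr \<le> ?y"
  proof -
    note st = stuck_layer[OF ok suff(2)]
    have "real ((k - 1) * length (leaves M (concat B))) \<le> real (k * (k * length (leaves M N)))"
      using st(2) of_nat_le_iff by blast
    then have "(real k - 1) * real (length (leaves M (concat B))) \<le> (real k)\<^sup>2 * ?y"
      using k_ge by (simp add: power2_eq_square of_nat_diff)
    then have "real (length (leaves M (concat B))) * ((real k - 1) / (real k)\<^sup>2) \<le> ?y"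
      using k_ge by (simp add: field_simps)
    then show ?thesis using st(1) by simp
  qed
  \<comment> \<open>Before the batch \<open>N\<close> lies below the top layer and is stuck, so its
    leaves still reach the threshold and its digit can be lowered.\<close>
  have "?h \<noteq> 0"
  proof
    assume "?h = 0"
    then have "?y < ?thr" using hits_left_spec[where M = M and N = N and X = "concat B"] by simp
    then show False using thr by linarith
  qed
  then obtain w where w: "?h = Suc w" by (cases ?h) auto
  have y': "real (length (leaves M' N)) \<le> ?y * shrink k"
  proof -
    have "real (length (leaves M N)) \<le> real (k * (k * length q))" using q(3) by (rule of_nat_mono)
    then have "?y / (real k)\<^sup>2 \<le> real (length q)"
      using k_ge by (simp add: field_simps power2_eq_square)
    moreover have "length (leaves M' N) + length q \<le> length (leaves M N)"
      using removed length_related_unrelated[of S q "leaves M N"] unfolding N_sub by linarith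
    then have "real (length (leaves M' N)) + real (length q) \<le> ?y" by linarith
    ultimately show ?thesis by (simp add: shrink_def algebra_simps)
  qed
  have "hits_left M' N (concat B) \<le> w"
  proof (rule hits_left_le)
    have s: "0 \<le> shrink k ^ w" using shrink_bounds(1)[OF k_ge] by simp
    have "real (length (leaves M' N)) * shrink k ^ w \<le> ?y * shrink k * shrink k ^ w"
      using y' s by (rule mult_right_mono)
    also have "\<dots> = ?y * shrink k ^ ?h" unfolding w by simp
    also have "\<dots> < ?thr" by (rule hits_left_spec)
    finally show "real (length (leaves M' N)) * shrink k ^ w <
      max 1 (real (length (leaves M' (concat B))) * ((real k - 1) / (real k)\<^sup>2))"
      using same[of "concat B"] by simp
  qed
  then have "hits_left M' N (concat B) * base ^ (L - Suc (length B)) + base ^ (L - Suc (length B))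
    \<le> ?h * base ^ (L - Suc (length B))"
    unfolding w using mult_le_mono1[of "hits_left M' N (concat B)" w "base ^ (L - Suc (length B))"] by simp
  moreover have "layer_potential M' B = layer_potential M B"
    by (rule layer_potential_cong) (rule same)
  \<comment> \<open>The digit of \<open>N\<close> drops by at least one, and the weight released is
    exactly the new last summand of the potential. Strictness then comes from the old last
    summand.\<close>
  ultimately have "layer_potential M' (N # B) + base ^ (L - length (N # B)) \<le> layer_potential M (N # B)"
    by simp
  also have "\<dots> \<le> layer_potential M (N0 # A @ N # B)"
    using layer_potential_suffix[of M "N # B" "N0 # A"] by simp
  finally have lp: "layer_potential M' (N # B) + base ^ (L - length (N # B)) \<le> layer_potential M (N0 # A @ N # B)" .
  have "(length cs - length M') * base ^ L \<le> (length cs - length M) * base ^ L"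
    using lenM by (intro mult_le_mono1) simp
  moreover have "0 < base ^ (L - length (N0 # A @ N # B))" by simp
  ultimately have "potential M' (N # B) < potential M (N0 # A @ N # B)"
    using lp unfolding potential_def by linarith
  then show ?thesis using pM' lay' heads by blast
qed

lemma state_okI: "partial M \<Longrightarrow> unrelated S M (map hd cs) = a # as \<Longrightarrow> layered a M Ls \<Longrightarrow> state_ok M Ls"
  by (simp add: state_ok_def)

text \<open>Every centre of the top layer lies in the class of \<open>a\<close> or of a lower leaf.
  If no idle one lay in the class of \<open>a\<close>, all of \<open>imm\<close> would be counted in
  \<open>no_swap_count\<close>, against the assumption that \<open>imm\<close> is large.\<close>

lemma hit_correct:
  assumes M: "partial M" and as: "unrelated S M (map hd cs) = a # as"
    and lay: "layered a M (N # R)" and imm: "imm = unrelated E M N" "imm \<noteq> []"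
    and many: "length (leaves M (concat R)) \<le> k * (k * length imm)"
  shows "\<exists>M' Ls'. hit a M imm R = Continue M' Ls' \<and> state_ok M' Ls' \<and> potential M' Ls' < potential M (N # R)"
proof -
  have a: "uncovered M a" using as by (rule root_uncovered)
  have ok: "layer_ok a M N (concat R)" and layR: "layered a M R" using lay by simp_all
  have i: "set imm \<subseteq> set N" "distinct imm" "\<And>x y. x \<in> set imm \<Longrightarrow> y \<in> set M \<Longrightarrow> \<not> E x y"
    using layer_okD(3)[OF ok] unfolding imm(1) by (auto simp: set_unrelated distinct_unrelated)
  show ?thesis
  proof (cases rule: hit_cases[where R = R and M = M and imm = imm and a = a])
    case (swap A N' B q)
    have *: "partial (q @ unrelated S q M) \<and> layered a (q @ unrelated S q M) (N' # B) \<and>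
        unrelated S (q @ unrelated S q M) (map hd cs) = unrelated S M (map hd cs) \<and>
        potential (q @ unrelated S q M) (N' # B) < potential M (N # A @ N' # B)"
      by (rule swap_step[OF M a _ i swap(2,3,4)]) (use lay swap(1) in simp_all)
    then have "state_ok (q @ unrelated S q M) (N' # B)" using as by (intro state_okI[of _ a as]) auto
    then show ?thesis using * swap(1,5) by auto
  next
    case augment
    have "related S [a] imm \<noteq> []"
    proof
      assume none: "related S [a] imm = []"
      have "related S (leaves M (concat R)) imm = imm"
        unfolding related_def filter_id_conv
      proof
        fix x assume x: "x \<in> set imm"
        have "\<not> S x a" using none x by (auto simp: related_def filter_empty_conv)
        then have "\<exists>z\<in>set (leaves M (concat R)). S x z" using layer_okD(8)[OF ok, of x] i(1) x by auto
        then show "\<exists>z\<in>set (filter (\<lambda>y. \<exists>x\<in>set (concat R). E y x) M). S x z" by (simp add: related_def)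
      qed
      then show False using no_swap_count[OF layR augment(1)] imm(2) many by simp
    qed
    then have "head (related S [a] imm) \<in> set (related S [a] imm)" by (simp add: head_eq_hd)
    then have x: "head (related S [a] imm) \<in> set imm" "S (head (related S [a] imm)) a"
      by (auto simp: set_related)
    have "head (related S [a] imm) \<in> V" using x(1) i(1) layer_okD(2)[OF ok] by blast
    from augment_step[OF M a this x(2) i(3)[OF x(1)]] augment(2) state_ok_Nil show ?thesis by blast
  qed
qed

lemma tick_correct:
  assumes ok: "state_ok M Ls"
  shows "case tick M Ls of
      IT vs \<Rightarrow> independent_transversal G (set Vs) (set vs)
    | BD is ds \<Rightarrow> small_dominator is ds
    | Continue M' Ls' \<Rightarrow> state_ok M' Ls' \<and> potential M' Ls' < potential M Ls"
proof (cases "unrelated S M (map hd cs)")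
  case Nil
  have M: "partial M" using ok by (simp add: state_ok_def)
  show ?thesis using covered_transversal[OF M Nil] Nil by (simp add: tick_def)
next
  case (Cons a as)
  have M: "partial M" and lay: "layered a M Ls" using ok Cons by (simp_all add: state_ok_def)
  have a: "uncovered M a" using Cons by (rule root_uncovered)
  show ?thesis
  proof (cases "stuck M Ls")
    case True
    then have tick: "tick M Ls = grow a M Ls"
      using Cons by (auto simp: tick_def stuck_def Let_def split: list.split)
    show ?thesis
    proof (cases "grow a M Ls")
      case (IT vs)
      then show ?thesis by (simp add: grow_def Let_def split: if_splits)
    next
      case (BD js ds)
      from grow_BD[OF M a lay True BD] show ?thesis unfolding tick BD outcome.case .
    next
      case (Continue M' Ls')
      have *: "M' = M \<and> layered a M Ls' \<and> potential M Ls' < potential M Ls"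
        by (rule grow_Continue[OF M a lay True Continue])
      then have "state_ok M Ls'" using M Cons by (intro state_okI) auto
      then show ?thesis unfolding tick Continue outcome.case using * by blast
    qed
  next
    case False
    then obtain N R where Ls: "Ls = N # R" by (auto simp: stuck_def split: list.splits)
    have imm: "unrelated E M N \<noteq> []" "length (leaves M (concat R)) \<le> k * (k * length (unrelated E M N))"
      using False unfolding Ls stuck_def by auto
    have tick: "tick M Ls = hit a M (unrelated E M N) R"
      using Cons imm by (simp add: tick_def Ls)
    obtain M' Ls' where "tick M Ls = Continue M' Ls'" "state_ok M' Ls'" "potential M' Ls' < potential M Ls"
      using hit_correct[OF M Cons lay[unfolded Ls] refl imm] tick unfolding Ls by auto
    then show ?thesis by simp
  qed
qed

end

section \<open>The program\<close>

text \<open>An upper bound in place of the exact cost: bounds compose along the evaluation rules and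
  can be made independent of the branch that is taken.\<close>

definition evb :: "program \<Rightarrow> data list \<Rightarrow> expr \<Rightarrow> data \<Rightarrow> nat \<Rightarrow> bool" where
  "evb P env e x b \<longleftrightarrow> (\<exists>t\<le>b. eval P env e x t)"

definition evbs :: "program \<Rightarrow> data list \<Rightarrow> expr list \<Rightarrow> data list \<Rightarrow> nat \<Rightarrow> bool" where
  "evbs P env es xs b \<longleftrightarrow> (\<exists>t\<le>b. evals P env es xs t)"

lemma evb_weaken: "evb P env e x s \<Longrightarrow> x = y \<Longrightarrow> s \<le> t \<Longrightarrow> evb P env e y t"
  unfolding evb_def using le_trans by blast

lemma evb_Var: "i < length env \<Longrightarrow> x = env ! i \<Longrightarrow> evb P env (Var i) x 1"
  unfolding evb_def using eval_Var by blast

lemma evb_MkLeaf: "evb P env MkLeaf Leaf 1"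
  unfolding evb_def using eval_MkLeaf by blast

lemma evb_MkBranch:
  assumes "evb P env a x s" "evb P env b y t" "z = Branch x y"
  shows "evb P env (MkBranch a b) z (s + t + 1)"
proof -
  obtain s' t' where "s' \<le> s" "eval P env a x s'" "t' \<le> t" "eval P env b y t'"
    using assms(1,2) unfolding evb_def by blast
  then show ?thesis unfolding evb_def assms(3)
    by (intro exI[of _ "s' + t' + 1"] conjI eval_MkBranch) auto
qed

lemma evb_Left: "evb P env a x t \<Longrightarrow> z = left x \<Longrightarrow> evb P env (Left a) z (t + 1)"
  unfolding evb_def using eval_Left by (metis add_le_mono1)

lemma evb_Right: "evb P env a x t \<Longrightarrow> z = right x \<Longrightarrow> evb P env (Right a) z (t + 1)"
  unfolding evb_def using eval_Right by (metis add_le_mono1)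

lemma evb_If:
  assumes "evb P env c x s" "evb P env (if x \<noteq> Leaf then a else b) y t"
  shows "evb P env (IfBranch c a b) y (s + t + 1)"
proof -
  obtain s' t' where *: "s' \<le> s" "eval P env c x s'" "t' \<le> t" "eval P env (if x \<noteq> Leaf then a else b) y t'"
    using assms unfolding evb_def by blast
  then have "eval P env (IfBranch c a b) y (s' + t' + 1)"
  proof (cases "x = Leaf")
    case True
    then show ?thesis using eval_If_Leaf[OF *(2) True] *(4) by simp
  next
    case False
    then show ?thesis using eval_If_Branch[OF *(2) False] *(4) by simp
  qed
  then show ?thesis unfolding evb_def using * by (intro exI[of _ "s' + t' + 1"] conjI) auto
qed

lemma evb_Let:
  assumes "evb P env a x s" "evb P (x # env) b y t"
  shows "evb P env (LetIn a b) y (s + t + 1)"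
proof -
  obtain s' t' where "s' \<le> s" "eval P env a x s'" "t' \<le> t" "eval P (x # env) b y t'"
    using assms unfolding evb_def by blast
  then show ?thesis unfolding evb_def
    by (intro exI[of _ "s' + t' + 1"] conjI eval_Let) auto
qed

lemma evb_Call:
  assumes "evbs P env as xs s" "f < length P" "evb P xs (P ! f) y t"
  shows "evb P env (Call f as) y (s + t + 1)"
proof -
  obtain s' t' where "s' \<le> s" "evals P env as xs s'" "t' \<le> t" "eval P xs (P ! f) y t'"
    using assms(1,3) unfolding evb_def evbs_def by blast
  then show ?thesis unfolding evb_def
    by (intro exI[of _ "s' + t' + 1"] conjI eval_Call) (auto simp: assms(2))
qed

lemma evbs_Nil: "evbs P env [] [] 0"
  unfolding evbs_def using evals_Nil by blast

lemma evbs_Cons: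
  assumes "evb P env a x s" "evbs P env as xs t"
  shows "evbs P env (a # as) (x # xs) (s + t)"
proof -
  obtain s' t' where "s' \<le> s" "eval P env a x s'" "t' \<le> t" "evals P env as xs t'"
    using assms unfolding evb_def evbs_def by blast
  then show ?thesis unfolding evbs_def
    by (intro exI[of _ "s' + t'"] conjI) (auto intro: evals_Cons)
qed

lemmas evb_rules = evb_Var evb_MkLeaf evb_MkBranch evb_Left evb_Right evb_If evb_Let evb_Call
  evbs_Nil evbs_Cons

section \<open>Encodings and function bodies\<close>

definition enc_lists :: "nat list list \<Rightarrow> data" where
  "enc_lists Ls = enc_list (map enc_nats Ls)"

lemma enc_nat_simps:
  "enc_nat 0 = Leaf" "enc_nat (Suc i) = Branch Leaf (enc_nat i)"
  by (simp_all add: enc_nat_def)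

lemma enc_nats_simps:
  "enc_nats [] = Leaf" "enc_nats (x # xs) = Branch (enc_nat x) (enc_nats xs)"
  by (simp_all add: enc_nats_def)

lemma enc_lists_simps:
  "enc_lists [] = Leaf" "enc_lists (N # Ls) = Branch (enc_nats N) (enc_lists Ls)"
  by (simp_all add: enc_lists_def)

lemma enc_fold:
  "Branch (enc_nat x) (enc_nats xs) = enc_nats (x # xs)"
  "Branch (enc_nat x) Leaf = enc_nats [x]"
  "Branch Leaf (enc_nat i) = enc_nat (Suc i)"
  "Branch (enc_nats N) (enc_lists Ls) = enc_lists (N # Ls)"
  "left (enc_nats xs) = enc_nat (head xs)" "right (enc_nats xs) = enc_nats (tl xs)"
  "right (enc_nat i) = enc_nat (i - 1)"
  "left (enc_lists (N # Ls)) = enc_nats N" "right (enc_lists Ls) = enc_lists (tl Ls)"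
  "enc_nat i = Leaf \<longleftrightarrow> i = 0" "enc_nats xs = Leaf \<longleftrightarrow> xs = []" "enc_lists Ls = Leaf \<longleftrightarrow> Ls = []"
  "enc_bool b = Leaf \<longleftrightarrow> \<not> b"
  by (simp_all add: enc_nat_simps enc_nats_simps enc_lists_simps enc_bool_def head_def split: list.split)
     (cases i; simp add: enc_nat_simps; fail | cases xs; simp add: enc_nats_simps; fail | cases Ls; simp add: enc_lists_simps; fail)+

abbreviation "TT \<equiv> MkBranch MkLeaf MkLeaf"

text \<open>The number \<open>k\<close> is written into the program text; \<open>r\<close> and
  \<open>\<epsilon>\<close> enter the program only through it.\<close>

fun nat_expr :: "nat \<Rightarrow> expr" where
  "nat_expr 0 = MkLeaf"
| "nat_expr (Suc k) = MkBranch MkLeaf (nat_expr k)"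

text \<open>
  \<open>Call f\<close> refers to position \<open>f\<close> of the list \<open>prog\<close> below. A relation on vertices is passed as a tagged
  value: \<open>Branch Leaf\<close> of the adjacency matrix, or \<open>Branch (Branch Leaf Leaf)\<close> of the list of classes
  for lying in a common class. Every \<open>LetIn\<close> shifts the indices of the parameters by one.
\<close>

definition body_nth :: expr where
  "body_nth = IfBranch (Var 1) (Call 1 [Right (Var 0), Right (Var 1)]) (Left (Var 0))"

definition body_eq :: expr where
  "body_eq = IfBranch (Var 0)
     (IfBranch (Var 1) (Call 2 [Right (Var 0), Right (Var 1)]) MkLeaf)
     (IfBranch (Var 1) MkLeaf TT)"

definition body_mem :: expr where
  "body_mem = IfBranch (Var 1)
     (IfBranch (Call 2 [Var 0, Left (Var 1)]) TT (Call 3 [Var 0, Right (Var 1)]))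
     MkLeaf"

definition body_same_class :: expr where
  "body_same_class = IfBranch (Var 0)
     (IfBranch (Call 3 [Var 1, Left (Var 0)])
        (IfBranch (Call 3 [Var 2, Left (Var 0)]) TT (Call 4 [Right (Var 0), Var 1, Var 2]))
        (Call 4 [Right (Var 0), Var 1, Var 2]))
     MkLeaf"

definition body_rel :: expr where
  "body_rel = IfBranch (Left (Var 0)) (Call 4 [Right (Var 0), Var 1, Var 2])
     (Call 1 [Call 1 [Right (Var 0), Var 1], Var 2])"

definition body_any :: expr where
  "body_any = IfBranch (Var 2)
     (IfBranch (Call 5 [Var 0, Var 1, Left (Var 2)]) TT (Call 6 [Var 0, Var 1, Right (Var 2)]))
     MkLeaf"

definition body_related :: expr where
  "body_related = IfBranch (Var 2)
     (IfBranch (Call 6 [Var 0, Left (Var 2), Var 1])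
        (MkBranch (Left (Var 2)) (Call 7 [Var 0, Var 1, Right (Var 2)]))
        (Call 7 [Var 0, Var 1, Right (Var 2)]))
     MkLeaf"

definition body_unrelated :: expr where
  "body_unrelated = IfBranch (Var 2)
     (IfBranch (Call 6 [Var 0, Left (Var 2), Var 1])
        (Call 8 [Var 0, Var 1, Right (Var 2)])
        (MkBranch (Left (Var 2)) (Call 8 [Var 0, Var 1, Right (Var 2)])))
     MkLeaf"

definition body_append :: expr where
  "body_append = IfBranch (Var 0) (MkBranch (Left (Var 0)) (Call 9 [Right (Var 0), Var 1])) (Var 1)"

definition body_concat :: expr where
  "body_concat = IfBranch (Var 0) (Call 9 [Left (Var 0), Call 10 [Right (Var 0)]]) MkLeaf"

text \<open>Multiplication acts on lengths: copies of a list are concatenated, so thresholds such as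
  \<open>k * (k * length q)\<close> are tested by walking down two lists in parallel.\<close>

definition body_times :: expr where
  "body_times = IfBranch (Var 0) (Call 9 [Var 1, Call 11 [Right (Var 0), Var 1]]) MkLeaf"

definition body_shorter :: expr where
  "body_shorter = IfBranch (Var 1)
     (IfBranch (Var 0) (Call 12 [Right (Var 0), Right (Var 1)]) TT)
     MkLeaf"

definition body_heads :: expr where
  "body_heads = IfBranch (Var 0) (MkBranch (Left (Left (Var 0))) (Call 13 [Right (Var 0)])) MkLeaf"

definition body_build :: expr where
  "body_build = IfBranch (Var 6)
     (Call 14 [Var 0, Var 1, Var 2, Var 3, Var 4,
        IfBranch (Call 6 [Var 1, Left (Left (Var 6)), Var 4])
          (LetIn (Call 8 [Var 0,
                Call 9 [Var 5, Call 9 [Var 3, Call 7 [Var 0, Call 9 [Var 5, Var 3], Var 2]]],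
                Left (Var 6)])
             (IfBranch (Var 0) (MkBranch (Left (Var 0)) (Var 6)) (Var 6)))
          (Var 5),
        Right (Var 6)])
     (Var 5)"

definition body_class_indices :: expr where
  "body_class_indices =
     (let rec = Call 15 [Var 0, Var 1, Var 2, MkBranch MkLeaf (Var 3), Right (Var 4)] in
      IfBranch (Var 4)
        (IfBranch (Call 6 [Var 0, Left (Left (Var 4)), Var 1])
           (IfBranch (Call 6 [Var 0, Left (Left (Var 4)), Var 2]) rec (MkBranch (Var 3) rec))
           rec)
        MkLeaf)"

definition body_hit :: "nat \<Rightarrow> expr" where
  "body_hit k =
     (let rec = Call 16 [Var 2, Var 3, Var 4, Var 5, Var 6, Right (Var 7)] in
      IfBranch (Var 5)
        (LetIn (Call 7 [Var 0, Left (Var 5), Var 2])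
        (LetIn (Call 7 [Var 2, Var 0, Var 4])
          (IfBranch (Var 0)
             (IfBranch (Call 12 [Call 11 [nat_expr k, Call 11 [nat_expr k, Var 0]], Var 1]) rec
                (MkBranch MkLeaf (MkBranch (Call 9 [Var 0, Call 8 [Var 3, Var 0, Var 4]]) (Var 7))))
             rec)))
        (MkBranch MkLeaf
           (MkBranch (MkBranch (Left (Call 7 [Var 1, MkBranch (Var 4) MkLeaf, Var 3])) (Var 2)) MkLeaf)))"

definition body_grow :: "nat \<Rightarrow> expr" where
  "body_grow k =
     LetIn (Call 10 [Var 5])
     (LetIn (Call 7 [Var 1, Var 0, Var 5])
     (LetIn (MkBranch (Var 5) (Var 0))
     (LetIn (Call 14 [Var 3, Var 4, Var 7, Var 2, Var 0, MkLeaf, Var 5])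
       (IfBranch (Call 12 [Call 11 [nat_expr k, Var 0], Var 2])
          (MkBranch TT (MkBranch TT (MkBranch
             (Call 15 [Var 5, Var 1, Var 0, MkLeaf, Var 6])
             (Call 9 [Var 0, Call 9 [Var 3, Call 7 [Var 4, Call 9 [Var 0, Var 3], Var 8]]]))))
          (MkBranch MkLeaf (MkBranch (Var 8) (MkBranch (Var 0) (Var 9))))))))"

definition body_tick :: "nat \<Rightarrow> expr" where
  "body_tick k =
     (let grow = Call 17 [Var 2, Var 3, Var 4, Left (Var 1), Var 5, Var 6] in
      LetIn (Call 8 [Var 1, Var 3, Call 13 [Var 2]])
        (IfBranch (Var 0)
           (IfBranch (Var 5)
              (LetIn (Call 8 [Var 1, Var 4, Left (Var 5)])
                 (IfBranch (Var 0)
                    (IfBranch (Call 12 [Call 11 [nat_expr k, Call 11 [nat_expr k, Var 0]],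
                                        Call 7 [Var 2, Call 10 [Right (Var 6)], Var 5]])
                       grow
                       (Call 16 [Var 2, Var 3, Var 5, Var 0, Left (Var 1), Right (Var 6)]))
                    grow))
              (Call 17 [Var 1, Var 2, Var 3, Left (Var 0), Var 4, Var 5]))
           (MkBranch TT (MkBranch MkLeaf (Var 4)))))"

definition body_loop :: expr where
  "body_loop = LetIn (Call 18 [Var 0, Var 1, Var 2, Var 3, Var 4])
     (IfBranch (Left (Var 0)) (Right (Var 0))
        (Call 19 [Var 1, Var 2, Var 3, Left (Right (Var 0)), Right (Right (Var 0))]))"

definition body_main :: expr where
  "body_main = Call 19 [MkBranch MkLeaf (Left (Var 0)), MkBranch TT (Right (Var 0)),
     Right (Var 0), MkLeaf, MkLeaf]"

definition prog :: "nat \<Rightarrow> program" where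
  "prog k = [body_main, body_nth, body_eq, body_mem, body_same_class, body_rel, body_any,
     body_related, body_unrelated, body_append, body_concat, body_times, body_shorter, body_heads,
     body_build, body_class_indices, body_hit k, body_grow k, body_tick k, body_loop]"

lemma length_prog: "length (prog k) = 20"
  by (simp add: prog_def)

lemma prog_nth:
  "prog k ! 0 = body_main" "prog k ! 1 = body_nth" "prog k ! 2 = body_eq"
  "prog k ! 3 = body_mem" "prog k ! 4 = body_same_class" "prog k ! 5 = body_rel"
  "prog k ! 6 = body_any" "prog k ! 7 = body_related" "prog k ! 8 = body_unrelated"
  "prog k ! 9 = body_append" "prog k ! 10 = body_concat" "prog k ! 11 = body_times"
  "prog k ! 12 = body_shorter" "prog k ! 13 = body_heads" "prog k ! 14 = body_build"
  "prog k ! 15 = body_class_indices" "prog k ! 16 = body_hit k" "prog k ! 17 = body_grow k"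
  "prog k ! 18 = body_tick k" "prog k ! 19 = body_loop"
  by (simp_all add: prog_def)

lemmas run_simps = length_prog enc_fold
text \<open>Otherwise \<open>prog k ! 1\<close> is rewritten to \<open>prog k ! Suc 0\<close> and no longer matches \<open>prog_nth\<close>.\<close>
declare One_nat_def [simp del]

section \<open>Evaluation of the basic functions\<close>

lemma evb_nth:
  "i < length xs \<Longrightarrow> evb (prog k) [enc_list xs, enc_nat i] (prog k ! 1) (xs ! i) (10 * (i + 1))"
proof (induction xs arbitrary: i)
  case Nil
  then show ?case by simp
next
  case (Cons x xs)
  show ?case
  proof (cases i)
    case 0
    show ?thesis
      unfolding prog_nth body_nth_def 0
      by (rule evb_weaken, (rule evb_rules | simp add: run_simps)+)
  next
    case (Suc j)
    have IH: "evb (prog k) [enc_list xs, enc_nat j] (prog k ! 1) (xs ! j) (10 * (j + 1))"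
      using Cons Suc by simp
    show ?thesis
      unfolding prog_nth body_nth_def Suc
      by (rule evb_weaken, (rule IH evb_rules | simp add: run_simps)+)
  qed
qed

lemma enc_bool_simps: "enc_bool True = Branch Leaf Leaf" "enc_bool False = Leaf"
  by (simp_all add: enc_bool_def)

lemma evb_eq: "evb (prog k) [enc_nat i, enc_nat j] (prog k ! 2) (enc_bool (i = j)) (20 * (i + 1))"
proof (induction i arbitrary: j)
  case 0
  show ?case
  proof (cases j)
    case 0
    show ?thesis
      unfolding prog_nth body_eq_def 0
      by (rule evb_weaken, (rule evb_rules | simp add: run_simps enc_bool_simps)+)
  next
    case (Suc j')
    show ?thesis
      unfolding prog_nth body_eq_def Suc
      by (rule evb_weaken, (rule evb_rules | simp add: run_simps enc_bool_simps)+)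
  qed
next
  case (Suc i)
  show ?case
  proof (cases j)
    case 0
    show ?thesis
      unfolding prog_nth body_eq_def 0
      by (rule evb_weaken, (rule evb_rules | simp add: run_simps enc_bool_simps)+)
  next
    case (Suc j')
    show ?thesis
      unfolding prog_nth body_eq_def Suc
      by (rule evb_weaken, (rule Suc.IH evb_rules | simp add: run_simps)+)
  qed
qed

lemma evb_mem:
  assumes "u < n"
  shows "evb (prog k) [enc_nat u, enc_nats c] (prog k ! 3) (enc_bool (u \<in> set c))
    ((length c + 1) * (20 * n + 20))"
proof (induction c)
  case Nil
  show ?case
    unfolding prog_nth body_mem_def
    by (rule evb_weaken, (rule evb_rules | simp add: run_simps enc_bool_simps)+)
next
  case (Cons x c)
  have n: "20 * (u + 1) \<le> 20 * n" using assms by simp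
  show ?case
    unfolding prog_nth body_mem_def
    apply (cases "u = x")
    apply (rule evb_weaken, (rule evb_eq evb_rules | simp add: run_simps enc_bool_simps)+)
    using n apply (simp add: algebra_simps)
    apply (rule evb_weaken, (rule evb_eq Cons.IH evb_rules | simp add: run_simps)+)
    using n apply (simp add: algebra_simps)
    done
qed

lemma evb_mem_le:
  assumes "u < n" "length c \<le> n"
  shows "evb (prog k) [enc_nat u, enc_nats c] (prog k ! 3) (enc_bool (u \<in> set c))
    ((n + 1) * (20 * n + 20))"
  using evb_mem[OF assms(1)] by (rule evb_weaken) (use assms(2) in auto)

definition cost_same_class :: "nat \<Rightarrow> nat" where
  "cost_same_class n = 2 * ((n + 1) * (20 * n + 20)) + 40"

lemma evb_same_class:
  assumes "u < n" "v < n" "\<And>c. c \<in> set cs \<Longrightarrow> length c \<le> n"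
  shows "evb (prog k) [enc_lists cs, enc_nat u, enc_nat v] (prog k ! 4)
    (enc_bool (\<exists>c\<in>set cs. u \<in> set c \<and> v \<in> set c)) ((length cs + 1) * cost_same_class n)"
  using assms(3)
proof (induction cs)
  case Nil
  show ?case
    unfolding prog_nth body_same_class_def
    by (rule evb_weaken, (rule evb_rules | simp add: run_simps enc_bool_simps cost_same_class_def)+)
next
  case (Cons c cs)
  have c: "length c \<le> n" using Cons.prems by simp
  have IH: "evb (prog k) [enc_lists cs, enc_nat u, enc_nat v] (prog k ! 4)
    (enc_bool (\<exists>c\<in>set cs. u \<in> set c \<and> v \<in> set c)) ((length cs + 1) * cost_same_class n)"
    using Cons by simp
  note mem = evb_mem_le[OF assms(1) c] evb_mem_le[OF assms(2) c]
  consider "u \<in> set c" "v \<in> set c" | "u \<in> set c" "v \<notin> set c" | "u \<notin> set c" by blast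
  then show ?case
  proof cases
    case 1
    then show ?thesis
      unfolding prog_nth body_same_class_def
      apply (rule_tac evb_weaken)
      apply (rule mem evb_rules | simp add: run_simps enc_bool_simps)+
      apply (simp add: cost_same_class_def)
      done
  next
    case 2
    then show ?thesis
      unfolding prog_nth body_same_class_def
      apply (rule_tac evb_weaken)
      apply (rule mem IH evb_rules | simp add: run_simps)+
      apply (simp add: cost_same_class_def)
      done
  next
    case 3
    then show ?thesis
      unfolding prog_nth body_same_class_def
      apply (rule_tac evb_weaken)
      apply (rule mem IH evb_rules | simp add: run_simps)+
      apply (simp add: cost_same_class_def)
      done
  qed
qed

section \<open>Correctness and running time of the program\<close>

text \<open>A common interface for adjacency and for lying in the same class, so that the functions
  taking a relation are analysed once for both.\<close>

definition implements :: "nat \<Rightarrow> nat \<Rightarrow> nat \<Rightarrow> data \<Rightarrow> (nat \<Rightarrow> nat \<Rightarrow> bool) \<Rightarrow> bool" where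
  "implements k n c d R \<longleftrightarrow>
     (\<forall>u<n. \<forall>v<n. evb (prog k) [d, enc_nat u, enc_nat v] (prog k ! 5) (enc_bool (R u v)) c)"

definition cost_rel :: "nat \<Rightarrow> nat" where
  "cost_rel n = (n + 1) * cost_same_class n + 20 * n + 40"

lemma implements_matrix:
  "implements k n (cost_rel n)
    (Branch Leaf (enc_list (map (\<lambda>u. enc_list (map (\<lambda>v. enc_bool (R u v)) [0..<n])) [0..<n]))) R"
  unfolding implements_def
proof (intro allI impI)
  fix u v assume uv: "u < n" "v < n"
  let ?row = "\<lambda>u. map (\<lambda>v. enc_bool (R u v)) [0..<n]"
  have row: "evb (prog k) [enc_list (map (\<lambda>u. enc_list (?row u)) [0..<n]), enc_nat u] (prog k ! 1)
      (enc_list (?row u)) (10 * (u + 1))"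
    using evb_nth[of u "map (\<lambda>u. enc_list (?row u)) [0..<n]" k] uv by simp
  have entry: "evb (prog k) [enc_list (?row u), enc_nat v] (prog k ! 1) (enc_bool (R u v)) (10 * (v + 1))"
    using evb_nth[of v "?row u" k] uv by simp
  show "evb (prog k) [Branch Leaf (enc_list (map (\<lambda>u. enc_list (?row u)) [0..<n])), enc_nat u, enc_nat v]
     (prog k ! 5) (enc_bool (R u v)) (cost_rel n)"
    unfolding prog_nth body_rel_def
    apply (rule evb_weaken)
    apply (rule row entry evb_rules | simp add: length_prog)+
    apply (use uv in \<open>simp add: cost_rel_def\<close>)
    done
qed

lemma implements_same_class:
  assumes "length cs \<le> n" "\<And>c. c \<in> set cs \<Longrightarrow> length c \<le> n"
  shows "implements k n (cost_rel n) (Branch (Branch Leaf Leaf) (enc_lists cs))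
    (\<lambda>u v. \<exists>c\<in>set cs. u \<in> set c \<and> v \<in> set c)"
  unfolding implements_def
proof (intro allI impI)
  fix u v assume uv: "u < n" "v < n"
  have le: "(length cs + 1) * cost_same_class n \<le> (n + 1) * cost_same_class n"
    using assms(1) by (intro mult_le_mono1) simp
  show "evb (prog k) [Branch (Branch Leaf Leaf) (enc_lists cs), enc_nat u, enc_nat v]
     (prog k ! 5) (enc_bool (\<exists>c\<in>set cs. u \<in> set c \<and> v \<in> set c)) (cost_rel n)"
    unfolding prog_nth body_rel_def
    apply (rule evb_weaken)
    apply (rule evb_same_class[OF uv assms(2)] evb_rules | assumption | simp add: length_prog)+
    apply (use le in \<open>unfold cost_rel_def, linarith\<close>)
    done
qed

section \<open>List functions, some over a represented relation\<close>

lemma evb_any: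
  assumes R: "implements k n c d R" and v: "v < n" and xs: "set xs \<subseteq> {..<n}"
  shows "evb (prog k) [d, enc_nat v, enc_nats xs] (prog k ! 6) (enc_bool (\<exists>x\<in>set xs. R v x))
    ((length xs + 1) * (c + 20))"
  using xs
proof (induction xs)
  case Nil
  show ?case
    unfolding prog_nth body_any_def
    by (rule evb_weaken, (rule evb_rules | simp add: run_simps enc_bool_simps)+)
next
  case (Cons x xs)
  have IH: "evb (prog k) [d, enc_nat v, enc_nats xs] (prog k ! 6) (enc_bool (\<exists>x\<in>set xs. R v x))
    ((length xs + 1) * (c + 20))" using Cons by simp
  have rel: "evb (prog k) [d, enc_nat v, enc_nat x] (prog k ! 5) (enc_bool (R v x)) c"
    using R v Cons.prems by (simp add: implements_def)
  show ?case
  proof (cases "R v x")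
    case True
    show ?thesis
      unfolding prog_nth body_any_def
      by (rule evb_weaken, (rule rel evb_rules | simp add: run_simps enc_bool_simps True)+)
  next
    case False
    show ?thesis
      unfolding prog_nth body_any_def
      by (rule evb_weaken, (rule rel IH evb_rules | simp add: run_simps False)+)
  qed
qed

definition cost_any :: "nat \<Rightarrow> nat \<Rightarrow> nat" where
  "cost_any c b = (b + 1) * (c + 20)"

lemma evb_any_le:
  assumes "implements k n c d R" "v < n" "set xs \<subseteq> {..<n}" "length xs \<le> b"
  shows "evb (prog k) [d, enc_nat v, enc_nats xs] (prog k ! 6) (enc_bool (\<exists>x\<in>set xs. R v x))
    (cost_any c b)"
  by (rule evb_weaken[OF evb_any[OF assms(1-3)] refl])
    (unfold cost_any_def, rule mult_le_mono1, use assms(4) in simp)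

definition cost_filter :: "nat \<Rightarrow> nat \<Rightarrow> nat" where
  "cost_filter c b = (b + 1) * (cost_any c b + 30)"

lemma evb_related:
  assumes R: "implements k n c d R" and xs: "set xs \<subseteq> {..<n}" "length xs \<le> b"
    and ys: "set ys \<subseteq> {..<n}"
  shows "evb (prog k) [d, enc_nats xs, enc_nats ys] (prog k ! 7) (enc_nats (related R xs ys))
    ((length ys + 1) * (cost_any c b + 30))"
  using ys
proof (induction ys)
  case Nil
  show ?case
    unfolding prog_nth body_related_def
    by (rule evb_weaken, (rule evb_rules | simp add: run_simps related_def enc_nats_simps)+)
next
  case (Cons y ys)
  have IH: "evb (prog k) [d, enc_nats xs, enc_nats ys] (prog k ! 7) (enc_nats (related R xs ys))
    ((length ys + 1) * (cost_any c b + 30))" using Cons by simp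
  have any: "evb (prog k) [d, enc_nat y, enc_nats xs] (prog k ! 6) (enc_bool (\<exists>x\<in>set xs. R y x))
    (cost_any c b)"
    by (rule evb_any_le[OF R _ xs]) (use Cons.prems in simp)
  show ?case
  proof (cases "\<exists>x\<in>set xs. R y x")
    case True
    then have eq: "related R xs (y # ys) = y # related R xs ys" by (simp add: related_def)
    show ?thesis
      unfolding prog_nth body_related_def eq
      by (rule evb_weaken, (rule any IH evb_rules | simp add: run_simps True)+)
  next
    case False
    then have eq: "related R xs (y # ys) = related R xs ys" by (simp add: related_def)
    show ?thesis
      unfolding prog_nth body_related_def eq
      by (rule evb_weaken, (rule any IH evb_rules | simp add: run_simps False)+)
  qed
qed

lemma evb_related_le:
  assumes "implements k n c d R" "set xs \<subseteq> {..<n}" "length xs \<le> b" "set ys \<subseteq> {..<n}" "length ys \<le> b"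
  shows "evb (prog k) [d, enc_nats xs, enc_nats ys] (prog k ! 7) (enc_nats (related R xs ys)) (cost_filter c b)"
  by (rule evb_weaken[OF evb_related[OF assms(1-4)] refl])
    (unfold cost_filter_def, rule mult_le_mono1, use assms(5) in simp)

lemma evb_unrelated:
  assumes R: "implements k n c d R" and xs: "set xs \<subseteq> {..<n}" "length xs \<le> b"
    and ys: "set ys \<subseteq> {..<n}"
  shows "evb (prog k) [d, enc_nats xs, enc_nats ys] (prog k ! 8) (enc_nats (unrelated R xs ys))
    ((length ys + 1) * (cost_any c b + 30))"
  using ys
proof (induction ys)
  case Nil
  show ?case
    unfolding prog_nth body_unrelated_def
    by (rule evb_weaken, (rule evb_rules | simp add: run_simps unrelated_def enc_nats_simps)+)
next
  case (Cons y ys)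
  have IH: "evb (prog k) [d, enc_nats xs, enc_nats ys] (prog k ! 8) (enc_nats (unrelated R xs ys))
    ((length ys + 1) * (cost_any c b + 30))" using Cons by simp
  have any: "evb (prog k) [d, enc_nat y, enc_nats xs] (prog k ! 6) (enc_bool (\<exists>x\<in>set xs. R y x))
    (cost_any c b)"
    by (rule evb_any_le[OF R _ xs]) (use Cons.prems in simp)
  show ?case
  proof (cases "\<exists>x\<in>set xs. R y x")
    case True
    then have eq: "unrelated R xs (y # ys) = unrelated R xs ys" by (simp add: unrelated_def)
    show ?thesis
      unfolding prog_nth body_unrelated_def eq
      by (rule evb_weaken, (rule any IH evb_rules | simp add: run_simps True)+)
  next
    case False
    then have eq: "unrelated R xs (y # ys) = y # unrelated R xs ys" by (simp add: unrelated_def)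
    show ?thesis
      unfolding prog_nth body_unrelated_def eq
      by (rule evb_weaken, (rule any IH evb_rules | simp add: run_simps False)+)
  qed
qed

lemma evb_unrelated_le:
  assumes "implements k n c d R" "set xs \<subseteq> {..<n}" "length xs \<le> b" "set ys \<subseteq> {..<n}" "length ys \<le> b"
  shows "evb (prog k) [d, enc_nats xs, enc_nats ys] (prog k ! 8) (enc_nats (unrelated R xs ys)) (cost_filter c b)"
  by (rule evb_weaken[OF evb_unrelated[OF assms(1-4)] refl])
    (unfold cost_filter_def, rule mult_le_mono1, use assms(5) in simp)

lemma evb_append:
  "evb (prog k) [enc_nats xs, enc_nats ys] (prog k ! 9) (enc_nats (xs @ ys)) (10 * (length xs + 1))"
proof (induction xs)
  case Nil
  show ?case
    unfolding prog_nth body_append_def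
    by (rule evb_weaken, (rule evb_rules | simp add: run_simps)+)
next
  case (Cons x xs)
  show ?case
    unfolding prog_nth body_append_def
    by (rule evb_weaken, (rule Cons.IH evb_rules | simp add: run_simps)+)
qed

lemma evb_append_le:
  "length xs \<le> b \<Longrightarrow>
   evb (prog k) [enc_nats xs, enc_nats ys] (prog k ! 9) (enc_nats (xs @ ys)) (10 * (b + 1))"
  by (rule evb_weaken[OF evb_append refl]) simp

lemma evb_concat:
  "evb (prog k) [enc_lists Ls] (prog k ! 10) (enc_nats (concat Ls))
    (10 * length (concat Ls) + 30 * (length Ls + 1))"
proof (induction Ls)
  case Nil
  show ?case
    unfolding prog_nth body_concat_def
    by (rule evb_weaken, (rule evb_rules | simp add: run_simps enc_nats_simps)+)
next
  case (Cons N Ls)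
  show ?case
    unfolding prog_nth body_concat_def
    by (rule evb_weaken, (rule Cons.IH evb_append evb_rules | simp add: run_simps)+)
qed

lemma evb_concat_le:
  assumes "length (concat Ls) \<le> b" "length Ls \<le> b"
  shows "evb (prog k) [enc_lists Ls] (prog k ! 10) (enc_nats (concat Ls)) (40 * (b + 1))"
  by (rule evb_weaken[OF evb_concat refl]) (use assms in \<open>simp del: length_concat\<close>)

lemma evb_nat_expr: "evb P env (nat_expr j) (enc_nat j) (2 * j + 1)"
proof (induction j)
  case 0
  show ?case by (rule evb_weaken, (rule evb_rules | simp add: enc_nat_simps)+)
next
  case (Suc j)
  show ?case by (rule evb_weaken, (rule Suc.IH evb_rules | simp add: enc_nat_simps)+)
qed

lemma evb_times:
  assumes "length xs \<le> b"
  shows "evb (prog k) [enc_nat j, enc_nats xs] (prog k ! 11) (enc_nats (concat (replicate j xs)))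
    ((j + 1) * (10 * (b + 1) + 20))"
proof (induction j)
  case 0
  show ?case
    unfolding prog_nth body_times_def
    by (rule evb_weaken, (rule evb_rules | simp add: run_simps enc_nats_simps)+)
next
  case (Suc j)
  show ?case
    unfolding prog_nth body_times_def
    by (rule evb_weaken, (rule Suc.IH evb_append_le[OF assms] evb_rules | simp add: run_simps)+)
qed

lemma length_concat_replicate: "length (concat (replicate j xs)) = j * length xs"
  by (induction j) auto

lemma evb_shorter:
  "evb (prog k) [enc_nats xs, enc_nats ys] (prog k ! 12) (enc_bool (length xs < length ys))
    (20 * (length ys + 1))"
proof (induction ys arbitrary: xs)
  case Nil
  show ?case
    unfolding prog_nth body_shorter_def
    by (rule evb_weaken, (rule evb_rules | simp add: run_simps enc_bool_simps)+)
next
  case (Cons y ys)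
  show ?case
  proof (cases xs)
    case Nil
    show ?thesis
      unfolding prog_nth body_shorter_def Nil
      by (rule evb_weaken, (rule evb_rules | simp add: run_simps enc_bool_simps)+)
  next
    case (Cons x xs')
    show ?thesis
      unfolding prog_nth body_shorter_def Cons
      by (rule evb_weaken, (rule Cons.IH evb_rules | simp add: run_simps)+)
  qed
qed

lemma evb_shorter_le:
  assumes "length ys \<le> b"
  shows "evb (prog k) [enc_nats xs, enc_nats ys] (prog k ! 12) (enc_bool (length xs < length ys))
    (20 * (b + 1))"
  by (rule evb_weaken[OF evb_shorter refl]) (use assms in simp)

lemma evb_heads:
  assumes "\<And>c. c \<in> set cs \<Longrightarrow> c \<noteq> []"
  shows "evb (prog k) [enc_lists cs] (prog k ! 13) (enc_nats (map hd cs)) (20 * (length cs + 1))"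
  using assms
proof (induction cs)
  case Nil
  show ?case
    unfolding prog_nth body_heads_def
    by (rule evb_weaken, (rule evb_rules | simp add: run_simps enc_nats_simps)+)
next
  case (Cons c cs)
  have IH: "evb (prog k) [enc_lists cs] (prog k ! 13) (enc_nats (map hd cs)) (20 * (length cs + 1))"
    using Cons by simp
  have c: "c \<noteq> []" using Cons.prems by simp
  show ?case
    unfolding prog_nth body_heads_def
    by (rule evb_weaken, (rule IH evb_rules | simp add: run_simps head_eq_hd[OF c])+)
qed

definition cost_build :: "nat \<Rightarrow> nat \<Rightarrow> nat" where
  "cost_build c b = cost_any c b + 2 * cost_filter c b + 30 * (b + 1) + 100"

definition cost_indices :: "nat \<Rightarrow> nat \<Rightarrow> nat" where
  "cost_indices c b = 2 * cost_any c b + 60"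

definition cost_hit :: "nat \<Rightarrow> nat \<Rightarrow> nat \<Rightarrow> nat" where
  "cost_hit k c b = 3 * cost_filter c b + (k + 1) * (10 * (b + 1) + 20) +
     (k + 1) * (10 * (k * b + 1) + 20) + 4 * k + 30 * (b + 1) + 100"

text \<open>The additional first component tells the loop whether to stop. For \<open>IT\<close> and
  \<open>BD\<close>, what follows it is already the final output.\<close>

fun enc_outcome :: "outcome \<Rightarrow> data" where
  "enc_outcome (IT vs) = Branch (Branch Leaf Leaf) (enc_IT vs)"
| "enc_outcome (BD js ds) = Branch (Branch Leaf Leaf) (enc_BD js ds)"
| "enc_outcome (Continue M Ls) = Branch Leaf (Branch (enc_nats M) (enc_lists Ls))"

section \<open>Cost of building a layer and of searching for a hit\<close>

context partitioned_graph begin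

context
  fixes dE dS :: data and c :: nat
  assumes RE: "implements k n c dE E" and RS: "implements k n c dS S"
begin

text \<open>The sum \<open>length N + length ds\<close> does not increase during the recursion,
  since a scanned class adds at most one vertex. One bound \<open>b\<close> therefore serves all
  recursive calls.\<close>

lemma evb_build:
  assumes MXT: "set M \<subseteq> {..<n}" "set X \<subseteq> {..<n}" "set T \<subseteq> {..<n}" "length T \<le> b"
    and ds: "\<And>d. d \<in> set ds \<Longrightarrow> d \<noteq> [] \<and> set d \<subseteq> {..<n} \<and> length d \<le> b"
    and N: "set N \<subseteq> {..<n}" "length N + length ds + length X + length M \<le> b"
  shows "evb (prog k) [dE, dS, enc_nats M, enc_nats X, enc_nats T, enc_nats N, enc_lists ds] (prog k ! 14)
    (enc_nats (build M X T N ds)) ((length ds + 1) * cost_build c b)"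
  using ds N
proof (induction ds arbitrary: N)
  case Nil
  show ?case
    unfolding prog_nth body_build_def
    by (rule evb_weaken, (rule evb_rules | simp add: run_simps cost_build_def)+)
next
  case (Cons d ds)
  have d: "d \<noteq> []" "set d \<subseteq> {..<n}" "length d \<le> b" using Cons.prems(1) by auto
  have hd: "head d = hd d" using d(1) by (rule head_eq_hd)
  have hdn: "hd d < n" using hd_in_set[OF d(1)] d(2) by auto
  let ?D = "N @ X @ leaves M (N @ X)"
  let ?u = "unrelated E ?D d"
  have len: "length N + length X + length M \<le> b" using Cons.prems(3) by simp
  have lenD: "length ?D \<le> b" using len length_related_le[of E "N @ X" M] by simp
  have setD: "set ?D \<subseteq> {..<n}" using Cons.prems(2) MXT set_related_subset[of E "N @ X" M] by auto
  have any: "evb (prog k) [dS, enc_nat (hd d), enc_nats T] (prog k ! 6)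
      (enc_bool (\<exists>z\<in>set T. S (hd d) z)) (cost_any c b)"
    by (rule evb_any_le[OF RS hdn MXT(3,4)])
  have app1: "evb (prog k) [enc_nats N, enc_nats X] (prog k ! 9) (enc_nats (N @ X)) (10 * (b + 1))"
    by (rule evb_append_le) (use len in simp)
  have filt: "evb (prog k) [dE, enc_nats (N @ X), enc_nats M] (prog k ! 7)
      (enc_nats (leaves M (N @ X))) (cost_filter c b)"
    by (rule evb_related_le[OF RE]) (use len Cons.prems(2) MXT in auto)
  have app2: "evb (prog k) [enc_nats X, enc_nats (leaves M (N @ X))] (prog k ! 9)
      (enc_nats (X @ leaves M (N @ X))) (10 * (b + 1))"
    by (rule evb_append_le) (use len in simp)
  have app3: "evb (prog k) [enc_nats N, enc_nats (X @ leaves M (N @ X))] (prog k ! 9)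
      (enc_nats ?D) (10 * (b + 1))"
    by (rule evb_append_le) (use len in simp)
  have unrel: "evb (prog k) [dE, enc_nats ?D, enc_nats d] (prog k ! 8) (enc_nats ?u) (cost_filter c b)"
    by (rule evb_unrelated_le[OF RE setD lenD d(2,3)])
  have IH: "evb (prog k) [dE, dS, enc_nats M, enc_nats X, enc_nats T, enc_nats N', enc_lists ds] (prog k ! 14)
      (enc_nats (build M X T N' ds)) ((length ds + 1) * cost_build c b)"
    if "set N' \<subseteq> {..<n}" "length N' \<le> length N + 1" for N'
    by (rule Cons.IH) (use Cons.prems that in auto)
  note IH0 = IH[OF Cons.prems(2) le_add1]
  show ?case
  proof (cases "\<exists>z\<in>set T. S (hd d) z")
    case False
    have eq: "build M X T N (d # ds) = build M X T N ds" using False by simp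
    show ?thesis
      unfolding prog_nth body_build_def eq
      by (rule evb_weaken, (rule any IH0 evb_rules | simp add: run_simps hd False)+)
        (simp add: cost_build_def)
  next
    case True
    show ?thesis
    proof (cases ?u)
      case Nil
      have eq: "build M X T N (d # ds) = build M X T N ds" using True Nil by simp
      show ?thesis
        unfolding prog_nth body_build_def eq
        by (rule evb_weaken, (rule any app1 filt app2 app3 unrel IH0 evb_rules | simp add: run_simps hd True Nil)+)
          (simp add: cost_build_def)
    next
      case (Cons v vs)
      have eq: "build M X T N (d # ds) = build M X T (v # N) ds" using True Cons by simp
      have "v \<in> set ?u" using Cons by simp
      then have "v < n" using d(2) by (auto simp: set_unrelated)
      have IH1: "evb (prog k) [dE, dS, enc_nats M, enc_nats X, enc_nats T, enc_nats (v # N), enc_lists ds] (prog k ! 14)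
        (enc_nats (build M X T (v # N) ds)) ((length ds + 1) * cost_build c b)"
        by (rule IH) (use \<open>v < n\<close> \<open>set N \<subseteq> {..<n}\<close> in auto)
      show ?thesis
        unfolding prog_nth body_build_def eq
        by (rule evb_weaken, (rule any app1 filt app2 app3 unrel IH1 evb_rules | simp add: run_simps hd True Cons)+)
          (simp add: cost_build_def)
    qed
  qed
qed

lemma evb_class_indices:
  assumes T: "set T \<subseteq> {..<n}" "length T \<le> b" and N: "set N \<subseteq> {..<n}" "length N \<le> b"
    and ds: "\<And>d. d \<in> set ds \<Longrightarrow> d \<noteq> [] \<and> set d \<subseteq> {..<n}"
  shows "evb (prog k) [dS, enc_nats T, enc_nats N, enc_nat i, enc_lists ds] (prog k ! 15)
    (enc_nats (class_indices T N i ds)) ((length ds + 1) * cost_indices c b)"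
  using ds
proof (induction ds arbitrary: i)
  case Nil
  show ?case
    unfolding prog_nth body_class_indices_def Let_def
    by (rule evb_weaken, (rule evb_rules | simp add: run_simps cost_indices_def enc_nats_simps)+)
next
  case (Cons d ds)
  have d: "d \<noteq> []" "set d \<subseteq> {..<n}" using Cons.prems by auto
  have hd: "head d = hd d" using d(1) by (rule head_eq_hd)
  have hdn: "hd d < n" using hd_in_set[OF d(1)] d(2) by auto
  have IH: "evb (prog k) [dS, enc_nats T, enc_nats N, enc_nat (Suc i), enc_lists ds] (prog k ! 15)
    (enc_nats (class_indices T N (Suc i) ds)) ((length ds + 1) * cost_indices c b)"
    by (rule Cons.IH) (use Cons.prems in auto)
  note any = evb_any_le[OF RS hdn T] evb_any_le[OF RS hdn N]
  show ?case
  proof (cases "\<exists>z\<in>set T. S (hd d) z")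
    case False
    have eq: "class_indices T N i (d # ds) = class_indices T N (Suc i) ds" using False by simp
    show ?thesis
      unfolding prog_nth body_class_indices_def Let_def eq
      by (rule evb_weaken, (rule any IH evb_rules | simp add: run_simps hd False)+)
        (simp add: cost_indices_def)
  next
    case True
    show ?thesis
    proof (cases "\<exists>z\<in>set N. S (hd d) z")
      case True': True
      have eq: "class_indices T N i (d # ds) = class_indices T N (Suc i) ds" using True' by simp
      show ?thesis
        unfolding prog_nth body_class_indices_def Let_def eq
        by (rule evb_weaken, (rule any IH evb_rules | simp add: run_simps hd True True')+)
          (simp add: cost_indices_def)
    next
      case False
      have eq: "class_indices T N i (d # ds) = i # class_indices T N (Suc i) ds" using True False by simp
      show ?thesis
        unfolding prog_nth body_class_indices_def Let_def eq
        by (rule evb_weaken, (rule any IH evb_rules | simp add: run_simps hd True False)+)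
          (simp add: cost_indices_def)
    qed
  qed
qed

lemma evb_hit:
  assumes M: "set M \<subseteq> {..<n}" "length M \<le> b" and imm: "set imm \<subseteq> {..<n}" "length imm \<le> b"
    and a: "a < n" and b: "1 \<le> b"
    and Ls: "\<And>N. N \<in> set Ls \<Longrightarrow> set N \<subseteq> {..<n} \<and> length N \<le> b"
  shows "evb (prog k) [dE, dS, enc_nats M, enc_nats imm, enc_nat a, enc_lists Ls] (prog k ! 16)
    (enc_outcome (hit a M imm Ls)) ((length Ls + 1) * cost_hit k c b)"
  using Ls
proof (induction Ls)
  case Nil
  have filt: "evb (prog k) [dS, enc_nats [a], enc_nats imm] (prog k ! 7)
      (enc_nats (related S [a] imm)) (cost_filter c b)"
    by (rule evb_related_le[OF RS]) (use a b imm in auto)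
  show ?case
    unfolding prog_nth body_hit_def Let_def
    by (rule evb_weaken, (rule filt evb_rules | simp add: run_simps enc_lists_simps)+)
      (simp add: cost_hit_def)
next
  case (Cons N Ls)
  have N: "set N \<subseteq> {..<n}" "length N \<le> b" using Cons.prems by auto
  have IH: "evb (prog k) [dE, dS, enc_nats M, enc_nats imm, enc_nat a, enc_lists Ls] (prog k ! 16)
    (enc_outcome (hit a M imm Ls)) ((length Ls + 1) * cost_hit k c b)"
    by (rule Cons.IH) (use Cons.prems in auto)
  let ?y = "leaves M N"
  let ?q = "related S ?y imm"
  have y: "set ?y \<subseteq> {..<n}" "length ?y \<le> b"
    using M set_related_subset[of E N M] length_related_le[of E N M] by auto
  have q: "set ?q \<subseteq> {..<n}" "length ?q \<le> b"
    using imm set_related_subset[of S ?y imm] length_related_le[of S ?y imm] by auto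
  have f1: "evb (prog k) [dE, enc_nats N, enc_nats M] (prog k ! 7) (enc_nats ?y) (cost_filter c b)"
    by (rule evb_related_le[OF RE N M])
  have f2: "evb (prog k) [dS, enc_nats ?y, enc_nats imm] (prog k ! 7) (enc_nats ?q) (cost_filter c b)"
    by (rule evb_related_le[OF RS y imm])
  have f3: "evb (prog k) [dS, enc_nats ?q, enc_nats M] (prog k ! 8) (enc_nats (unrelated S ?q M)) (cost_filter c b)"
    by (rule evb_unrelated_le[OF RS q M])
  have app: "evb (prog k) [enc_nats ?q, enc_nats (unrelated S ?q M)] (prog k ! 9)
      (enc_nats (?q @ unrelated S ?q M)) (10 * (b + 1))"
    by (rule evb_append_le[OF q(2)])
  have t1: "evb (prog k) [enc_nat k, enc_nats ?q] (prog k ! 11) (enc_nats (concat (replicate k ?q)))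
      ((k + 1) * (10 * (b + 1) + 20))"
    by (rule evb_times[OF q(2)])
  have t2: "evb (prog k) [enc_nat k, enc_nats (concat (replicate k ?q))] (prog k ! 11)
      (enc_nats (concat (replicate k (concat (replicate k ?q))))) ((k + 1) * (10 * (k * b + 1) + 20))"
    by (rule evb_times) (use q(2) in \<open>simp add: length_concat_replicate del: length_concat\<close>)
  have sh: "evb (prog k) [enc_nats (concat (replicate k (concat (replicate k ?q)))), enc_nats ?y] (prog k ! 12)
      (enc_bool (k * (k * length ?q) < length ?y)) (20 * (b + 1))"
    using evb_shorter_le[OF y(2), of k "concat (replicate k (concat (replicate k ?q)))"]
    by (simp only: length_concat_replicate)
  show ?case
  proof (cases "?q = []")
    case True
    have eq: "hit a M imm (N # Ls) = hit a M imm Ls" using True by simp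
    show ?thesis
      unfolding prog_nth body_hit_def Let_def eq
      by (rule evb_weaken, (rule f1 f2 IH evb_rules | simp add: run_simps True)+)
        (simp add: cost_hit_def)
  next
    case False
    show ?thesis
    proof (cases "k * (k * length ?q) < length ?y")
      case True
      have eq: "hit a M imm (N # Ls) = hit a M imm Ls" using True by simp
      show ?thesis
        unfolding prog_nth body_hit_def Let_def eq
        by (rule evb_weaken, (rule f1 f2 t1 t2 sh evb_nat_expr IH evb_rules | simp add: run_simps True False)+)
          (simp add: cost_hit_def)
    next
      case nlt: False
      have eq: "hit a M imm (N # Ls) = Continue (?q @ unrelated S ?q M) (N # Ls)"
        using nlt False by (simp add: Let_def)
      show ?thesis
        unfolding prog_nth body_hit_def Let_def eq
        by (rule evb_weaken, (rule f1 f2 f3 app t1 t2 sh evb_nat_expr evb_rules | simp add: run_simps False nlt)+)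
          (simp add: cost_hit_def)
    qed
  qed
qed

end
end

definition cost_grow :: "nat \<Rightarrow> nat \<Rightarrow> nat \<Rightarrow> nat" where
  "cost_grow k c b = 2 * cost_filter c b + (b + 1) * cost_build c b + (b + 1) * cost_indices c b +
     (k + 1) * (10 * (b + 1) + 20) + 2 * k + 100 * (b + 1) + 200"

definition cost_tick :: "nat \<Rightarrow> nat \<Rightarrow> nat \<Rightarrow> nat" where
  "cost_tick k c b = 4 * cost_filter c b + cost_grow k c b + (b + 1) * cost_hit k c b +
     (k + 1) * (10 * (b + 1) + 20) + (k + 1) * (10 * (k * b + 1) + 20) + 4 * k +
     100 * (b + 1) + 200"

context partitioned_graph begin

section \<open>Sizes of the states and cost of a round\<close>

lemma set_build_subset: "set (build M X T N ds) \<subseteq> set N \<union> \<Union>(set ` set ds)"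
proof (induction ds arbitrary: N)
  case Nil
  then show ?case by simp
next
  case (Cons d ds)
  let ?N = "if \<exists>z\<in>set T. S (hd d) z
      then (case unrelated E (N @ X @ leaves M (N @ X)) d of [] \<Rightarrow> N | v # _ \<Rightarrow> v # N) else N"
  have "set (unrelated E (N @ X @ leaves M (N @ X)) d) \<subseteq> set d" by (auto simp: unrelated_def)
  then have sub: "set ?N \<subseteq> set N \<union> set d" by (auto split: list.split)
  have "set (build M X T N (d # ds)) \<subseteq> set ?N \<union> \<Union>(set ` set ds)"
    unfolding build.simps by (rule Cons)
  also have "\<dots> \<subseteq> (set N \<union> set d) \<union> \<Union>(set ` set ds)" using sub by blast
  finally show ?case by (simp add: Un_assoc)
qed

lemma length_build_le: "length (build M X T N ds) \<le> length N + length ds"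
proof (induction ds arbitrary: N)
  case Nil
  then show ?case by simp
next
  case (Cons d ds)
  let ?N = "if \<exists>z\<in>set T. S (hd d) z
      then (case unrelated E (N @ X @ leaves M (N @ X)) d of [] \<Rightarrow> N | v # _ \<Rightarrow> v # N) else N"
  have "length ?N \<le> length N + 1" by (auto split: list.split)
  then show ?case using Cons[of ?N] by simp
qed

lemma class_facts:
  assumes "d \<in> set cs"
  shows "d \<noteq> [] \<and> set d \<subseteq> {..<n} \<and> length d \<le> n"
proof -
  have "distinct d" using assms by (auto simp: cs_def)
  moreover have "set d \<subseteq> V" using cs_subset assms by blast
  ultimately have "length d \<le> n" using card_mono[OF finite_V] by (metis distinct_card)
  then show ?thesis using cs_nonempty assms \<open>set d \<subseteq> V\<close> verts by blast
qed

text \<open>At most \<open>n + 1\<close> layers with at most \<open>n\<close> centres each give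
  \<open>n * (n + 1)\<close> centres; a new layer and the leaves still fit into the square.\<close>

abbreviation "size_bound \<equiv> (n + 2) * (n + 2)"

definition small_state :: "nat list list \<Rightarrow> bool" where
  "small_state Ls \<longleftrightarrow> (\<forall>N\<in>set Ls. set N \<subseteq> {..<n} \<and> length N \<le> n) \<and> length Ls \<le> n + 1 \<and>
     length (concat Ls) \<le> n * (n + 1)"

text \<open>Every stuck layer has at least one leaf of its own. This linear bound is enough for
  sizes; the logarithmic one matters only in the potential.\<close>

lemma layers_le_leaves:
  assumes "layered a M Ls" "stuck M Ls"
  shows "length Ls \<le> length (leaves M (concat Ls))"
  using assms
proof (induction Ls)
  case Nil
  then show ?case by simp
next
  case (Cons N R)
  then have ok: "layer_ok a M N (concat R)" and IH: "length R \<le> length (leaves M (concat R))" by auto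
  have "length (leaves M (N @ concat R)) = length (leaves M N) + length (leaves M (concat R))"
    using layer_okD(6)[OF ok] by (rule length_leaves_append)
  then show ?case using stuck_layer(1)[OF ok Cons.prems(2)] IH by simp
qed

lemma length_M_le: "partial M \<Longrightarrow> length M \<le> n"
  using partial_length length_cs le_trans by blast

lemma small_state:
  assumes M: "partial M" and lay: "layered a M Ls"
  shows "small_state Ls"
proof -
  have each: "\<forall>N\<in>set Ls. set N \<subseteq> V \<and> length N \<le> n"
    using lay
  proof (induction Ls)
    case Nil
    then show ?case by simp
  next
    case (Cons N R)
    then have ok: "layer_ok a M N (concat R)" by simp
    have "length N \<le> n"
      using layer_okD(2,3)[OF ok] card_mono[OF finite_V] by (metis distinct_card)
    then show ?case using Cons layer_okD(2)[OF ok] by simp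
  qed
  have len: "length Ls \<le> n + 1"
  proof (cases Ls)
    case Nil
    then show ?thesis by simp
  next
    case (Cons N R)
    then have "length R \<le> length (leaves M (concat R))"
      using lay layers_le_leaves[of a M R] by simp
    also have "\<dots> \<le> n" using length_related_le[of E "concat R" M] length_M_le[OF M] by linarith
    finally show ?thesis using Cons by simp
  qed
  have "length (concat Ls) \<le> n * length Ls"
    using each
  proof (induction Ls)
    case (Cons N R)
    then have "length N \<le> n" "length (concat R) \<le> n * length R" by auto
    then show ?case by simp
  qed simp
  also have "\<dots> \<le> n * (n + 1)" using len by (rule mult_le_mono2)
  finally show ?thesis unfolding small_state_def using each len verts by blast
qed

definition good_output :: "data \<Rightarrow> bool" where
  "good_output out \<longleftrightarrow> (\<exists>vs. out = enc_IT vs \<and> independent_transversal G (set Vs) (set vs)) \<or>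
     (\<exists>js ds. out = enc_BD js ds \<and> small_dominator js ds)"

context
  fixes dE dS :: data and c :: nat
  assumes RE: "implements k n c dE E" and RS: "implements k n c dS S"
begin

lemma evb_grow:
  assumes M: "set M \<subseteq> {..<n}" "length M \<le> n" and a: "a < n" and Ls: "small_state Ls"
  shows "evb (prog k) [dE, dS, enc_lists cs, enc_nat a, enc_nats M, enc_lists Ls] (prog k ! 17)
    (enc_outcome (grow a M Ls)) (cost_grow k c size_bound)"
proof -
  define b where "b = size_bound"
  define X where "X = concat Ls"
  define y where "y = leaves M X"
  define N where "N = build M X (a # y) [] cs"
  have bn: "b = n * n + 4 * n + 4" by (simp add: b_def algebra_simps)
  have lX: "length X \<le> n * n + n" using Ls by (simp add: small_state_def X_def algebra_simps del: length_concat)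
  have lLs: "length Ls \<le> b" using Ls bn by (simp add: small_state_def)
  have sX: "set X \<subseteq> {..<n}" using Ls by (auto simp: small_state_def X_def)
  have y: "set y \<subseteq> {..<n}" "length y \<le> n"
    using M set_related_subset[of E X M] length_related_le[of E X M] by (auto simp: y_def)
  have T: "set (a # y) \<subseteq> {..<n}" "length (a # y) \<le> b" using y a bn by auto
  have N: "set N \<subseteq> {..<n}" "length N \<le> n"
    using set_build_subset[of M X "a # y" "[]" cs] length_build_le[of M X "a # y" "[]" cs]
      class_facts length_cs unfolding N_def by (fastforce, simp)
  have NX: "set (N @ X) \<subseteq> {..<n}" "length (N @ X) \<le> b" using N sX lX bn by auto
  have Mb: "length M \<le> b" "length X \<le> b" "length N \<le> b" "length y \<le> b" using M lX N y bn by auto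
  have ccs: "length cs \<le> b" using length_cs bn by linarith
  have f0: "evb (prog k) [enc_lists Ls] (prog k ! 10) (enc_nats X) (40 * (b + 1))"
    unfolding X_def by (rule evb_concat_le) (use Mb(2) lLs in \<open>simp_all add: X_def del: length_concat\<close>)
  have f1: "evb (prog k) [dE, enc_nats X, enc_nats M] (prog k ! 7) (enc_nats y) (cost_filter c b)"
    unfolding y_def by (rule evb_related_le[OF RE sX Mb(2) M(1) Mb(1)])
  have "evb (prog k) [dE, dS, enc_nats M, enc_nats X, enc_nats (a # y), enc_nats [], enc_lists cs] (prog k ! 14)
      (enc_nats N) ((length cs + 1) * cost_build c b)"
    unfolding N_def
  proof (rule evb_build[OF RE RS M(1) sX T])
    show "d \<noteq> [] \<and> set d \<subseteq> {..<n} \<and> length d \<le> b" if "d \<in> set cs" for d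
      using class_facts[OF that] bn by auto
    show "length [] + length cs + length X + length M \<le> b" using length_cs lX M(2) bn by simp
  qed simp
  then have f2: "evb (prog k) [dE, dS, enc_nats M, enc_nats X, enc_nats (a # y), Leaf, enc_lists cs] (prog k ! 14)
      (enc_nats N) ((length cs + 1) * cost_build c b)"
    by (simp only: enc_nats_simps(1))
  have f3: "evb (prog k) [enc_nat k, enc_nats N] (prog k ! 11) (enc_nats (concat (replicate k N)))
      ((k + 1) * (10 * (b + 1) + 20))" by (rule evb_times[OF Mb(3)])
  have f4: "evb (prog k) [enc_nats (concat (replicate k N)), enc_nats y] (prog k ! 12)
      (enc_bool (k * length N < length y)) (20 * (b + 1))"
    using evb_shorter_le[OF Mb(4), of k "concat (replicate k N)"] by (simp only: length_concat_replicate)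
  have "evb (prog k) [dS, enc_nats (a # y), enc_nats N, enc_nat 0, enc_lists cs] (prog k ! 15)
      (enc_nats (class_indices (a # y) N 0 cs)) ((length cs + 1) * cost_indices c b)"
    by (rule evb_class_indices[OF RE RS T N(1) Mb(3)]) (use class_facts in blast)
  then have f5: "evb (prog k) [dS, enc_nats (a # y), enc_nats N, Leaf, enc_lists cs] (prog k ! 15)
      (enc_nats (class_indices (a # y) N 0 cs)) ((length cs + 1) * cost_indices c b)"
    by (simp only: enc_nat_simps(1))
  have f6: "evb (prog k) [enc_nats N, enc_nats X] (prog k ! 9) (enc_nats (N @ X)) (10 * (b + 1))"
    by (rule evb_append_le[OF Mb(3)])
  have f7: "evb (prog k) [dE, enc_nats (N @ X), enc_nats M] (prog k ! 7) (enc_nats (leaves M (N @ X))) (cost_filter c b)"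
    by (rule evb_related_le[OF RE NX M(1) Mb(1)])
  have f8: "evb (prog k) [enc_nats X, enc_nats (leaves M (N @ X))] (prog k ! 9)
      (enc_nats (X @ leaves M (N @ X))) (10 * (b + 1))" by (rule evb_append_le[OF Mb(2)])
  have f9: "evb (prog k) [enc_nats N, enc_nats (X @ leaves M (N @ X))] (prog k ! 9)
      (enc_nats (N @ X @ leaves M (N @ X))) (10 * (b + 1))" by (rule evb_append_le[OF Mb(3)])
  define C1 where "C1 = (b + 1) * cost_build c b"
  define C2 where "C2 = (b + 1) * cost_indices c b"
  define C3 where "C3 = (k + 1) * (10 * (b + 1) + 20)"
  have "(length cs + 1) * cost_build c b \<le> C1" "(length cs + 1) * cost_indices c b \<le> C2"
    unfolding C1_def C2_def by (rule mult_le_mono1, use ccs in simp)+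
  note f2 = evb_weaken[OF f2 refl this(1)] and f5 = evb_weaken[OF f5 refl this(2)]
  note f3 = f3[folded C3_def]
  have cost: "2 * cost_filter c b + C1 + C2 + C3 + 2 * k + 100 * (b + 1) + 200 = cost_grow k c b"
    by (simp add: cost_grow_def C1_def C2_def C3_def)
  have g: "grow a M Ls = (if k * length N < length y
      then BD (class_indices (a # y) N 0 cs) (N @ X @ leaves M (N @ X)) else Continue M (N # Ls))"
    unfolding grow_def Let_def X_def y_def N_def ..
  show ?thesis
  proof (cases "k * length N < length y")
    case True
    have eq: "grow a M Ls = BD (class_indices (a # y) N 0 cs) (N @ X @ leaves M (N @ X))"
      using g True by simp
    show ?thesis
      unfolding prog_nth body_grow_def eq b_def[symmetric]
      apply (rule evb_weaken)
      apply (rule f0 f1 f2 f3 f4 f5 f6 f7 f8 f9 evb_nat_expr evb_rules | simp add: run_simps True)+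
       apply (simp add: enc_BD_def enc_bool_simps)
      apply (use cost in simp)
      done
  next
    case False
    have eq: "grow a M Ls = Continue M (N # Ls)" using g False by simp
    show ?thesis
      unfolding prog_nth body_grow_def eq b_def[symmetric]
      apply (rule evb_weaken)
      apply (rule f0 f1 f2 f3 f4 evb_nat_expr evb_rules | simp add: run_simps False)+
      apply (use cost in simp)
      done
  qed
qed

lemma evb_tick:
  assumes ok: "state_ok M Ls"
  shows "evb (prog k) [dE, dS, enc_lists cs, enc_nats M, enc_lists Ls] (prog k ! 18)
    (enc_outcome (tick M Ls)) (cost_tick k c size_bound)"
proof -
  define b where "b = size_bound"
  have bn: "b = n * n + 4 * n + 4" by (simp add: b_def algebra_simps)
  have pM: "partial M" using ok by (simp add: state_ok_def)
  have M: "set M \<subseteq> {..<n}" "length M \<le> n" using partialD(1)[OF pM] verts length_M_le[OF pM] by blast+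
  have Mb: "length M \<le> b" using M bn by simp
  have ccs: "length cs \<le> n" by (rule length_cs)
  let ?h = "map hd cs"
  have "hd ` set cs \<subseteq> {..<n}" using class_facts hd_cs by blast
  then have h: "set ?h \<subseteq> {..<n}" "length ?h \<le> b" using ccs bn by simp_all
  have f0: "evb (prog k) [enc_lists cs] (prog k ! 13) (enc_nats ?h) (20 * (length cs + 1))"
    by (rule evb_heads) (use class_facts in blast)
  let ?u = "unrelated S M ?h"
  have f1: "evb (prog k) [dS, enc_nats M, enc_nats ?h] (prog k ! 8) (enc_nats ?u) (cost_filter c b)"
    by (rule evb_unrelated_le[OF RS M(1) Mb h])
  have cb: "length cs \<le> b" using ccs bn by simp
  define C3 where "C3 = (k + 1) * (10 * (b + 1) + 20)"
  define C4 where "C4 = (k + 1) * (10 * (k * b + 1) + 20)"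
  define C5 where "C5 = (b + 1) * cost_hit k c b"
  have cost: "4 * cost_filter c b + cost_grow k c b + C5 + C3 + C4 + 4 * k + 100 * (b + 1) + 200 =
      cost_tick k c b"
    by (simp add: cost_tick_def C3_def C4_def C5_def)
  show ?thesis
  proof (cases ?u)
    case Nil
    have eq: "tick M Ls = IT M" by (simp add: tick_def Nil)
    show ?thesis
      unfolding prog_nth body_tick_def Let_def eq b_def[symmetric]
      apply (rule evb_weaken)
      apply (rule f0 f1 evb_rules | simp add: run_simps Nil)+
       apply (simp add: enc_IT_def enc_bool_simps)
      apply (use cb cost in simp)
      done
  next
    case (Cons a as)
    have lay: "layered a M Ls" using ok Cons by (simp add: state_ok_def)
    have "uncovered M a" using Cons by (rule root_uncovered)
    then have a: "a < n" using verts by (auto simp: uncovered_def)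
    have small: "small_state Ls" by (rule small_state[OF pM lay])
    note fg = evb_grow[OF M a small, folded b_def]
    show ?thesis
    proof (cases Ls)
      case Nil
      have eq: "tick M Ls = grow a M Ls" by (simp add: tick_def Cons Nil)
      show ?thesis
        unfolding prog_nth body_tick_def Let_def eq b_def[symmetric]
        apply (rule evb_weaken)
        apply (rule f0 f1 fg[unfolded Nil] evb_rules | simp add: run_simps Nil Cons)+
        apply (use cb cost in simp)
        done
    next
      case Ls: (Cons N R)
      have NR: "set N \<subseteq> {..<n}" "length N \<le> n" "length R \<le> n"
        "\<And>N. N \<in> set R \<Longrightarrow> set N \<subseteq> {..<n} \<and> length N \<le> n"
        "length (concat R) \<le> n * n + n"
        using small by (auto simp: small_state_def Ls algebra_simps)
      have cR: "length (concat R) \<le> b" "length R \<le> b" "length N \<le> b" using NR bn by linarith+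
      have sR: "set (concat R) \<subseteq> {..<n}" using NR(4) by auto
      let ?i = "unrelated E M N" and ?y = "leaves M (concat R)"
      have i: "set ?i \<subseteq> {..<n}" "length ?i \<le> b"
        using NR(1) length_unrelated_le[of E M N] cR(3) by (auto simp: set_unrelated)
      have y: "length ?y \<le> b" using length_related_le[of E "concat R" M] Mb by linarith
      have f2: "evb (prog k) [dE, enc_nats M, enc_nats N] (prog k ! 8) (enc_nats ?i) (cost_filter c b)"
        by (rule evb_unrelated_le[OF RE M(1) Mb NR(1) cR(3)])
      have t1: "evb (prog k) [enc_nat k, enc_nats ?i] (prog k ! 11) (enc_nats (concat (replicate k ?i)))
          ((k + 1) * (10 * (b + 1) + 20))"
        by (rule evb_times[OF i(2)])
      have t2: "evb (prog k) [enc_nat k, enc_nats (concat (replicate k ?i))] (prog k ! 11)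
          (enc_nats (concat (replicate k (concat (replicate k ?i))))) ((k + 1) * (10 * (k * b + 1) + 20))"
        by (rule evb_times) (use i(2) in \<open>simp add: length_concat_replicate del: length_concat\<close>)
      have f3: "evb (prog k) [enc_lists R] (prog k ! 10) (enc_nats (concat R)) (40 * (b + 1))"
        by (rule evb_concat_le[OF cR(1,2)])
      have f4: "evb (prog k) [dE, enc_nats (concat R), enc_nats M] (prog k ! 7) (enc_nats ?y) (cost_filter c b)"
        by (rule evb_related_le[OF RE sR cR(1) M(1) Mb])
      have sh: "evb (prog k) [enc_nats (concat (replicate k (concat (replicate k ?i)))), enc_nats ?y] (prog k ! 12)
          (enc_bool (k * (k * length ?i) < length ?y)) (20 * (b + 1))"
        using evb_shorter_le[OF y, of k "concat (replicate k (concat (replicate k ?i)))"]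
        by (simp only: length_concat_replicate)
      have fh: "evb (prog k) [dE, dS, enc_nats M, enc_nats ?i, enc_nat a, enc_lists R] (prog k ! 16)
          (enc_outcome (hit a M ?i R)) ((length R + 1) * cost_hit k c b)"
        by (rule evb_hit[OF RE RS M(1) Mb i a]) (use NR(4) bn in fastforce)+
      have "(length R + 1) * cost_hit k c b \<le> C5"
        unfolding C5_def by (rule mult_le_mono1) (use cR in simp)
      note fh = evb_weaken[OF fh refl this]
      note t1 = t1[folded C3_def] and t2 = t2[folded C4_def]
      note fg' = fg[unfolded Ls]
      show ?thesis
      proof (cases "?i = []")
        case True
        have eq: "tick M (N # R) = grow a M (N # R)" by (simp add: tick_def Cons Ls True)
        show ?thesis
          unfolding prog_nth body_tick_def Let_def eq b_def[symmetric] Ls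
          apply (rule evb_weaken)
          apply (rule f0 f1 f2 fg' evb_rules | simp add: run_simps Cons True)+
          apply (use cb cost in simp)
          done
      next
        case ne: False
        show ?thesis
        proof (cases "k * (k * length ?i) < length ?y")
          case True
          have eq: "tick M (N # R) = grow a M (N # R)" using True by (simp add: tick_def Cons Ls)
          show ?thesis
            unfolding prog_nth body_tick_def Let_def eq b_def[symmetric] Ls
            apply (rule evb_weaken)
            apply (rule f0 f1 f2 f3 f4 t1 t2 sh fg' evb_nat_expr evb_rules | simp add: run_simps Cons True ne)+
            apply (use cb cost in simp)
            done
        next
          case False
          have eq: "tick M (N # R) = hit a M ?i R" using False ne by (simp add: tick_def Cons Ls)
          show ?thesis
            unfolding prog_nth body_tick_def Let_def eq b_def[symmetric] Ls
            apply (rule evb_weaken)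
            apply (rule f0 f1 f2 f3 f4 t1 t2 sh fh evb_nat_expr evb_rules | simp add: run_simps Cons False ne)+
            apply (use cb cost in simp)
            done
        qed
      qed
    qed
  qed
qed

text \<open>The potential is a natural number that drops in every unfinished round, so it bounds the
  number of further rounds.\<close>

lemma evb_loop:
  assumes "state_ok M Ls"
  shows "\<exists>out. evb (prog k) [dE, dS, enc_lists cs, enc_nats M, enc_lists Ls] (prog k ! 19) out
      ((potential M Ls + 1) * (cost_tick k c size_bound + 30)) \<and> good_output out"
  using assms
proof (induction "potential M Ls" arbitrary: M Ls rule: less_induct)
  case less
  define K where "K = cost_tick k c size_bound"
  note ft = evb_tick[OF less.prems, folded K_def]
  note tc = tick_correct[OF less.prems]
  have K: "K + 30 \<le> (potential M Ls + 1) * (K + 30)" by simp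
  have "\<exists>out. evb (prog k) [dE, dS, enc_lists cs, enc_nats M, enc_lists Ls] (prog k ! 19) out
      ((potential M Ls + 1) * (K + 30)) \<and> good_output out"
  proof (cases "tick M Ls")
    case (IT vs)
    have "evb (prog k) [dE, dS, enc_lists cs, enc_nats M, enc_lists Ls] (prog k ! 19) (enc_IT vs)
        ((potential M Ls + 1) * (K + 30))"
      unfolding prog_nth body_loop_def
      apply (rule evb_weaken)
      apply (rule ft[unfolded IT] evb_rules | simp add: run_simps)+
      apply (use K in linarith)
      done
    then show ?thesis using tc unfolding good_output_def IT outcome.case by blast
  next
    case (BD js ds)
    have "evb (prog k) [dE, dS, enc_lists cs, enc_nats M, enc_lists Ls] (prog k ! 19) (enc_BD js ds)
        ((potential M Ls + 1) * (K + 30))"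
      unfolding prog_nth body_loop_def
      apply (rule evb_weaken)
      apply (rule ft[unfolded BD] evb_rules | simp add: run_simps)+
      apply (use K in linarith)
      done
    moreover have "small_dominator js ds" using tc unfolding BD outcome.case .
    ultimately show ?thesis unfolding good_output_def by blast
  next
    case (Continue M' Ls')
    have ok: "state_ok M' Ls'" and lt: "potential M' Ls' < potential M Ls"
      using tc unfolding Continue by auto
    obtain out where out: "evb (prog k) [dE, dS, enc_lists cs, enc_nats M', enc_lists Ls'] (prog k ! 19) out
      ((potential M' Ls' + 1) * (K + 30))" "good_output out"
      using less.hyps[OF lt ok, folded K_def] by blast
    have "(potential M' Ls' + 1) * (K + 30) + (K + 30) = (potential M' Ls' + 2) * (K + 30)"
      by (simp add: algebra_simps)
    also have "\<dots> \<le> (potential M Ls + 1) * (K + 30)" using lt by (intro mult_le_mono1) simp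
    finally have le: "(potential M' Ls' + 1) * (K + 30) + (K + 30) \<le> (potential M Ls + 1) * (K + 30)" .
    have "evb (prog k) [dE, dS, enc_lists cs, enc_nats M, enc_lists Ls] (prog k ! 19) out
        ((potential M Ls + 1) * (K + 30))"
      unfolding prog_nth body_loop_def
      apply (rule evb_weaken)
      apply (rule ft[unfolded Continue] out(1) evb_rules | simp add: run_simps)+
      apply (use le in linarith)
      done
    then show ?thesis using out(2) by blast
  qed
  then show ?case unfolding K_def .
qed

end
end

section \<open>The polynomial bound\<close>

definition poly_bounded :: "(nat \<Rightarrow> nat) \<Rightarrow> bool" where
  "poly_bounded f \<longleftrightarrow> (\<exists>p :: nat poly. \<forall>n. f n \<le> poly p n)"

lemma poly_bounded_const: "poly_bounded (\<lambda>n. a)"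
  unfolding poly_bounded_def by (rule exI[of _ "[:a:]"]) simp

lemma poly_bounded_id: "poly_bounded (\<lambda>n. n)"
  unfolding poly_bounded_def by (rule exI[of _ "[:0, 1:]"]) simp

lemma poly_bounded_add:
  assumes "poly_bounded f" "poly_bounded g"
  shows "poly_bounded (\<lambda>n. f n + g n)"
proof -
  obtain p q where "\<And>n. f n \<le> poly p n" "\<And>n. g n \<le> poly q n"
    using assms unfolding poly_bounded_def by blast
  then show ?thesis unfolding poly_bounded_def
    by (intro exI[of _ "p + q"]) (simp add: add_mono)
qed

lemma poly_bounded_mult:
  assumes "poly_bounded f" "poly_bounded g"
  shows "poly_bounded (\<lambda>n. f n * g n)"
proof -
  obtain p q where "\<And>n. f n \<le> poly p n" "\<And>n. g n \<le> poly q n"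
    using assms unfolding poly_bounded_def by blast
  then show ?thesis unfolding poly_bounded_def
    by (intro exI[of _ "p * q"]) (simp add: mult_le_mono)
qed

lemma poly_bounded_power:
  assumes "poly_bounded f"
  shows "poly_bounded (\<lambda>n. f n ^ e)"
  by (induction e) (simp_all add: poly_bounded_const poly_bounded_mult assms)

lemma poly_bounded_mono: "poly_bounded g \<Longrightarrow> (\<And>n. f n \<le> g n) \<Longrightarrow> poly_bounded f"
  unfolding poly_bounded_def using le_trans by blast

lemmas poly_bounded_intros = poly_bounded_const poly_bounded_id poly_bounded_add poly_bounded_mult
  poly_bounded_power

text \<open>Write \<open>a < rate k ^ e\<close>; then \<open>a ^ depth k n\<close> is about \<open>(rate k ^ depth k n) ^ e\<close>, about \<open>n ^ e\<close>.\<close>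

lemma poly_bounded_power_depth:
  assumes k: "k \<ge> 3" and a: "0 < a"
  shows "poly_bounded (\<lambda>n. a ^ depth k n)"
proof -
  obtain e where e: "real a < rate k ^ e" using real_arch_pow rate_gt_1[OF k] by blast
  have le: "a ^ depth k n \<le> a * a * (n + 1) ^ e" for n
  proof (cases "LEAST l. real n < rate k ^ l")
    case 0
    have "1 \<le> a * (n + 1) ^ e" using a by (simp add: Suc_le_eq One_nat_def)
    then have "a * 1 \<le> a * (a * (n + 1) ^ e)" by (rule mult_le_mono2)
    then show ?thesis unfolding depth_def 0 by simp
  next
    case (Suc l)
    have "\<not> real n < rate k ^ l"
      by (rule not_less_Least) (simp add: Suc)
    then have n: "rate k ^ l \<le> real n" by simp
    have "real (a ^ l) \<le> (rate k ^ e) ^ l"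
      unfolding of_nat_power using e by (intro power_mono) auto
    also have "\<dots> = (rate k ^ l) ^ e" by (simp add: power_mult[symmetric] mult.commute)
    also have "\<dots> \<le> real n ^ e" using n rate_gt_1[OF k] by (intro power_mono) auto
    also have "\<dots> \<le> real ((n + 1) ^ e)" unfolding of_nat_power by (intro power_mono) auto
    finally have "a ^ l \<le> (n + 1) ^ e" by (simp only: of_nat_le_iff)
    then have "a * a * a ^ l \<le> a * a * (n + 1) ^ e" by (rule mult_le_mono2)
    then show ?thesis unfolding depth_def Suc by (simp add: mult.assoc)
  qed
  have "poly_bounded (\<lambda>n. a * a * (n + 1) ^ e)" by (intro poly_bounded_intros)
  then show ?thesis using le by (rule poly_bounded_mono)
qed

text \<open>The first factor bounds the number of rounds: initially at most \<open>n\<close> classes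
  are missed and the stack is empty, and each missed class as well as the empty stack is worth one
  power \<open>base ^ L\<close>.\<close>

definition cost_main :: "nat \<Rightarrow> nat \<Rightarrow> nat \<Rightarrow> nat" where
  "cost_main r k n = ((n + 1) * (hit_bound r k + 2) ^ depth k n + 1) *
     (cost_tick k (cost_rel n) ((n + 2) * (n + 2)) + 30) + 30"

lemma poly_bounded_cost_main:
  assumes "k \<ge> 3"
  shows "poly_bounded (cost_main r k)"
proof -
  have pos: "0 < hit_bound r k + 2" by simp
  show ?thesis
    unfolding cost_main_def cost_tick_def cost_grow_def cost_hit_def cost_build_def
      cost_indices_def cost_filter_def cost_any_def cost_rel_def cost_same_class_def
    by (intro poly_bounded_intros poly_bounded_power_depth[OF assms pos])
qed

context partitioned_graph begin

lemma main_correct: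
  "\<exists>out t. runs (prog k) (enc_input G Vs) out t \<and> t \<le> cost_main r k n \<and> good_output out"
proof -
  let ?mat = "enc_list (map (\<lambda>u. enc_list (map (\<lambda>v. enc_bool ((u, v) \<in> parcs G)) [0..<n])) [0..<n])"
  let ?dE = "Branch Leaf ?mat" and ?dS = "Branch (Branch Leaf Leaf) (enc_lists cs)"
  have inp: "enc_input G Vs = Branch ?mat (enc_lists cs)"
    by (simp add: enc_input_def Let_def cs_def enc_lists_def comp_def)
  have "E = (\<lambda>u v. (u, v) \<in> parcs G)" by (intro ext) (simp add: E_def)
  then have RE: "implements k n (cost_rel n) ?dE E" using implements_matrix by simp
  have "S = (\<lambda>u v. \<exists>c\<in>set cs. u \<in> set c \<and> v \<in> set c)" by (intro ext) (simp add: S_def)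
  then have RS: "implements k n (cost_rel n) ?dS S"
    using implements_same_class[OF length_cs, of k] class_facts by simp
  have "state_ok [] []" by (rule state_ok_Nil) (simp add: partial_def)
  from evb_loop[OF RE RS this] obtain out where
    out: "evb (prog k) [?dE, ?dS, enc_lists cs, Leaf, Leaf] (prog k ! 19) out
      ((potential [] [] + 1) * (cost_tick k (cost_rel n) size_bound + 30))" "good_output out"
    unfolding enc_nats_simps(1) enc_lists_simps(1) by blast
  have "potential [] [] = (length cs + 1) * base ^ L"
    by (simp add: potential_def algebra_simps)
  also have "\<dots> \<le> (n + 1) * base ^ L" using length_cs by (intro mult_le_mono1) simp
  finally have pot: "(potential [] [] + 1) * (cost_tick k (cost_rel n) size_bound + 30)
      \<le> ((n + 1) * base ^ L + 1) * (cost_tick k (cost_rel n) size_bound + 30)"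
    by (intro mult_le_mono1) simp
  note out' = evb_weaken[OF out(1) refl pot]
  have "evb (prog k) [enc_input G Vs] (prog k ! 0) out (cost_main r k n)"
    unfolding prog_nth body_main_def inp
    apply (rule evb_weaken)
    apply (rule out' evb_rules | simp add: length_prog)+
    apply (simp add: cost_main_def)
    done
  then obtain t where "t \<le> cost_main r k n" "eval (prog k) [enc_input G Vs] (prog k ! 0) out t"
    unfolding evb_def by blast
  moreover have "prog k \<noteq> []" by (simp add: prog_def)
  ultimately show ?thesis using out(2) unfolding runs_def by blast
qed

end

text \<open>From \<open>b - 1 \<ge> t - l\<close> and \<open>k * l < t\<close> follows
  \<open>(k - 1) * (b - 1) > (k - 2) * t\<close>. Scaled by \<open>k - 1\<close>, the
  \<open>e\<close> vertices outside the constellation cost at most \<open>(r + 2) * t\<close>, and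
  replacing \<open>2 * t\<close> by \<open>2 * (b - 1)\<close> costs at most another
  \<open>2 * t\<close>. This is the \<open>r + 4\<close> that \<open>\<epsilon> * (k - 2)\<close>
  has to exceed.\<close>

lemma epsilon_bounds:
  fixes \<epsilon> :: real and k l t e r b :: nat
  assumes eps: "\<epsilon> > 0" and k: "k \<ge> 3" "real r + 4 < \<epsilon> * (real k - 2)"
    and t: "0 < t" "k * l < t" "(k - 1) * e \<le> (r + 2) * t" "t + 1 \<le> b + l"
  shows "real e < \<epsilon> * (real b - 1)" "2 * real t + real e < (2 + \<epsilon>) * (real b - 1)"
proof -
  define q where "q = real k - 1"
  have q: "q \<ge> 2" using k(1) by (simp add: q_def)
  have "real (k * l) < real t" using t(2) by (simp only: of_nat_less_iff)
  then have "q * real l < real t" by (simp add: q_def algebra_simps)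
  moreover have "real t - real l \<le> real b - 1" using t(4) by linarith
  then have "q * (real t - real l) \<le> q * (real b - 1)" using q by (intro mult_left_mono) auto
  ultimately have B: "(q - 1) * real t < q * (real b - 1)" by (simp add: algebra_simps)
  have "real ((k - 1) * e) \<le> real ((r + 2) * t)" using t(3) by (simp only: of_nat_le_iff)
  then have e: "q * real e \<le> (real r + 2) * real t"
    using k(1) by (simp add: q_def of_nat_diff One_nat_def algebra_simps)
  have c: "(real r + 4) * real t < \<epsilon> * (q - 1) * real t"
    using k(2) t(1) by (intro mult_strict_right_mono) (auto simp: q_def algebra_simps)
  have eB: "\<epsilon> * ((q - 1) * real t) < \<epsilon> * (q * (real b - 1))"
    using B eps by (rule mult_strict_left_mono)
  have "(real r + 2) * real t \<le> (real r + 4) * real t" by (intro mult_right_mono) auto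
  then have "q * real e < q * (\<epsilon> * (real b - 1))"
    using e c eB by (simp add: algebra_simps)
  then show "real e < \<epsilon> * (real b - 1)" using q by simp
  have "q * (2 * real t + real e) < q * ((2 + \<epsilon>) * (real b - 1))"
    using e c eB B by (simp add: algebra_simps)
  then show "2 * real t + real e < (2 + \<epsilon>) * (real b - 1)" using q by simp
qed

context partitioned_graph begin

lemma small_dominator_bounds:
  fixes \<epsilon> :: real
  assumes dom: "small_dominator js ds" and \<epsilon>: "\<epsilon> > 0" "real r + 4 < \<epsilon> * (real k - 2)"
  defines "\<B> \<equiv> (\<lambda>i. Vs ! i) ` set js"
  shows "(\<forall>i\<in>set js. i < length Vs) \<and> set ds \<subseteq> pverts G \<and>
    totally_dominates G (set ds) (class_graph G \<B>) \<and>
    real (card (set ds)) < (2 + \<epsilon>) * (real (card \<B>) - 1) \<and>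
    (\<exists>\<B>\<^sub>0 K. \<B> \<subseteq> \<B>\<^sub>0 \<and> \<B>\<^sub>0 \<subseteq> set Vs \<and> constellation G \<B>\<^sub>0 K \<and>
       pverts K \<subseteq> set ds \<and> real (card (set ds - pverts K)) < \<epsilon> * (real (card \<B>) - 1))"
  using dom unfolding small_dominator_def \<B>_def[symmetric]
proof (elim exE conjE)
  fix t e l \<B>\<^sub>0 K
  assume t: "0 < t" "k * l < t" "(k - 1) * e \<le> (r + 2) * t" "t + 1 \<le> card \<B> + l"
    and ds: "\<forall>i\<in>set js. i < length Vs" "set ds \<subseteq> V" "totally_dominates G (set ds) (class_graph G \<B>)"
      "card (set ds) \<le> 2 * t + e"
    and K: "\<B> \<subseteq> \<B>\<^sub>0" "\<B>\<^sub>0 \<subseteq> set Vs" "constellation G \<B>\<^sub>0 K" "pverts K \<subseteq> set ds"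
      "card (set ds - pverts K) \<le> e"
  note bounds = epsilon_bounds[OF \<epsilon>(1) k_ge \<epsilon>(2) t]
  have "real (card (set ds)) < (2 + \<epsilon>) * (real (card \<B>) - 1)"
    using ds(4) bounds(2) by linarith
  moreover have "real (card (set ds - pverts K)) < \<epsilon> * (real (card \<B>) - 1)"
    using K(5) bounds(1) by linarith
  ultimately show ?thesis
    using ds(1-3) K(1-4) by (intro conjI exI[of _ \<B>\<^sub>0] exI[of _ K])
qed

end

theorem theorem3:
  fixes r :: nat and \<epsilon> :: real
  assumes "\<epsilon> > 0"
  shows "\<exists>(FindITorBD :: program) (p :: nat poly).
    \<forall>(G :: nat pair_pre_digraph) (Vs :: nat set list).
      pair_graph G \<and> pverts G = {..<card (pverts G)} \<and>
      vertex_partition G Vs \<and> claw_free_wrt r G (set Vs) \<longrightarrow>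
      (\<exists>out t.
        runs FindITorBD (enc_input G Vs) out t \<and> t \<le> poly p (card (pverts G)) \<and>
        ((\<exists>vs. out = enc_IT vs \<and> independent_transversal G (set Vs) (set vs)) \<or>
         (\<exists>is ds \<B> D.
            out = enc_BD is ds \<and> (\<forall>i\<in>set is. i < length Vs) \<and>
            \<B> = (\<lambda>i. Vs ! i) ` set is \<and> D = set ds \<and>
            D \<subseteq> pverts G \<and>
            totally_dominates G D (class_graph G \<B>) \<and>
            real (card D) < (2 + \<epsilon>) * (real (card \<B>) - 1) \<and>
            (\<exists>\<B>\<^sub>0 K. \<B> \<subseteq> \<B>\<^sub>0 \<and> \<B>\<^sub>0 \<subseteq> set Vs \<and> constellation G \<B>\<^sub>0 K \<and>
               pverts K \<subseteq> D \<and>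
               real (card (D - pverts K)) < \<epsilon> * (real (card \<B>) - 1)))))"
proof -
  obtain m :: nat where m: "(real r + 4) / \<epsilon> < real m" using reals_Archimedean2 by blast
  define k where "k = m + 3"
  have k: "k \<ge> 3" by (simp add: k_def)
  have "real r + 4 < \<epsilon> * real m" using m assms by (simp add: field_simps)
  also have "\<dots> \<le> \<epsilon> * (real k - 2)" using assms by (intro mult_left_mono) (auto simp: k_def)
  finally have kr: "real r + 4 < \<epsilon> * (real k - 2)" .
  obtain p :: "nat poly" where p: "\<forall>n. cost_main r k n \<le> poly p n"
    using poly_bounded_cost_main[OF k, of r] unfolding poly_bounded_def by (rule exE)
  show ?thesis
  proof (intro exI[of _ "prog k"] exI[of _ p] allI impI)
    fix G :: "nat pair_pre_digraph" and Vs :: "nat set list"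
    assume A: "pair_graph G \<and> pverts G = {..<card (pverts G)} \<and>
      vertex_partition G Vs \<and> claw_free_wrt r G (set Vs)"
    interpret partitioned_graph G Vs r k
      using A k by (elim conjE) (rule partitioned_graph.intro)
    obtain out t where run: "runs (prog k) (enc_input G Vs) out t" "t \<le> cost_main r k n"
      and good: "good_output out"
      using main_correct by blast
    have t: "t \<le> poly p n" using run(2) p[rule_format, of n] by (rule le_trans)
    show "\<exists>out t.
        runs (prog k) (enc_input G Vs) out t \<and> t \<le> poly p n \<and>
        ((\<exists>vs. out = enc_IT vs \<and> independent_transversal G (set Vs) (set vs)) \<or>
         (\<exists>is ds \<B> D.
            out = enc_BD is ds \<and> (\<forall>i\<in>set is. i < length Vs) \<and>
            \<B> = (\<lambda>i. Vs ! i) ` set is \<and> D = set ds \<and>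
            D \<subseteq> pverts G \<and>
            totally_dominates G D (class_graph G \<B>) \<and>
            real (card D) < (2 + \<epsilon>) * (real (card \<B>) - 1) \<and>
            (\<exists>\<B>\<^sub>0 K. \<B> \<subseteq> \<B>\<^sub>0 \<and> \<B>\<^sub>0 \<subseteq> set Vs \<and> constellation G \<B>\<^sub>0 K \<and>
               pverts K \<subseteq> D \<and>
               real (card (D - pverts K)) < \<epsilon> * (real (card \<B>) - 1))))"
      using good unfolding good_output_def
    proof (elim disjE exE conjE)
      fix vs assume "out = enc_IT vs" "independent_transversal G (set Vs) (set vs)"
      then show ?thesis
        using run(1) t by (intro exI[of _ out] exI[of _ t] conjI disjI1 exI[of _ vs])
    next
      fix js ds assume "out = enc_BD js ds" and dom: "small_dominator js ds"
      with small_dominator_bounds[OF dom assms kr] show ?thesis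
        by - (rule exI[of _ out], rule exI[of _ t], rule conjI, rule run(1), rule conjI, rule t,
            rule disjI2, rule exI[of _ js], rule exI[of _ ds], rule exI[of _ "(\<lambda>i. Vs ! i) ` set js"],
            rule exI[of _ "set ds"], intro conjI refl, (elim conjE, assumption)+)
    qed
  qed
qed

end
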